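(* Let $a<b$ be real, $\Omega=(a,b)$, and $1\le p<\infty$. For each $\epsilon>0$ define $F_\epsilon:L^p(\Omega)\to[-\infty,\infty]$ by $$F_\epsilon(u):=\begin{cases}\int_\Omega\epsilon^{-1}(u^2-1)^2+\epsilon^3|u''|^2\,dx,& u\in W^{2,p}(\Omega),\\ +\infty,&\text{otherwise.}\end{cases}$$ Let $(\epsilon_n)$ be positive reals with $\epsilon_n\to0^+$. Then, with respect to strong convergence in $L^p(\Omega)$, $F_{\epsilon_n}$ Gamma-converges to $$F(u)=\begin{cases}\alpha\operatorname{essVar}_\Omega u,& u\in BPV(\Omega;\{-1,1\}),\\ +\infty,&\text{otherwise.}\end{cases}$$
   Context: For an interval $I$ and $v:I\to\mathbb{R}$, $\operatorname{Var}_I v:=\sup\{\sum_{i=1}^n|v(x_i)-v(x_{i-1})|: x_0<\dots<x_n\text{ in }I\}$; for $u\in L^1_{loc}(I)$, $\operatorname{essVar}_I u:=\inf\{\operatorname{Var}_I\tilde u:\tilde u\text{ a representative of }u\}$. $BPV(\Omega;\{-1,1\})$ is the set of $u\in L^p(\Omega)$ with $u\in\{-1,1\}$ a.e. and $\operatorname{essVar}_\Omega u<\infty$. For $w\in W^{2,p}(0,1)$ (identified with its $C^1$ representative, with one-sided endpoint limits $w(0_+)$, $w'(0_+)$ etc.), $\Phi(w):=\left(\int_0^1(w^2-1)^2dy\right)^{3/4}\left(\int_0^1|w''|^2dy\right)^{1/4}$; $\mathscr{J}:=\{w\in W^{2,p}(0,1): w(0_+)=-1,\ w(1_-)=1,\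 w'(0_+)=w'(1_-)=0\}$; $\alpha:=\frac{2}{3^{3/4}}\inf_{w\in\mathscr{J}}\Phi(w)$. Gamma convergence in a metric space $X$: $f_n$ Gamma-converges to $f$ if for every $x\in X$, $\liminf_n f_n(x_n)\ge f(x)$ for every sequence $x_n\to x$, and $\limsup_n f_n(x_n)\le f(x)$ for some sequence $x_n\to x$. *)

theory Defs
  imports "HOL-Analysis.Analysis"
begin

definition Lp_fun :: "real \<Rightarrow> real \<Rightarrow> real \<Rightarrow> (real \<Rightarrow> real) \<Rightarrow> bool" where
  "Lp_fun p a b u \<longleftrightarrow>
     set_borel_measurable lebesgue {a<..<b} u \<and>
     (\<integral>\<^sup>+x\<in>{a<..<b}. ennreal (\<bar>u x\<bar> powr p) \<partial>lebesgue) < \<infinity>"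

definition Lp_space :: "real \<Rightarrow> real \<Rightarrow> real \<Rightarrow> (real \<Rightarrow> real) set" where
  "Lp_space p a b = {u. Lp_fun p a b u}"

definition Lp_conv :: "real \<Rightarrow> real \<Rightarrow> real \<Rightarrow> (nat \<Rightarrow> real \<Rightarrow> real) \<Rightarrow> (real \<Rightarrow> real) \<Rightarrow> bool" where
  "Lp_conv p a b us u \<longleftrightarrow>
     ((\<lambda>n. \<integral>\<^sup>+x\<in>{a<..<b}. ennreal (\<bar>us n x - u x\<bar> powr p) \<partial>lebesgue) \<longlonglongrightarrow> 0)"

text \<open>D is the sequence of all derivatives of the C^\<infinity> function D 0.\<close>
definition smooth_derivs :: "(nat \<Rightarrow> real \<Rightarrow> real) \<Rightarrow> bool" where
  "smooth_derivs D \<longleftrightarrow> (\<forall>k x. (D k has_real_derivative D (Suc k) x) (at x))"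

definition test_fun :: "real \<Rightarrow> real \<Rightarrow> (nat \<Rightarrow> real \<Rightarrow> real) \<Rightarrow> bool" where
  "test_fun a b D \<longleftrightarrow> smooth_derivs D \<and>
     (\<exists>K. compact K \<and> K \<subseteq> {a<..<b} \<and> (\<forall>x. x \<notin> K \<longrightarrow> D 0 x = 0))"

definition weak_deriv :: "real \<Rightarrow> real \<Rightarrow> (real \<Rightarrow> real) \<Rightarrow> (real \<Rightarrow> real) \<Rightarrow> bool" where
  "weak_deriv a b u v \<longleftrightarrow>
     (\<forall>D. test_fun a b D \<longrightarrow>
        (LINT x:{a<..<b}|lebesgue. u x * D 1 x) = - (LINT x:{a<..<b}|lebesgue. v x * D 0 x))"

definition W2p :: "real \<Rightarrow> real \<Rightarrow> real \<Rightarrow> (real \<Rightarrow> real) \<Rightarrow> bool" where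
  "W2p p a b u \<longleftrightarrow> Lp_fun p a b u \<and>
     (\<exists>v w. Lp_fun p a b v \<and> Lp_fun p a b w \<and> weak_deriv a b u v \<and> weak_deriv a b v w)"

text \<open>A (the) weak second derivative; unique up to null sets, which is all that matters.\<close>
definition wdd :: "real \<Rightarrow> real \<Rightarrow> real \<Rightarrow> (real \<Rightarrow> real) \<Rightarrow> (real \<Rightarrow> real)" where
  "wdd p a b u = (SOME w. \<exists>v. Lp_fun p a b v \<and> Lp_fun p a b w \<and> weak_deriv a b u v \<and> weak_deriv a b v w)"

definition F_eps :: "real \<Rightarrow> real \<Rightarrow> real \<Rightarrow> real \<Rightarrow> (real \<Rightarrow> real) \<Rightarrow> ereal" where
  "F_eps p a b eps u =
     (if W2p p a b u then
        enn2ereal (\<integral>\<^sup>+x\<in>{a<..<b}.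
          ennreal ((u x ^ 2 - 1) ^ 2 / eps + eps ^ 3 * (wdd p a b u x) ^ 2) \<partial>lebesgue)
      else \<infinity>)"

definition pvar :: "real set \<Rightarrow> (real \<Rightarrow> real) \<Rightarrow> ereal" where
  "pvar I v = (SUP nx \<in> {(n, x). (\<forall>i<n. x i < x (Suc i)) \<and> (\<forall>i\<le>n. x i \<in> I)}.
      ereal (\<Sum>i<fst nx. \<bar>v (snd nx (Suc i)) - v (snd nx i)\<bar>))"

definition essVar :: "real set \<Rightarrow> (real \<Rightarrow> real) \<Rightarrow> ereal" where
  "essVar I u = (INF v \<in> {v. AE x in lebesgue. x \<in> I \<longrightarrow> v x = u x}. pvar I v)"

definition BPV :: "real \<Rightarrow> real \<Rightarrow> real \<Rightarrow> (real \<Rightarrow> real) \<Rightarrow> bool" where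
  "BPV p a b u \<longleftrightarrow> Lp_fun p a b u \<and>
     (AE x in lebesgue. x \<in> {a<..<b} \<longrightarrow> u x \<in> {-1, 1}) \<and>
     essVar {a<..<b} u < \<infinity>"

definition Phi :: "real \<Rightarrow> (real \<Rightarrow> real) \<Rightarrow> ereal" where
  "Phi p w =
     (let A = (\<integral>\<^sup>+y\<in>{0<..<1}. ennreal ((w y ^ 2 - 1) ^ 2) \<partial>lebesgue);
          B = (\<integral>\<^sup>+y\<in>{0<..<1}. ennreal ((wdd p 0 1 w y) ^ 2) \<partial>lebesgue)
      in if A = \<infinity> \<or> B = \<infinity> then \<infinity>
         else ereal (enn2real A powr (3/4) * enn2real B powr (1/4)))"

text \<open>w is taken to be its own C^1 representative on (0,1), with the one-sided endpoint limits.\<close>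
definition Jset :: "real \<Rightarrow> (real \<Rightarrow> real) set" where
  "Jset p = {w. W2p p 0 1 w \<and>
     (\<exists>w'. (\<forall>x\<in>{0<..<1}. (w has_real_derivative w' x) (at x)) \<and> continuous_on {0<..<1} w' \<and>
        (w \<longlongrightarrow> -1) (at_right 0) \<and> (w \<longlongrightarrow> 1) (at_left 1) \<and>
        (w' \<longlongrightarrow> 0) (at_right 0) \<and> (w' \<longlongrightarrow> 0) (at_left 1))}"

definition alpha :: "real \<Rightarrow> ereal" where
  "alpha p = ereal (2 / 3 powr (3/4)) * (INF w \<in> Jset p. Phi p w)"

definition F_lim :: "real \<Rightarrow> real \<Rightarrow> real \<Rightarrow> (real \<Rightarrow> real) \<Rightarrow> ereal" where
  "F_lim p a b u = (if BPV p a b u then alpha p * essVar {a<..<b} u else \<infinity>)"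

definition Gamma_conv_Lp :: "real \<Rightarrow> real \<Rightarrow> real \<Rightarrow> (nat \<Rightarrow> (real \<Rightarrow> real) \<Rightarrow> ereal) \<Rightarrow> ((real \<Rightarrow> real) \<Rightarrow> ereal) \<Rightarrow> bool" where
  "Gamma_conv_Lp p a b fs f \<longleftrightarrow>
     (\<forall>u\<in>Lp_space p a b.
        (\<forall>us. (\<forall>n. us n \<in> Lp_space p a b) \<longrightarrow> Lp_conv p a b us u \<longrightarrow>
              f u \<le> liminf (\<lambda>n. fs n (us n))) \<and>
        (\<exists>us. (\<forall>n. us n \<in> Lp_space p a b) \<and> Lp_conv p a b us u \<and>
              limsup (\<lambda>n. fs n (us n)) \<le> f u))"

end

theory Submission
  imports Defs
begin

text \<open>
  Blowing up by \<open>y = (x - a) / \<epsilon>\<close> turns \<open>F\<^sub>\<epsilon>\<close> into \<open>E f = \<integral> (f\<^sup>2 - 1)\<^sup>2 + |f''|\<^sup>2\<close> on a long interval.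
  For a transition profile on \<open>[0,1]\<close> stretched to length \<open>\<lambda>\<close> the energy is \<open>\<lambda> A + \<lambda>\<^sup>-\<^sup>3 B\<close>, and the
  minimum over \<open>\<lambda>\<close> is \<open>4 / 3\<^sup>3\<^sup>/\<^sup>4\<close> times \<open>\<Phi>\<close>; hence each jump of height \<open>2\<close> costs \<open>2\<alpha>\<close>.

  Lower bound: bounded energy forces all but boundedly many unit cells to have tiny energy, and on
  such a cell \<open>f\<close> is uniformly close to one of the phases \<open>\<plusminus>1\<close> with \<open>f'\<close> close to \<open>0\<close>. Around every essential point
  of \<open>u\<close> such a cell exists, and cubic connectors of small energy turn the piece of \<open>f\<close> between two of
  these cells into an admissible profile. Upper bound: \<open>u\<close> is almost everywhere a step function with finitely
  many jumps; near-optimal profiles are glued in at scale \<open>\<epsilon>\<close>, and a diagonal argument concludes.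
\<close>

section \<open>Primitives of Henstock--Kurzweil integrable functions\<close>

text \<open>The statement speaks of weak derivatives and of a second derivative picked by
  \<open>SOME\<close>. All analysis is done instead on triples \<open>U\<close>, \<open>V\<close>,
  \<open>G\<close> of iterated primitives: they come with continuous representatives, and cutting,
  gluing and rescaling become facts about integrals over subintervals. The price of the translation
  is the lemma of du Bois-Reymond. The exponent does not match the quadratic energy. For p < 2 a
  function in W^{2,p} need not have a square integrable second derivative, and for p > 2 a square
  integrable one need not lie in L^p; so both conditions are carried along everywhere. No
  compactness is used. Near an essential point, convergence keeps u_n close to the phase on a set of
  measure bounded below, whereas cells of large energy cover only a length of order \<epsilon>;
  hence a quiet cell meets that set, and its phase is the one of u. Positivity of \<alpha> needs a
  proof: it makes infinite variation force infinite energy. It comes from the same quiet cells,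
  since a profile of energy at most 1/35^2 could not cross 0.\<close>

definition primitive_on :: "real \<Rightarrow> real \<Rightarrow> (real \<Rightarrow> real) \<Rightarrow> (real \<Rightarrow> real) \<Rightarrow> bool" where
  "primitive_on a b F f \<longleftrightarrow>
     (\<forall>x y. a \<le> x \<longrightarrow> x \<le> y \<longrightarrow> y \<le> b \<longrightarrow> (f has_integral F y - F x) {x..y})"

lemma primitive_onD:
  "primitive_on a b F f \<Longrightarrow> a \<le> x \<Longrightarrow> x \<le> y \<Longrightarrow> y \<le> b \<Longrightarrow> (f has_integral F y - F x) {x..y}"
  by (simp add: primitive_on_def)

lemma primitive_on_integrable:
  assumes "primitive_on a b F f" "a \<le> x" "x \<le> y" "y \<le> b"
  shows "f integrable_on {x..y}" "integral {x..y} f = F y - F x"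
  using primitive_onD[OF assms] by (auto simp: integrable_on_def integral_unique)

lemma primitive_on_integral:
  assumes f: "f integrable_on {a..b}" and F: "\<And>x. x \<in> {a..b} \<Longrightarrow> F x = C + integral {a..x} f"
  shows "primitive_on a b F f"
  unfolding primitive_on_def
proof (intro allI impI)
  fix x y assume xy: "a \<le> x" "x \<le> y" "y \<le> b"
  have "f integrable_on {a..y}" "f integrable_on {x..y}"
    using f xy by (auto intro: integrable_on_subinterval)
  then have "integral {a..x} f + integral {x..y} f = integral {a..y} f"
    using xy Henstock_Kurzweil_Integration.integral_combine by blast
  then have "integral {x..y} f = F y - F x"
    using F[of x] F[of y] xy by simp
  then show "(f has_integral F y - F x) {x..y}"
    using integrable_integral[OF \<open>f integrable_on {x..y}\<close>] by simp
qed

lemma primitive_on_subinterval: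
  "primitive_on a b F f \<Longrightarrow> a \<le> c \<Longrightarrow> d \<le> b \<Longrightarrow> primitive_on c d F f"
  by (auto simp: primitive_on_def)

lemma primitive_on_continuous:
  assumes "primitive_on a b F f"
  shows "continuous_on {a..b} F"
proof (cases "a \<le> b")
  case True
  have "f integrable_on {a..b}"
    using primitive_on_integrable[OF assms] True by auto
  then have "continuous_on {a..b} (\<lambda>x. F a + integral {a..x} f)"
    by (intro continuous_intros indefinite_integral_continuous_1)
  then show ?thesis
    by (rule continuous_on_eq) (use primitive_on_integrable(2)[OF assms] in auto)
qed auto

lemma primitive_on_derivative:
  assumes F: "primitive_on a b F f" and f: "continuous_on {a..b} f" and x: "x \<in> {a..b}"
  shows "(F has_real_derivative f x) (at x within {a..b})"
proof -
  have "((\<lambda>x. F a + integral {a..x} f) has_real_derivative f x) (at x within {a..b})"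
    by (auto intro!: derivative_eq_intros integral_has_real_derivative f x)
  then show ?thesis
    unfolding has_field_derivative_def
    by (rule has_derivative_transform[rotated 2])
       (use primitive_on_integrable(2)[OF F] x in auto)
qed

lemma derivative_primitive_on:
  assumes "\<And>x. x \<in> {a..b} \<Longrightarrow> (F has_real_derivative f x) (at x within {a..b})"
  shows "primitive_on a b F f"
  unfolding primitive_on_def
proof (intro allI impI)
  fix x y assume xy: "a \<le> x" "x \<le> y" "y \<le> b"
  show "(f has_integral F y - F x) {x..y}"
    by (rule fundamental_theorem_of_calculus)
       (use xy in \<open>auto intro!: assms DERIV_subset[where s="{a..b}"]
          simp flip: has_real_derivative_iff_has_vector_derivative\<close>)
qed

lemma primitive_on_cong:
  assumes "primitive_on a b F f" "\<And>x. x \<in> {a..b} \<Longrightarrow> F' x = F x"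
    "negligible N" "\<And>x. x \<in> {a..b} - N \<Longrightarrow> f' x = f x"
  shows "primitive_on a b F' f'"
  unfolding primitive_on_def
proof (intro allI impI)
  fix x y assume xy: "a \<le> x" "x \<le> y" "y \<le> b"
  then show "(f' has_integral F' y - F' x) {x..y}"
    using has_integral_spike[OF assms(3), of "{x..y}" f' f] assms(2,4) primitive_onD[OF assms(1) xy]
    by auto
qed

lemma primitive_on_uminus:
  "primitive_on a b F f \<Longrightarrow> primitive_on a b (\<lambda>x. - F x) (\<lambda>x. - f x)"
  unfolding primitive_on_def
  using has_integral_neg[of f "F y - F x" "{x..y}" for x y] by auto

lemma has_integral_affine_real:
  fixes f :: "real \<Rightarrow> real"
  assumes "(f has_integral I) {m*x+k..m*y+k}" "m > 0"
  shows "((\<lambda>x. f (m*x+k)) has_integral I/m) {x..y}"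
proof -
  have [simp]: "inverse m * (m * t) = t" for t
    using assms(2) by (simp add: field_simps)
  show ?thesis
    using has_integral_affinity'[of f I "m*x+k" "m*y+k" m k] assms
    by (simp add: divide_inverse_commute)
qed

lemma primitive_on_affine:
  assumes "primitive_on a b F f" "m > 0" "a \<le> m*c+k" "m*d+k \<le> b"
  shows "primitive_on c d (\<lambda>x. F (m*x+k)) (\<lambda>x. m * f (m*x+k))"
  unfolding primitive_on_def
proof (intro allI impI)
  fix x y assume xy: "c \<le> x" "x \<le> y" "y \<le> d"
  have "m*c \<le> m*x" "m*x \<le> m*y" "m*y \<le> m*d" using xy assms(2) by auto
  then have "(f has_integral F (m*y+k) - F (m*x+k)) {m*x+k..m*y+k}"
    by (intro primitive_onD[OF assms(1)]) (use assms in linarith)+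
  from has_integral_mult_right[OF has_integral_affine_real[OF this assms(2)], of m]
  show "((\<lambda>x. m * f (m*x+k)) has_integral F (m*y+k) - F (m*x+k)) {x..y}"
    using assms(2) by simp
qed

lemma primitive_on_cmult:
  assumes "primitive_on a b F f"
  shows "primitive_on a b (\<lambda>x. c * F x) (\<lambda>x. c * f x)"
  unfolding primitive_on_def
proof (intro allI impI)
  fix x y assume "a \<le> x" "x \<le> y" "y \<le> b"
  from has_integral_mult_right[OF primitive_onD[OF assms this], of c]
  show "((\<lambda>x. c * f x) has_integral c * F y - c * F x) {x..y}" by (simp add: right_diff_distrib)
qed

lemma primitive_on_concat:
  assumes 1: "primitive_on a c F f" and 2: "primitive_on c b F f" and "a \<le> c" "c \<le> b"
  shows "primitive_on a b F f"
  unfolding primitive_on_def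
proof (intro allI impI)
  fix x y assume xy: "a \<le> x" "x \<le> y" "y \<le> b"
  consider "y \<le> c" | "c \<le> x" | "x \<le> c" "c \<le> y" by linarith
  then show "(f has_integral F y - F x) {x..y}"
  proof cases
    case 3
    have "(f has_integral (F c - F x) + (F y - F c)) {x..y}"
      by (rule has_integral_combine[of x c y]) (use 3 xy primitive_onD[OF 1] primitive_onD[OF 2] in auto)
    then show ?thesis by simp
  qed (use xy primitive_onD[OF 1] primitive_onD[OF 2] in auto)
qed

text \<open>Henstock's lemma bounds the sum over a tagged division of the absolute errors |content *
  f - integral|. As all these integrals vanish, that sum is the Riemann sum of |f| itself, so
  integrability of |f| comes out together with its value.\<close>

lemma has_integral_abs_zero:
  fixes f :: "real \<Rightarrow> real"
  assumes int: "f integrable_on {a..b}"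
    and 0: "\<And>x y. a \<le> x \<Longrightarrow> x \<le> y \<Longrightarrow> y \<le> b \<Longrightarrow> integral {x..y} f = 0"
  shows "((\<lambda>x. \<bar>f x\<bar>) has_integral 0) {a..b}"
proof -
  have "((\<lambda>x. \<bar>f x\<bar>) has_integral 0) (cbox a b)"
    unfolding has_integral
  proof (intro allI impI)
    fix e :: real assume "e > 0"
    obtain g where g: "gauge g"
      "\<And>p. \<lbrakk>p tagged_partial_division_of (cbox a b); g fine p\<rbrakk> \<Longrightarrow>
         sum (\<lambda>(x,k). norm(measure lborel k *\<^sub>R f x - integral k f)) p < e"
      using Henstock_lemma[of f a b e] int \<open>e > 0\<close> by auto
    show "\<exists>\<gamma>. gauge \<gamma> \<and> (\<forall>\<D>. \<D> tagged_division_of cbox a b \<and> \<gamma> fine \<D> \<longrightarrow>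
        norm ((\<Sum>(x, k)\<in>\<D>. measure lborel k *\<^sub>R \<bar>f x\<bar>) - 0) < e)"
    proof (intro exI conjI allI impI)
      fix p assume p: "p tagged_division_of cbox a b \<and> g fine p"
      have *: "integral k f = 0" if xk: "(x,k) \<in> p" for x k
      proof -
        obtain u v where "k = cbox u v" using tagged_division_ofD(4)[OF conjunct1[OF p] xk] by auto
        moreover have "k \<subseteq> cbox a b" "k \<noteq> {}"
          using tagged_division_ofD(2,3)[OF conjunct1[OF p] xk] by auto
        ultimately show ?thesis
          using 0[of u v] by (auto simp: cbox_interval)
      qed
      have "norm ((\<Sum>(x, k)\<in>p. measure lborel k *\<^sub>R \<bar>f x\<bar>) - 0) \<le> (\<Sum>(x, k)\<in>p. norm (measure lborel k *\<^sub>R \<bar>f x\<bar>))"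
        by (simp add: split_def sum_nonneg)
      also have "\<dots> = sum (\<lambda>(x,k). norm(measure lborel k *\<^sub>R f x - integral k f)) p"
        by (intro sum.cong) (auto simp: * abs_mult)
      also have "\<dots> < e" using g(2)[of p] p by (simp add: tagged_division_of_def)
      finally show "norm ((\<Sum>(x, k)\<in>p. measure lborel k *\<^sub>R \<bar>f x\<bar>) - 0) < e" .
    qed (rule g)
  qed
  then show ?thesis by simp
qed

lemma negligible_integrals_zero:
  fixes f :: "real \<Rightarrow> real"
  assumes int: "f integrable_on {a..b}"
    and 0: "\<And>x y. a \<le> x \<Longrightarrow> x \<le> y \<Longrightarrow> y \<le> b \<Longrightarrow> integral {x..y} f = 0"
  shows "negligible {x\<in>{a..b}. f x \<noteq> 0}"
proof -
  let ?h = "\<lambda>x. if x \<in> {a..b} then \<bar>f x\<bar> else 0"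
  have "(?h has_integral 0) UNIV"
    unfolding has_integral_restrict_UNIV by (rule has_integral_abs_zero[OF assms])
  then have "?h \<in> borel_measurable lebesgue" "(\<integral>\<^sup>+x. ennreal (?h x) \<partial>lebesgue) = 0"
    using has_integral_iff_nn_integral_lebesgue[of ?h 0] by auto
  then have "AE x in lebesgue. ennreal (?h x) = 0"
    by (subst (asm) nn_integral_0_iff_AE) auto
  then obtain N where "negligible N" "{x. ennreal (?h x) \<noteq> 0} \<subseteq> N"
    unfolding eventually_ae_filter_negligible by auto
  then show ?thesis by (elim negligible_subset) (auto split: if_splits)
qed

section \<open>Integration by parts against a continuously differentiable factor\<close>

lemma continuous_on_Icc_bound:
  fixes f :: "real \<Rightarrow> real"
  assumes "continuous_on {a..b} f"
  obtains C where "C \<ge> 1" "\<And>x. x \<in> {a..b} \<Longrightarrow> \<bar>f x\<bar> \<le> C"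
proof -
  have "bounded (f ` {a..b})" by (intro compact_imp_bounded compact_continuous_image assms compact_Icc)
  then obtain K where "\<forall>x\<in>{a..b}. \<bar>f x\<bar> \<le> K" unfolding bounded_iff by auto
  then show thesis using that[of "max 1 K"] by fastforce
qed

lemma absolutely_integrable_times_continuous:
  fixes g f :: "real \<Rightarrow> real"
  assumes "g absolutely_integrable_on {a..b}" "continuous_on {a..b} f"
  shows "(\<lambda>x. g x * f x) absolutely_integrable_on {a..b}"
proof -
  have "bounded (f ` {a..b})" by (intro compact_imp_bounded compact_continuous_image assms compact_Icc)
  then have "(\<lambda>x. f x * g x) absolutely_integrable_on {a..b}"
    by (intro absolutely_integrable_bounded_measurable_product_real assms)
       (auto intro: continuous_imp_measurable_on_sets_lebesgue assms)
  then show ?thesis by (simp add: mult.commute)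
qed

text \<open>The increment of the defect is quadratically small, so the defect has derivative zero.\<close>

lemma primitive_on_by_parts:
  assumes F: "primitive_on a b F g" and g: "g absolutely_integrable_on {a..b}"
    and \<phi>: "\<And>x. (\<phi> has_real_derivative \<phi>' x) (at x)" and c: "continuous_on {a..b} \<phi>'" and ab: "a \<le> b"
  shows "((\<lambda>x. F x * \<phi>' x + g x * \<phi> x) has_integral F b * \<phi> b - F a * \<phi> a) {a..b}"
proof -
  define h where "h = (\<lambda>x. F x * \<phi>' x + g x * \<phi> x)"
  have cF: "continuous_on {a..b} F" by (rule primitive_on_continuous[OF F])
  have c\<phi>: "continuous_on S \<phi>" for S
    by (rule DERIV_continuous_on[of S \<phi> \<phi>']) (rule has_field_derivative_at_within[OF \<phi>])
  obtain C where C: "C \<ge> 1" "\<And>x. x \<in> {a..b} \<Longrightarrow> \<bar>\<phi>' x\<bar> \<le> C"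
    using continuous_on_Icc_bound[OF c] by blast
  have C0: "C \<ge> 0" using C(1) by simp
  have g\<phi>: "(\<lambda>x. g x * \<phi> x) integrable_on {a..b}"
    by (intro set_lebesgue_integral_eq_integral(1) absolutely_integrable_times_continuous g c\<phi>)
  have F\<phi>: "(\<lambda>x. F x * \<phi>' x) integrable_on {a..b}"
    by (intro integrable_continuous_real continuous_intros cF c)
  have h: "h integrable_on {a..b}" unfolding h_def by (intro integrable_add g\<phi> F\<phi>)
  have ga: "(\<lambda>x. \<bar>g x\<bar>) integrable_on {a..b}"
    using g by (simp add: absolutely_integrable_on_def)
  \<comment> \<open>\<open>M\<close> dominates the increments of \<open>F\<close>, and
    \<open>H\<close> is the defect of the product rule. The aim is that \<open>H\<close> is
    constant, although \<open>F\<close> need not be differentiable everywhere.\<close>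
  define M where "M x = integral {a..x} (\<lambda>x. \<bar>g x\<bar>)" for x
  define H where "H x = F x * \<phi> x - integral {a..x} h" for x
  have M: "primitive_on a b M (\<lambda>x. \<bar>g x\<bar>)"
    by (rule primitive_on_integral[OF ga, of _ 0]) (simp add: M_def)
  have Mmono: "M s \<le> M t" if "a \<le> s" "s \<le> t" "t \<le> b" for s t
    using has_integral_nonneg[OF primitive_onD[OF M that]] by auto
  have incr: "\<bar>H y - H x\<bar> \<le> 2 * C * (y - x) * (M y - M x)"
    if xy: "a \<le> x" "x \<le> y" "y \<le> b" for x y
  proof -
    have sub: "{x..y} \<subseteq> {a..b}" using xy by auto
    have i: "f integrable_on {x..y}" if "f integrable_on {a..b}" for f :: "real \<Rightarrow> real"
      by (rule integrable_on_subinterval[OF that sub])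
    have \<phi>I: "(\<phi>' has_integral \<phi> t - \<phi> s) {s..t}" if "s \<le> t" for s t
      by (rule fundamental_theorem_of_calculus[OF that])
         (use \<phi> in \<open>auto simp: has_real_derivative_iff_has_vector_derivative[symmetric]
            intro: has_field_derivative_at_within\<close>)
    have Lip: "\<bar>\<phi> t - \<phi> s\<bar> \<le> C * (t - s)" if "a \<le> s" "s \<le> t" "t \<le> b" for s t
      using has_integral_bound_real[OF C0 _ \<phi>I[of s t], of "{}"] C(2) that by (auto simp: content_real_if)
    have gI: "(g has_integral F t - F s) {s..t}" if "a \<le> s" "s \<le> t" "t \<le> b" for s t
      using primitive_onD[OF F] that by auto
    have MI: "((\<lambda>x. \<bar>g x\<bar>) has_integral M t - M s) {s..t}" if "a \<le> s" "s \<le> t" "t \<le> b" for s t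
      using primitive_onD[OF M] that by auto
    have Fdiff: "\<bar>F t - F s\<bar> \<le> M t - M s" if "a \<le> s" "s \<le> t" "t \<le> b" for s t
      using integral_norm_bound_integral[of g "{s..t}" "\<lambda>x. \<bar>g x\<bar>"] gI[OF that] MI[OF that]
      by (auto simp: integral_unique integrable_on_def)
    have hint: "integral {a..y} h - integral {a..x} h = integral {x..y} h"
      using Henstock_Kurzweil_Integration.integral_combine[of a x y h] xy h
      integrable_on_subinterval[OF h, of a y] by force
    have 1: "((\<lambda>t. g t * (\<phi> y - \<phi> t)) has_integral ((F y - F x) * \<phi> y - integral {x..y} (\<lambda>t. g t * \<phi> t))) {x..y}"
      using has_integral_diff[OF has_integral_mult_left[OF gI[OF xy], of "\<phi> y"] integrable_integral[OF i[OF g\<phi>]]]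
      by (simp add: algebra_simps)
    have 2: "((\<lambda>t. (F t - F x) * \<phi>' t) has_integral (integral {x..y} (\<lambda>t. F t * \<phi>' t) - F x * (\<phi> y - \<phi> x))) {x..y}"
      using has_integral_diff[OF integrable_integral[OF i[OF F\<phi>]] has_integral_mult_right[OF \<phi>I[OF xy(2)], of "F x"]]
      by (simp add: algebra_simps)
    have hs: "integral {x..y} h = integral {x..y} (\<lambda>t. F t * \<phi>' t) + integral {x..y} (\<lambda>t. g t * \<phi> t)"
      unfolding h_def by (rule integral_add[OF i[OF F\<phi>] i[OF g\<phi>]])
    \<comment> \<open>Recentring at the ends: the two brackets are the integrals of
      \<open>g t * (\<phi> y - \<phi> t)\<close> and of \<open>(F t - F x) * \<phi>' t\<close>. In
      each, one factor is of order y - x and the other of order \<open>M y - M x\<close>.\<close>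
    have eq: "H y - H x = ((F y - F x) * \<phi> y - integral {x..y} (\<lambda>t. g t * \<phi> t))
        - (integral {x..y} (\<lambda>t. F t * \<phi>' t) - F x * (\<phi> y - \<phi> x))"
      using hint hs unfolding H_def by (simp add: algebra_simps)
    have b1: "\<bar>(F y - F x) * \<phi> y - integral {x..y} (\<lambda>t. g t * \<phi> t)\<bar> \<le> C * (y - x) * (M y - M x)"
    proof -
      have "norm (integral {x..y} (\<lambda>t. g t * (\<phi> y - \<phi> t))) \<le> integral {x..y} (\<lambda>t. C * (y - x) * \<bar>g t\<bar>)"
      proof (rule integral_norm_bound_integral)
        show "(\<lambda>t. C * (y - x) * \<bar>g t\<bar>) integrable_on {x..y}"
          by (rule integrable_on_mult_right[OF i[OF ga]])
        fix t assume t: "t \<in> {x..y}"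
        have "\<bar>\<phi> y - \<phi> t\<bar> \<le> C * (y - x)"
          using Lip[of t y] t xy C0 mult_left_mono[of "y - t" "y - x" C] by auto
        then show "norm (g t * (\<phi> y - \<phi> t)) \<le> C * (y - x) * \<bar>g t\<bar>"
          by (simp add: abs_mult mult.commute mult_left_mono)
      qed (use 1 in auto)
      then show ?thesis
        using integral_unique[OF 1] integral_unique[OF has_integral_mult_right[OF MI[OF xy], of "C * (y-x)"]] by auto
    qed
    have b2: "\<bar>integral {x..y} (\<lambda>t. F t * \<phi>' t) - F x * (\<phi> y - \<phi> x)\<bar> \<le> C * (y - x) * (M y - M x)"
    proof -
      have "norm (integral {x..y} (\<lambda>t. (F t - F x) * \<phi>' t)) \<le> (M y - M x) * C * measure lborel (cbox x y)"
        unfolding cbox_interval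
      proof (rule has_integral_bound_real[OF _ _ , of _ "{}"])
        show "0 \<le> (M y - M x) * C" using Mmono[OF xy] C0 by auto
        show "((\<lambda>t. (F t - F x) * \<phi>' t) has_integral integral {x..y} (\<lambda>t. (F t - F x) * \<phi>' t)) {x..y}"
          using 2 by blast
        fix t assume t: "t \<in> {x..y} - {}"
        have "\<bar>F t - F x\<bar> \<le> M y - M x" using Fdiff[of x t] Mmono[of t y] t xy by auto
        then show "norm ((F t - F x) * \<phi>' t) \<le> (M y - M x) * C"
          using C(2)[of t] t xy by (auto simp: abs_mult intro!: mult_mono)
      qed auto
      then show ?thesis using integral_unique[OF 2] xy by (simp add: mult_ac)
    qed
    show ?thesis using eq b1 b2 by linarith
  qed
  have dH: "(H has_real_derivative 0) (at x within {a..b})" if x: "x \<in> {a..b}" for x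
    unfolding has_field_derivative_iff
  proof (rule Lim_null_comparison)
    have "continuous_on {a..b} M" by (rule primitive_on_continuous[OF M])
    then have "(M \<longlongrightarrow> M x) (at x within {a..b})" using x by (auto simp: continuous_on_def)
    then show "((\<lambda>y. 2 * C * \<bar>M y - M x\<bar>) \<longlongrightarrow> 0) (at x within {a..b})"
      by (auto intro!: tendsto_eq_intros)
    show "\<forall>\<^sub>F y in at x within {a..b}. norm ((H y - H x) / (y - x)) \<le> 2 * C * \<bar>M y - M x\<bar>"
      unfolding eventually_at_filter
    proof (intro always_eventually allI impI)
      fix y assume y: "y \<noteq> x" "y \<in> {a..b}"
      have "\<bar>H y - H x\<bar> \<le> 2 * C * \<bar>M y - M x\<bar> * \<bar>y - x\<bar>"
      proof (cases "x \<le> y")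
        case True
        have "\<bar>M y - M x\<bar> = M y - M x" "\<bar>y - x\<bar> = y - x" using True Mmono[of x y] x y by auto
        then show ?thesis using incr[of x y] True x y by (metis atLeastAtMost_iff mult.assoc mult.commute)
      next
        case False
        have "\<bar>M y - M x\<bar> = M x - M y" "\<bar>y - x\<bar> = x - y" "\<bar>H y - H x\<bar> = \<bar>H x - H y\<bar>"
          using False Mmono[of y x] x y by auto
        then show ?thesis using incr[of y x] False x y by (metis atLeastAtMost_iff mult.assoc mult.commute linear)
      qed
      then show "norm ((H y - H x) / (y - x)) \<le> 2 * C * \<bar>M y - M x\<bar>"
        using y by (simp add: divide_simps)
    qed
  qed
  have "\<exists>c. \<forall>x\<in>{a..b}. H x = c"
    using dH by (intro has_field_derivative_zero_constant) auto
  then have "H b = H a" using ab by auto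
  then have "integral {a..b} h = F b * \<phi> b - F a * \<phi> a" by (simp add: H_def)
  then show ?thesis using integrable_integral[OF h] by (simp add: h_def)
qed

section \<open>Test functions and the lemma of du Bois-Reymond\<close>

text \<open>With t = 1/x the k-th derivative of exp(-1/x) is p_k(t) exp(-t). Since d/dx = -t^2 d/dt,
  the next polynomial is t^2 (p_k - p_k').\<close>

fun expinv_poly :: "nat \<Rightarrow> real poly" where
  "expinv_poly 0 = 1"
| "expinv_poly (Suc k) = [:0, 0, 1:] * (expinv_poly k - pderiv (expinv_poly k))"

definition expinv :: "nat \<Rightarrow> real \<Rightarrow> real" where
  "expinv k x = (if x > 0 then poly (expinv_poly k) (1/x) * exp (- 1/x) else 0)"

lemma poly_times_exp_tendsto_0:
  fixes p :: "real poly"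
  shows "((\<lambda>x. poly p x * exp (-x)) \<longlongrightarrow> 0) at_top"
proof -
  have "((\<lambda>x. \<Sum>i\<le>degree p. coeff p i * (x^i / exp x)) \<longlongrightarrow> (\<Sum>i\<le>degree p. coeff p i * 0)) at_top"
    by (intro tendsto_intros tendsto_power_div_exp_0)
  then show ?thesis
    by (simp add: poly_altdef sum_distrib_right exp_minus divide_inverse mult.assoc)
qed

lemma smooth_derivs_expinv: "smooth_derivs expinv"
  unfolding smooth_derivs_def
proof (intro allI)
  fix k and x :: real
  consider "x > 0" | "x < 0" | "x = 0" by linarith
  then show "(expinv k has_real_derivative expinv (Suc k) x) (at x)"
  proof cases
    case 1
    let ?p = "expinv_poly k"
    have "((\<lambda>x. poly ?p (1/x) * exp (- 1/x)) has_real_derivative expinv (Suc k) x) (at x)"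
      using 1
      by (auto intro!: derivative_eq_intros DERIV_chain2[OF poly_DERIV]
               simp: expinv_def field_simps power2_eq_square)
    then show ?thesis
      by (rule has_field_derivative_transform_within_open[where S = "{0<..}"])
         (use 1 in \<open>auto simp: expinv_def\<close>)
  next
    case 2
    have "((\<lambda>x. 0) has_real_derivative expinv (Suc k) x) (at x)"
      using 2 by (simp add: expinv_def)
    then show ?thesis
      by (rule has_field_derivative_transform_within_open[where S = "{..<0}"])
         (use 2 in \<open>auto simp: expinv_def\<close>)
  next
    case 3
    \<comment> \<open>For y > 0 the difference quotient at 0 is t p_k(t) exp(-t) with t = 1/y; the
      factor \<open>[:0,1:]\<close> is this extra t.\<close>
    have lim: "((\<lambda>x. poly ([:0,1:] * expinv_poly k) (inverse x) * exp (- inverse x)) \<longlongrightarrow> 0) (at_right 0)"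
      by (rule filterlim_compose[OF poly_times_exp_tendsto_0 filterlim_inverse_at_top_right])
    have "((\<lambda>y. (expinv k y - expinv k 0) / (y - 0)) \<longlongrightarrow> 0) (at_right 0)"
      by (rule Lim_transform_eventually[OF lim])
         (auto simp: eventually_at_right_field expinv_def divide_inverse mult_ac intro!: exI[of _ 1])
    moreover have "((\<lambda>y. (expinv k y - expinv k 0) / (y - 0)) \<longlongrightarrow> 0) (at_left 0)"
      by (rule Lim_transform_eventually[OF tendsto_const])
         (auto simp: eventually_at_left_field expinv_def intro!: exI[of _ "-1"])
    ultimately show ?thesis
      using 3 unfolding has_field_derivative_iff
      by (auto simp: filterlim_at_split expinv_def)
  qed
qed

lemma smooth_derivs_affine:
  assumes "smooth_derivs D"
  shows "smooth_derivs (\<lambda>k x. m^k * D k (m * x + c))"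
  unfolding smooth_derivs_def
proof (intro allI)
  fix k x
  have "(D k has_real_derivative D (Suc k) (m*x+c)) (at (m*x+c))"
    using assms by (auto simp: smooth_derivs_def)
  then have "((\<lambda>x. D k (m*x+c)) has_real_derivative D (Suc k) (m*x+c) * m) (at x)"
    by (rule DERIV_chain2) (auto intro!: derivative_eq_intros)
  then show "((\<lambda>x. m^k * D k (m * x + c)) has_real_derivative m ^ Suc k * D (Suc k) (m * x + c)) (at x)"
    by (auto intro!: derivative_eq_intros simp: mult_ac)
qed

text \<open>A smooth function is given here with its whole sequence of derivatives, so a product has
  to supply all of them. The Leibniz formula does; an index shift and Pascal's rule show that each
  term is the derivative of the one before.\<close>

lemma smooth_derivs_mult:
  assumes D: "smooth_derivs D" and E: "smooth_derivs E"
  shows "smooth_derivs (\<lambda>k x. \<Sum>i\<le>k. real (k choose i) * (D i x * E (k-i) x))"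
  unfolding smooth_derivs_def
proof (intro allI)
  fix k x
  have d: "(D i has_real_derivative D (Suc i) x) (at x)" "(E i has_real_derivative E (Suc i) x) (at x)" for i
    using D E by (auto simp: smooth_derivs_def)
  have "((\<lambda>x. \<Sum>i\<le>k. real (k choose i) * (D i x * E (k-i) x)) has_real_derivative
      (\<Sum>i\<le>k. real (k choose i) * (D (Suc i) x * E (k-i) x + D i x * E (Suc (k-i)) x))) (at x)"
    by (rule DERIV_sum) (auto intro!: derivative_eq_intros d)
  also have "(\<Sum>i\<le>k. real (k choose i) * (D (Suc i) x * E (k-i) x + D i x * E (Suc (k-i)) x)) =
     (\<Sum>i\<le>k. real (k choose i) * (D (Suc i) x * E (k-i) x)) + (\<Sum>i\<le>k. real (k choose i) * (D i x * E (Suc k-i) x))"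
    by (simp add: ring_distribs sum.distrib Suc_diff_le)
  also have "(\<Sum>i\<le>k. real (k choose i) * (D i x * E (Suc k-i) x)) =
     D 0 x * E (Suc k) x + (\<Sum>i\<le>k. real (k choose Suc i) * (D (Suc i) x * E (k-i) x))"
  proof -
    have "(\<Sum>i\<le>k. real (k choose i) * (D i x * E (Suc k-i) x)) = (\<Sum>i\<le>Suc k. real (k choose i) * (D i x * E (Suc k-i) x))"
      by simp
    also have "\<dots> = D 0 x * E (Suc k) x + (\<Sum>i\<le>k. real (k choose Suc i) * (D (Suc i) x * E (k-i) x))"
      by (subst sum.atMost_Suc_shift) simp
    finally show ?thesis .
  qed
  also have "(\<Sum>i\<le>k. real (k choose i) * (D (Suc i) x * E (k-i) x)) + (D 0 x * E (Suc k) x + (\<Sum>i\<le>k. real (k choose Suc i) * (D (Suc i) x * E (k-i) x)))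
      = (\<Sum>i\<le>Suc k. real (Suc k choose i) * (D i x * E (Suc k-i) x))"
    by (subst sum.atMost_Suc_shift) (simp add: ring_distribs sum.distrib)
  finally show "((\<lambda>x. \<Sum>i\<le>k. real (k choose i) * (D i x * E (k-i) x)) has_real_derivative
     (\<Sum>i\<le>Suc k. real (Suc k choose i) * (D i x * E (Suc k-i) x))) (at x)" .
qed

lemma smooth_derivs_lincomb:
  "smooth_derivs D \<Longrightarrow> smooth_derivs E \<Longrightarrow> smooth_derivs (\<lambda>k x. D k x - c * E k x)"
  by (auto simp: smooth_derivs_def intro!: derivative_eq_intros)

lemma smooth_derivs_continuous:
  assumes "smooth_derivs D" shows "continuous_on S (D k)"
  using assms unfolding smooth_derivs_def
  by (intro DERIV_continuous_on[of S "D k" "D (Suc k)"]) (auto intro: has_field_derivative_at_within)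

text \<open>The factor \<open>m\<close> sets the steepness: as it grows, the bump tends to the
  indicator of the open interval from \<open>s\<close> to \<open>r\<close>, while its support stays
  in the closed one.\<close>

definition bump :: "real \<Rightarrow> real \<Rightarrow> real \<Rightarrow> real \<Rightarrow> real" where
  "bump m s r x = expinv 0 (m * (x - s)) * expinv 0 (m * (r - x))"

lemma expinv_0: "expinv 0 x = (if x > 0 then exp (- 1/x) else 0)"
  by (simp add: expinv_def)

lemma bump_bounds: "0 \<le> bump m s r x" "bump m s r x \<le> 1"
  by (auto simp: bump_def expinv_0 intro!: mult_le_one)

lemma bump_support: "m > 0 \<Longrightarrow> x \<notin> {s..r} \<Longrightarrow> bump m s r x = 0"
  by (auto simp: bump_def expinv_0 zero_less_mult_iff)

lemma bump_pos: "m > 0 \<Longrightarrow> s < x \<Longrightarrow> x < r \<Longrightarrow> bump m s r x > 0"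
  by (auto simp: bump_def expinv_0 zero_less_mult_iff)

lemma bump_smooth: "\<exists>D. smooth_derivs D \<and> D 0 = bump m s r"
proof -
  have "smooth_derivs (\<lambda>k x. \<Sum>i\<le>k. real (k choose i) * (m^i * expinv i (m * x + - (m * s)) * ((-m)^(k-i) * expinv (k-i) (- m * x + m * r))))"
    using smooth_derivs_mult[OF smooth_derivs_affine[OF smooth_derivs_expinv] smooth_derivs_affine[OF smooth_derivs_expinv]] .
  then show ?thesis
    by (intro exI conjI, assumption) (simp add: bump_def fun_eq_iff algebra_simps)
qed

text \<open>The ends are pulled in so that each bump is compactly supported even for x = a and y =
  b; n + 3 keeps the left end below the right one from the start. For fixed t inside, the growing
  steepness times the distance to the moving ends tends to infinity, so both exponential factors
  tend to 1.\<close>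

lemma bump_tendsto:
  assumes "x < y"
  shows "(\<lambda>n. bump (real (Suc n)) (x + (y-x)/real (n+3)) (y - (y-x)/real (n+3)) t) \<longlonglongrightarrow> indicator {x<..<y} t"
proof (cases "t \<in> {x<..<y}")
  case False
  have "bump (real (Suc n)) (x + (y-x)/real (n+3)) (y - (y-x)/real (n+3)) t = 0" for n
  proof (rule bump_support)
    have "(y-x)/real (n+3) > 0" using assms by auto
    then show "t \<notin> {x + (y-x)/real (n+3)..y - (y-x)/real (n+3)}" using False by auto
  qed auto
  then show ?thesis using False by simp
next
  case True
  have l: "(\<lambda>n. expinv 0 (real (Suc n) * (c - (y-x)/real (n+3)))) \<longlonglongrightarrow> 1" if "c > 0" for c :: real
  proof -
    have 1: "(\<lambda>n. (y-x)/real (n+3)) \<longlonglongrightarrow> 0"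
      by (intro real_tendsto_divide_at_top[OF tendsto_const] filterlim_compose[OF filterlim_real_sequentially] filterlim_add_const_nat_at_top)
    have 2: "(\<lambda>n. c - (y-x)/real (n+3)) \<longlonglongrightarrow> c" using tendsto_diff[OF tendsto_const 1] by simp
    have 3: "filterlim (\<lambda>n. real (Suc n) * (c - (y-x)/real (n+3))) at_top sequentially"
      by (rule filterlim_at_top_mult_tendsto_pos[OF 2 that, of "\<lambda>n. real (Suc n)", simplified mult.commute])
         (intro filterlim_compose[OF filterlim_real_sequentially] filterlim_Suc)
    have 4: "((\<lambda>z::real. exp (- 1/z)) \<longlongrightarrow> exp 0) at_top"
      by (intro tendsto_exp real_tendsto_divide_at_top[OF tendsto_const] filterlim_ident)
    have "((expinv 0) \<longlongrightarrow> 1) at_top"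
      by (rule Lim_transform_eventually[OF 4[simplified]])
         (use eventually_gt_at_top[of 0] in eventually_elim, simp add: expinv_0)
    then show ?thesis by (rule filterlim_compose[OF _ 3])
  qed
  show ?thesis
    using tendsto_mult[OF l[of "t - x"] l[of "y - t"]] True
    by (simp add: bump_def algebra_simps)
qed

text \<open>The primitive taken from the left vanishes before \<open>s\<close> in any case; the zero
  mean makes it vanish after \<open>r\<close> as well.\<close>

lemma test_fun_primitive:
  assumes E: "smooth_derivs E" and supp: "\<And>x. x \<notin> {s..r} \<Longrightarrow> E 0 x = 0"
    and sr: "a < s" "s \<le> r" "r < b" and 0: "integral {a..b} (E 0) = 0"
  shows "\<exists>D. test_fun a b D \<and> D 1 = E 0"
proof -
  define \<phi> where "\<phi> x = integral {a..x} (E 0)" for x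
  have cont: "continuous_on S (E 0)" for S by (rule smooth_derivs_continuous[OF E])
  have \<phi>0: "\<phi> x = 0" if "x < s" for x
  proof -
    have "\<phi> x = integral {a..x} (\<lambda>x. 0)" unfolding \<phi>_def
      by (rule integral_cong) (use that supp in auto)
    then show ?thesis by simp
  qed
  have \<phi>1: "\<phi> x = 0" if "x > r" for x
  proof -
    have 1: "integral {a..r} (E 0) + integral {r..z} (E 0) = integral {a..z} (E 0)" if "r < z" for z
      using that sr by (intro Henstock_Kurzweil_Integration.integral_combine integrable_continuous_real cont) auto
    have 2: "integral {r..z} (E 0) = 0" if "r < z" for z
    proof -
      have "integral {r..z} (E 0) = integral {r..z} (\<lambda>x. 0)"
        by (rule integral_spike[of "{r}"]) (use supp in auto)
      then show ?thesis by simp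
    qed
    show ?thesis using 1[OF that] 2[OF that] 1[of b] 2[of b] 0 sr by (simp add: \<phi>_def)
  qed
  have d: "(\<phi> has_real_derivative E 0 x) (at x)" for x
  proof (cases "x > a")
    case True
    have "(\<phi> has_real_derivative E 0 x) (at x within {a..x+1})"
      unfolding \<phi>_def by (rule integral_has_real_derivative[OF cont]) (use True in auto)
    then show ?thesis using True by (simp add: at_within_Icc_at)
  next
    case False
    then have "((\<lambda>x. 0) has_real_derivative E 0 x) (at x)"
      using supp[of x] sr by simp
    then show ?thesis
      by (rule has_field_derivative_transform_within_open[where S = "{..<s}"]) (use False sr \<phi>0 in auto)
  qed
  \<comment> \<open>Prepending the primitive shifts the sequence: derivative k + 1 of the result is
    \<open>E k\<close>.\<close>
  have "smooth_derivs (case_nat \<phi> E)"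
    using E d unfolding smooth_derivs_def by (auto split: nat.split)
  moreover have "\<exists>K. compact K \<and> K \<subseteq> {a<..<b} \<and> (\<forall>x. x \<notin> K \<longrightarrow> \<phi> x = 0)"
    by (rule exI[of _ "{s..r}"]) (use \<phi>0 \<phi>1 sr in force)
  ultimately have "test_fun a b (case_nat \<phi> E)" by (simp add: test_fun_def)
  then show ?thesis by (intro exI[of _ "case_nat \<phi> E"]) auto
qed

text \<open>A bump minus the right multiple of a fixed bump \<open>B\<close> has zero mean, hence is
  the derivative of a test function. Testing with it shows that \<open>g\<close> minus its
  \<open>B\<close>-weighted mean \<open>c\<close> is orthogonal to every bump, and bumps approximate
  the indicators of intervals.\<close>

lemma du_Bois_Reymond:
  assumes g: "g absolutely_integrable_on {a..b}" and ab: "a < b"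
    and 0: "\<And>D. test_fun a b D \<Longrightarrow> integral {a..b} (\<lambda>x. g x * D 1 x) = 0"
  shows "\<exists>c. negligible {x\<in>{a..b}. g x \<noteq> c}"
proof -
  have gi: "g integrable_on {a..b}" using g set_lebesgue_integral_eq_integral(1) by blast
  have gf: "(\<lambda>x. g x * f x) integrable_on {a..b}" if "continuous_on {a..b} f" for f
    using absolutely_integrable_times_continuous[OF g that] set_lebesgue_integral_eq_integral(1) by blast
  define s0 r0 where "s0 = a + (b-a)/3" and "r0 = a + 2*(b-a)/3"
  have sr0: "a < s0" "s0 < r0" "r0 < b" using ab by (auto simp: s0_def r0_def field_simps)
  define B where "B = bump 1 s0 r0"
  obtain E0 where E0: "smooth_derivs E0" "E0 0 = B" using bump_smooth B_def by metis
  have cB: "continuous_on S B" for S using smooth_derivs_continuous[OF E0(1), of S 0] E0(2) by simp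
  have Bi: "B integrable_on {a..b}" by (rule integrable_continuous_real[OF cB])
  define I0 where "I0 = integral {a..b} B"
  have "I0 > 0"
  proof -
    have "integral {a..b} B \<noteq> 0"
    proof
      assume "integral {a..b} B = 0"
      then have "\<forall>x\<in>{a..b}. B x = 0"
        using integral_eq_0_iff[of a b B] cB bump_bounds(1) ab by (auto simp: B_def)
      then show False using bump_pos[of 1 s0 "(s0+r0)/2" r0] sr0 by (auto simp: B_def)
    qed
    moreover have "integral {a..b} B \<ge> 0" by (rule integral_nonneg[OF Bi]) (simp add: B_def bump_bounds)
    ultimately show ?thesis by (simp add: I0_def)
  qed
  define c where "c = integral {a..b} (\<lambda>x. g x * B x) / I0"
  have main: "integral {a..b} (\<lambda>x. (g x - c) * bump m s r x) = 0" if m: "m > 0" and sr: "a < s" "s \<le> r" "r < b" for m s r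
  proof -
    obtain E where E: "smooth_derivs E" "E 0 = bump m s r" using bump_smooth by blast
    have cE: "continuous_on S (bump m s r)" for S using smooth_derivs_continuous[OF E(1), of S 0] E(2) by simp
    have Ei: "bump m s r integrable_on {a..b}" by (rule integrable_continuous_real[OF cE])
    define k where "k = integral {a..b} (bump m s r) / I0"
    have sm: "smooth_derivs (\<lambda>j x. E j x - k * E0 j x)" by (rule smooth_derivs_lincomb[OF E(1) E0(1)])
    have "\<exists>D. test_fun a b D \<and> D 1 = (\<lambda>x. E 0 x - k * E0 0 x)"
    proof (rule test_fun_primitive[OF sm])
      show "E 0 x - k * E0 0 x = 0" if "x \<notin> {min s s0..max r r0}" for x
        using bump_support[OF m, of x s r] bump_support[of 1 x s0 r0] that E E0 B_def by (cases "s \<le> x \<and> x \<le> r"; cases "s0 \<le> x \<and> x \<le> r0") auto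
      show "integral {a..b} (\<lambda>x. E 0 x - k * E0 0 x) = 0"
        using \<open>I0 > 0\<close> Ei Bi E E0 by (simp add: integral_diff integrable_on_mult_right k_def I0_def)
    qed (use sr sr0 in auto)
    then have "integral {a..b} (\<lambda>x. g x * (bump m s r x - k * B x)) = 0"
      using 0 E E0 by metis
    moreover have "integral {a..b} (\<lambda>x. g x * (bump m s r x - k * B x)) =
       integral {a..b} (\<lambda>x. g x * bump m s r x) - k * integral {a..b} (\<lambda>x. g x * B x)"
      using integral_diff[OF gf[OF cE] integrable_on_mult_right[OF gf[OF cB], of k]]
      by (simp add: algebra_simps)
    moreover have "integral {a..b} (\<lambda>x. (g x - c) * bump m s r x) =
       integral {a..b} (\<lambda>x. g x * bump m s r x) - c * integral {a..b} (bump m s r)"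
      using integral_diff[OF gf[OF cE] integrable_on_mult_right[OF Ei, of c]]
      by (simp add: algebra_simps)
    ultimately show ?thesis by (simp add: k_def c_def)
  qed
  have gc: "(\<lambda>x. g x - c) absolutely_integrable_on {a..b}"
    using g by (intro set_integral_diff) auto
  have gci: "(\<lambda>x. g x - c) integrable_on {a..b}" "(\<lambda>x. \<bar>g x - c\<bar>) integrable_on {a..b}"
    using gc by (auto simp: absolutely_integrable_on_def)
  have z: "integral {x..y} (\<lambda>x. g x - c) = 0" if xy: "a \<le> x" "x \<le> y" "y \<le> b" for x y
  proof (cases "x < y")
    case True
    define f where "f n = bump (real (Suc n)) (x + (y-x)/real (n+3)) (y - (y-x)/real (n+3))" for n
    have cf: "continuous_on S (f n)" for S n
      using bump_smooth[of "real (Suc n)"] smooth_derivs_continuous f_def by metis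
    have fi: "integral {a..b} (\<lambda>t. (g t - c) * f n t) = 0" for n
      unfolding f_def
    proof (rule main)
      have q: "(y-x)/real (n+3) > 0" "(y-x)/real (n+3) \<le> (y-x)/2"
        using True by (simp, intro divide_left_mono) auto
      show "a < x + (y-x)/real (n+3)" "y - (y-x)/real (n+3) < b" using q(1) xy by linarith+
      show "x + (y-x)/real (n+3) \<le> y - (y-x)/real (n+3)" using q(2) by argo
    qed auto
    have "((\<lambda>t. (g t - c) * indicator {x<..<y} t) has_integral 0) {a..b}"
    proof (rule has_integral_dominated_convergence[where f = "\<lambda>n t. (g t - c) * f n t" and y="\<lambda>_. 0"])
      show "((\<lambda>t. (g t - c) * f n t) has_integral 0) {a..b}" for n
        using fi[of n] absolutely_integrable_times_continuous[OF gc cf[of _ n]]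
          set_lebesgue_integral_eq_integral(1) by (metis has_integral_integral)
      show "(\<lambda>x. \<bar>g x - c\<bar>) integrable_on {a..b}" by (rule gci)
      show "\<forall>t\<in>{a..b}. norm ((g t - c) * f n t) \<le> \<bar>g t - c\<bar>" for n
        using bump_bounds by (auto simp: f_def abs_mult intro!: mult_left_le)
      show "\<forall>t\<in>{a..b}. (\<lambda>n. (g t - c) * f n t) \<longlonglongrightarrow> (g t - c) * indicator {x<..<y} t"
        unfolding f_def by (intro ballI tendsto_mult tendsto_const bump_tendsto True)
    qed auto
    then have "((\<lambda>t. if t \<in> {x<..<y} then g t - c else 0) has_integral 0) {a..b}"
      by (rule has_integral_eq[rotated]) auto
    then have "((\<lambda>t. g t - c) has_integral 0) {x<..<y}"
      by (subst (asm) has_integral_restrict) (use xy in auto)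
    then show ?thesis by (metis has_integral_Icc_iff_Ioo integral_unique)
  qed (use xy in auto)
  have "negligible {x\<in>{a..b}. g x - c \<noteq> 0}"
    by (rule negligible_integrals_zero[OF gci(1) z])
  then show ?thesis by auto
qed

section \<open>Sobolev functions as iterated primitives\<close>

lemma nn_integral_Ioo_has_integral:
  fixes f :: "real \<Rightarrow> real"
  assumes "(f has_integral I) {a..b}" "\<And>x. 0 \<le> f x"
  shows "(\<integral>\<^sup>+x\<in>{a<..<b}. ennreal (f x) \<partial>lebesgue) = ennreal I"
proof -
  have "(f has_integral I) {a<..<b}" using assms(1) has_integral_Icc_iff_Ioo by blast
  then show ?thesis
    using nn_integral_has_integral_lebesgue'[of "{a<..<b}" f I] assms(2) by (simp add: nn_integral_completion)
qed

lemma integrable_on_Icc_of_nn_integral: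
  fixes f :: "real \<Rightarrow> real"
  assumes m: "set_borel_measurable lebesgue {a<..<b} f" and nn: "\<And>x. 0 \<le> f x"
    and fin: "(\<integral>\<^sup>+x\<in>{a<..<b}. ennreal (f x) \<partial>lebesgue) < \<infinity>"
  shows "f integrable_on {a..b}"
proof -
  let ?h = "\<lambda>x. if x \<in> {a<..<b} then f x else 0"
  have h: "?h = (\<lambda>x. indicator {a<..<b} x *\<^sub>R f x)" by auto
  have eq: "(\<integral>\<^sup>+x. ennreal (?h x) \<partial>lebesgue) = (\<integral>\<^sup>+x\<in>{a<..<b}. ennreal (f x) \<partial>lebesgue)"
    by (intro nn_integral_cong) auto
  have "(?h has_integral enn2real (\<integral>\<^sup>+x. ennreal (?h x) \<partial>lebesgue)) UNIV"
    by (subst has_integral_iff_nn_integral_lebesgue)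
       (use m nn fin eq h in \<open>auto simp: set_borel_measurable_def\<close>)
  then show ?thesis
    unfolding has_integral_restrict_UNIV by (metis has_integral_Icc_iff_Ioo integrable_on_def)
qed

text \<open>On a bounded interval |u| \<le> 1 + |u|^p makes L^p functions absolutely integrable, so
  primitives of them exist.\<close>

lemma Lp_fun_iff:
  assumes p: "1 \<le> p"
  shows "Lp_fun p a b u \<longleftrightarrow> u absolutely_integrable_on {a..b} \<and> (\<lambda>x. \<bar>u x\<bar> powr p) integrable_on {a..b}"
proof
  assume L: "Lp_fun p a b u"
  then have m: "set_borel_measurable lebesgue {a<..<b} u"
    and fin: "(\<integral>\<^sup>+x\<in>{a<..<b}. ennreal (\<bar>u x\<bar> powr p) \<partial>lebesgue) < \<infinity>"
    by (auto simp: Lp_fun_def)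
  have mu: "u \<in> borel_measurable (lebesgue_on {a<..<b})"
    using m by (simp add: set_borel_measurable_def borel_measurable_restrict_space_iff)
  then have "(\<lambda>x. \<bar>u x\<bar> powr p) \<in> borel_measurable (lebesgue_on {a<..<b})" by measurable
  then have "set_borel_measurable lebesgue {a<..<b} (\<lambda>x. \<bar>u x\<bar> powr p)"
    by (simp add: set_borel_measurable_def borel_measurable_restrict_space_iff)
  then have i: "(\<lambda>x. \<bar>u x\<bar> powr p) integrable_on {a..b}"
    by (rule integrable_on_Icc_of_nn_integral) (use fin in auto)
  have "u absolutely_integrable_on {a<..<b}"
  proof (rule measurable_bounded_by_integrable_imp_absolutely_integrable[OF mu])
    show "(\<lambda>x. 1 + \<bar>u x\<bar> powr p) integrable_on {a<..<b}"
      using integrable_add[OF integrable_const_ivl[of 1 a b] i] by (simp add: integrable_on_Icc_iff_Ioo)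
    show "norm (u x) \<le> 1 + \<bar>u x\<bar> powr p" for x
    proof (cases "\<bar>u x\<bar> \<le> 1")
      case False
      then have "\<bar>u x\<bar> powr 1 \<le> \<bar>u x\<bar> powr p" by (intro powr_mono) (use p in auto)
      then show ?thesis using False by simp
    qed (simp add: add_increasing2)
  qed auto
  then show "u absolutely_integrable_on {a..b} \<and> (\<lambda>x. \<bar>u x\<bar> powr p) integrable_on {a..b}"
    using i absolutely_integrable_on_Icc_iff_Ioo by blast
next
  assume R: "u absolutely_integrable_on {a..b} \<and> (\<lambda>x. \<bar>u x\<bar> powr p) integrable_on {a..b}"
  then have "u absolutely_integrable_on {a<..<b}" using absolutely_integrable_on_Icc_iff_Ioo by blast
  then have "u \<in> borel_measurable (lebesgue_on {a<..<b})"
    by (rule absolutely_integrable_imp_borel_measurable) auto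
  then have "set_borel_measurable lebesgue {a<..<b} u"
    by (simp add: set_borel_measurable_def borel_measurable_restrict_space_iff)
  moreover have "(\<integral>\<^sup>+x\<in>{a<..<b}. ennreal (\<bar>u x\<bar> powr p) \<partial>lebesgue) = ennreal (integral {a..b} (\<lambda>x. \<bar>u x\<bar> powr p))"
    by (rule nn_integral_Ioo_has_integral) (use R in auto)
  ultimately show "Lp_fun p a b u" by (simp add: Lp_fun_def)
qed

lemma Lp_fun_measurable:
  "Lp_fun p a b u \<Longrightarrow> u \<in> borel_measurable (lebesgue_on {a<..<b})"
  by (simp add: Lp_fun_def set_borel_measurable_def borel_measurable_restrict_space_iff)

lemma Lp_fun_continuous:
  assumes "continuous_on {a..b} u" "1 \<le> p" shows "Lp_fun p a b u"
  unfolding Lp_fun_iff[OF assms(2)]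
  by (intro conjI absolutely_integrable_continuous_real integrable_continuous_real assms continuous_on_powr' continuous_intros)
     (use assms in auto)

lemma set_lebesgue_integral_Ioo:
  fixes g f :: "real \<Rightarrow> real"
  assumes "g absolutely_integrable_on {a..b}" "continuous_on {a..b} f"
  shows "(LINT x:{a<..<b}|lebesgue. g x * f x) = integral {a..b} (\<lambda>x. g x * f x)"
  using absolutely_integrable_times_continuous[OF assms]
  by (simp add: absolutely_integrable_on_Icc_iff_Ioo set_lebesgue_integral_eq_integral(2) integral_open_interval_real)

lemma weak_deriv_iff:
  assumes u: "u absolutely_integrable_on {a..b}" and v: "v absolutely_integrable_on {a..b}"
  shows "weak_deriv a b u v \<longleftrightarrow>
    (\<forall>D. test_fun a b D \<longrightarrow> integral {a..b} (\<lambda>x. u x * D 1 x) = - integral {a..b} (\<lambda>x. v x * D 0 x))"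
proof -
  have "continuous_on {a..b} (D k)" if "test_fun a b D" for D k
    using that smooth_derivs_continuous by (auto simp: test_fun_def)
  then have "(LINT x:{a<..<b}|lebesgue. u x * D k x) = integral {a..b} (\<lambda>x. u x * D k x)"
    "(LINT x:{a<..<b}|lebesgue. v x * D k x) = integral {a..b} (\<lambda>x. v x * D k x)" if "test_fun a b D" for D k
    using that by (auto intro: set_lebesgue_integral_Ioo u v)
  then show ?thesis
    unfolding weak_deriv_def by (simp cong: imp_cong)
qed

lemma weak_deriv_primitive:
  assumes F: "primitive_on a b F g" and g: "g absolutely_integrable_on {a..b}" and ab: "a < b"
  shows "weak_deriv a b F g"
proof -
  have cF: "continuous_on {a..b} F" by (rule primitive_on_continuous[OF F])
  show ?thesis
    unfolding weak_deriv_iff[OF absolutely_integrable_continuous_real[OF cF] g]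
  proof (intro allI impI)
    fix D assume D: "test_fun a b D"
    have s: "smooth_derivs D" using D by (simp add: test_fun_def)
    have 0: "D 0 a = 0" "D 0 b = 0"
      using D by (force simp: test_fun_def)+
    have d: "(D 0 has_real_derivative D 1 x) (at x)" for x using s by (simp add: smooth_derivs_def)
    note c = smooth_derivs_continuous[OF s]
    have "((\<lambda>x. F x * D 1 x + g x * D 0 x) has_integral 0) {a..b}"
      using primitive_on_by_parts[OF F g d c] ab 0 by simp
    moreover have "(\<lambda>x. F x * D 1 x) integrable_on {a..b}"
      by (intro integrable_continuous_real continuous_intros cF c)
    moreover have "(\<lambda>x. g x * D 0 x) integrable_on {a..b}"
      using absolutely_integrable_times_continuous[OF g c] set_lebesgue_integral_eq_integral(1) by blast
    ultimately have "integral {a..b} (\<lambda>x. F x * D 1 x) + integral {a..b} (\<lambda>x. g x * D 0 x) = 0"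
      by (metis integral_add integral_unique)
    then show "integral {a..b} (\<lambda>x. F x * D 1 x) = - integral {a..b} (\<lambda>x. g x * D 0 x)" by simp
  qed
qed

text \<open>A primitive \<open>W\<close> of \<open>v\<close> has the same weak derivative as
  \<open>u\<close>, so \<open>u - W\<close> is almost everywhere constant by
  \<open>du_Bois_Reymond\<close>, and the constant is absorbed into the primitive.\<close>

lemma weak_deriv_imp_primitive:
  assumes w: "weak_deriv a b u v" and u: "u absolutely_integrable_on {a..b}"
    and v: "v absolutely_integrable_on {a..b}" and ab: "a < b"
  shows "\<exists>F. primitive_on a b F v \<and> negligible {x\<in>{a..b}. u x \<noteq> F x}"
proof -
  have vi: "v integrable_on {a..b}" using v set_lebesgue_integral_eq_integral(1) by blast
  define W where "W x = integral {a..x} v" for x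
  have W: "primitive_on a b W v" by (rule primitive_on_integral[OF vi, of _ 0]) (simp add: W_def)
  have Wa: "W absolutely_integrable_on {a..b}"
    by (rule absolutely_integrable_continuous_real[OF primitive_on_continuous[OF W]])
  have wW: "weak_deriv a b W v" by (rule weak_deriv_primitive[OF W v ab])
  have "\<exists>c. negligible {x\<in>{a..b}. u x - W x \<noteq> c}"
  proof (rule du_Bois_Reymond[OF _ ab])
    show "(\<lambda>x. u x - W x) absolutely_integrable_on {a..b}" using u Wa by (rule set_integral_diff)
    fix D assume D: "test_fun a b D"
    then have c: "continuous_on {a..b} (D 1)" by (auto simp: test_fun_def intro: smooth_derivs_continuous)
    have "integral {a..b} (\<lambda>x. u x * D 1 x) = integral {a..b} (\<lambda>x. W x * D 1 x)"
      using w wW D unfolding weak_deriv_iff[OF u v] weak_deriv_iff[OF Wa v] by metis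
    moreover have "integral {a..b} (\<lambda>x. u x * D 1 x - W x * D 1 x) = integral {a..b} (\<lambda>x. u x * D 1 x) - integral {a..b} (\<lambda>x. W x * D 1 x)"
      by (intro integral_diff set_lebesgue_integral_eq_integral(1) absolutely_integrable_times_continuous u Wa c)
    ultimately show "integral {a..b} (\<lambda>x. (u x - W x) * D 1 x) = 0" by (simp add: algebra_simps)
  qed
  then obtain c where c: "negligible {x\<in>{a..b}. u x - W x \<noteq> c}" by blast
  have "primitive_on a b (\<lambda>x. W x + c) v" using W by (simp add: primitive_on_def)
  moreover have "negligible {x\<in>{a..b}. u x \<noteq> W x + c}"
    by (rule negligible_subset[OF c]) auto
  ultimately show ?thesis by blast
qed

lemma continuous_eq_ae_imp_eq:
  fixes f g :: "real \<Rightarrow> real"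
  assumes f: "continuous_on {a..b} f" and g: "continuous_on {a..b} g" and ab: "a < b"
    and n: "negligible {x\<in>{a..b}. f x \<noteq> g x}" and x: "x \<in> {a..b}"
  shows "f x = g x"
proof -
  have "integral {a..b} (\<lambda>x. \<bar>f x - g x\<bar>) = integral {a..b} (\<lambda>x. 0)"
    by (rule integral_spike[OF n]) auto
  then have "\<forall>x\<in>{a..b}. \<bar>f x - g x\<bar> = 0"
    by (subst integral_eq_0_iff[symmetric]) (use f g ab in \<open>auto intro!: continuous_intros\<close>)
  then show ?thesis using x by auto
qed

lemma primitive_on_unique:
  assumes "primitive_on a b F f" "primitive_on a b F g" "a < b"
  shows "negligible {x\<in>{a..b}. f x \<noteq> g x}"
proof -
  have "negligible {x\<in>{a..b}. f x - g x \<noteq> 0}"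
  proof (rule negligible_integrals_zero)
    show "(\<lambda>x. f x - g x) integrable_on {a..b}"
      using assms by (intro integrable_diff primitive_on_integrable(1)[of a b]) auto
    show "integral {x..y} (\<lambda>x. f x - g x) = 0" if "a \<le> x" "x \<le> y" "y \<le> b" for x y
      using has_integral_diff[OF primitive_onD[OF assms(1) that] primitive_onD[OF assms(2) that]]
      by (simp add: integral_unique)
  qed
  then show ?thesis by simp
qed

text \<open>Whatever \<open>SOME\<close> picks is a weak second derivative through some intermediate
  \<open>v\<close>. This \<open>v\<close> agrees almost everywhere with a primitive \<open>V\<close>
  of it, and replacing \<open>v\<close> by \<open>V\<close> leaves all integrals unchanged.\<close>

lemma W2p_imp_primitive:
  assumes W: "W2p p a b u" and p: "1 \<le> p" and ab: "a < b"
  shows "Lp_fun p a b (wdd p a b u) \<and> (\<exists>U V. primitive_on a b U V \<and> primitive_on a b V (wdd p a b u) \<and>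
    negligible {x\<in>{a..b}. u x \<noteq> U x})"
proof -
  let ?w = "wdd p a b u"
  have "\<exists>w v. Lp_fun p a b v \<and> Lp_fun p a b w \<and> weak_deriv a b u v \<and> weak_deriv a b v w"
    using W unfolding W2p_def by blast
  then have "\<exists>v. Lp_fun p a b v \<and> Lp_fun p a b ?w \<and> weak_deriv a b u v \<and> weak_deriv a b v ?w"
    unfolding wdd_def by (rule someI_ex)
  then obtain v where v: "Lp_fun p a b v" "Lp_fun p a b ?w" "weak_deriv a b u v" "weak_deriv a b v ?w" by blast
  have ai: "u absolutely_integrable_on {a..b}" "v absolutely_integrable_on {a..b}" "?w absolutely_integrable_on {a..b}"
    using W v Lp_fun_iff[OF p] by (auto simp: W2p_def)
  obtain U where U: "primitive_on a b U v" "negligible {x\<in>{a..b}. u x \<noteq> U x}"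
    using weak_deriv_imp_primitive[OF v(3) ai(1,2) ab] by blast
  obtain V where V: "primitive_on a b V ?w" "negligible {x\<in>{a..b}. v x \<noteq> V x}"
    using weak_deriv_imp_primitive[OF v(4) ai(2,3) ab] by blast
  have "primitive_on a b U V"
    by (rule primitive_on_cong[OF U(1) _ V(2)]) auto
  then show ?thesis using U V v by blast
qed

text \<open>\<open>wdd\<close> is an arbitrary choice, so it is identified by going back: it has
  iterated primitives \<open>V'\<close> and \<open>U'\<close>, continuity turns their
  almost-everywhere equality with \<open>V\<close> and \<open>U\<close> into equality, and two
  integrands of one primitive agree almost everywhere.\<close>

lemma W2p_of_primitive:
  assumes U: "primitive_on a b U V" and V: "primitive_on a b V G" and G: "Lp_fun p a b G"
    and p: "1 \<le> p" and ab: "a < b"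
  shows "W2p p a b U" and "negligible {x\<in>{a..b}. wdd p a b U x \<noteq> G x}"
proof -
  have cU: "continuous_on {a..b} U" and cV: "continuous_on {a..b} V"
    using U V primitive_on_continuous by blast+
  have "G absolutely_integrable_on {a..b}" using G Lp_fun_iff[OF p] by blast
  then have "weak_deriv a b V G" "weak_deriv a b U V"
    using weak_deriv_primitive[OF V _ ab] weak_deriv_primitive[OF U absolutely_integrable_continuous_real[OF cV] ab] by auto
  then show W: "W2p p a b U"
    using Lp_fun_continuous[OF cU p] Lp_fun_continuous[OF cV p] G unfolding W2p_def by blast
  obtain U' V' where *: "primitive_on a b U' V'" "primitive_on a b V' (wdd p a b U)" "negligible {x\<in>{a..b}. U x \<noteq> U' x}"
    using W2p_imp_primitive[OF W p ab] by blast
  have eU: "U x = U' x" if "x \<in> {a..b}" for x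
    using continuous_eq_ae_imp_eq[OF cU primitive_on_continuous[OF *(1)] ab *(3) that] .
  have "primitive_on a b U V'" by (rule primitive_on_cong[OF *(1), of _ "{}"]) (use eU in auto)
  from primitive_on_unique[OF this U ab]
  have eV: "V' x = V x" if "x \<in> {a..b}" for x
    using continuous_eq_ae_imp_eq[OF primitive_on_continuous[OF *(2)] cV ab _ that] by blast
  have "primitive_on a b V (wdd p a b U)" by (rule primitive_on_cong[OF *(2), of _ "{}"]) (use eV in auto)
  from primitive_on_unique[OF this V ab]
  show "negligible {x\<in>{a..b}. wdd p a b U x \<noteq> G x}" .
qed

text \<open>Membership in \<open>W\<^sup>2\<^sup>,\<^sup>p\<close> together with the square integrability of \<open>U''\<close> that finite energy provides.\<close>

definition H2 :: "real \<Rightarrow> real \<Rightarrow> real \<Rightarrow> (real \<Rightarrow> real) \<Rightarrow> (real \<Rightarrow> real) \<Rightarrow> (real \<Rightarrow> real) \<Rightarrow> bool" where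
  "H2 p a b U V G \<longleftrightarrow> primitive_on a b U V \<and> primitive_on a b V G \<and>
     (\<lambda>x. \<bar>G x\<bar> powr p) integrable_on {a..b} \<and> (\<lambda>x. (G x)\<^sup>2) integrable_on {a..b}"

lemma H2_Lp_fun:
  assumes "H2 p a b U V G" "1 \<le> p" "a \<le> b" shows "Lp_fun p a b G"
proof -
  have g: "G integrable_on {a..b}" using assms primitive_on_integrable(1)[of a b V G a b] by (auto simp: H2_def)
  have i: "(\<lambda>x. 1 + \<bar>G x\<bar> powr p) integrable_on {a..b}"
    using assms by (intro integrable_add) (auto simp: H2_def)
  have "norm (G x) \<le> 1 + \<bar>G x\<bar> powr p" for x
  proof (cases "\<bar>G x\<bar> \<le> 1")
    case False
    then have "\<bar>G x\<bar> powr 1 \<le> \<bar>G x\<bar> powr p" by (intro powr_mono) (use assms in auto)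
    then show ?thesis using False by simp
  qed (simp add: add_increasing2)
  then have "G absolutely_integrable_on {a..b}"
    by (intro absolutely_integrable_integrable_bound[OF _ g i]) auto
  then show ?thesis using assms by (auto simp: Lp_fun_iff H2_def)
qed

lemma H2_energy_integrable:
  assumes "H2 p a b U V G"
  shows "(\<lambda>x. (U x ^ 2 - 1) ^ 2) integrable_on {a..b}" "(\<lambda>x. (G x)\<^sup>2) integrable_on {a..b}"
  using assms primitive_on_continuous[of a b U V]
  by (auto simp: H2_def intro!: integrable_continuous_real continuous_intros)

definition energy :: "real \<Rightarrow> real \<Rightarrow> real \<Rightarrow> (real \<Rightarrow> real) \<Rightarrow> (real \<Rightarrow> real) \<Rightarrow> real" where
  "energy e a b U G = integral {a..b} (\<lambda>x. (U x ^ 2 - 1) ^ 2 / e + e ^ 3 * (G x) ^ 2)"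

lemma energy_integrable:
  assumes "H2 p a b U V G"
  shows "(\<lambda>x. (U x ^ 2 - 1) ^ 2 / e + e ^ 3 * (G x) ^ 2) integrable_on {a..b}"
  using H2_energy_integrable[OF assms]
  by (intro integrable_add integrable_on_mult_right integrable_on_divide)

lemma negligible_AE_Ioo:
  fixes a b :: real
  assumes "negligible {x\<in>{a..b}. f x \<noteq> g x}"
  shows "AE x in lebesgue. x \<in> {a<..<b} \<longrightarrow> f x = g x"
  unfolding eventually_ae_filter_negligible
  by (intro exI[of _ "{x\<in>{a..b}. f x \<noteq> g x}"] conjI assms) auto

lemma F_eps_H2:
  assumes H: "H2 p a b U V G" and "1 \<le> p" "a < b" "e > 0"
  shows "F_eps p a b e U = ereal (energy e a b U G)"
proof -
  have W: "W2p p a b U" "negligible {x\<in>{a..b}. wdd p a b U x \<noteq> G x}"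
    using W2p_of_primitive[of a b U V G p] H2_Lp_fun[OF H] assms by (auto simp: H2_def)
  have "(\<integral>\<^sup>+x\<in>{a<..<b}. ennreal ((U x ^ 2 - 1) ^ 2 / e + e ^ 3 * (wdd p a b U x) ^ 2) \<partial>lebesgue)
    = (\<integral>\<^sup>+x\<in>{a<..<b}. ennreal ((U x ^ 2 - 1) ^ 2 / e + e ^ 3 * (G x) ^ 2) \<partial>lebesgue)"
    using negligible_AE_Ioo[OF W(2)] by (intro nn_integral_cong_AE) (auto elim!: eventually_mono split: split_indicator)
  also have "\<dots> = ennreal (energy e a b U G)"
    unfolding energy_def
    by (rule nn_integral_Ioo_has_integral) (use energy_integrable[OF H] assms in auto)
  finally show ?thesis
    using W(1) assms energy_integrable[OF H, of e] unfolding F_eps_def energy_def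
    by (simp add: enn2ereal_ennreal integral_nonneg)
qed

lemma wdd_square_integrable:
  assumes W: "W2p p a b u" and p: "1 \<le> p" and ab: "a < b"
    and fin: "(\<integral>\<^sup>+x\<in>{a<..<b}. ennreal ((wdd p a b u x) ^ 2) \<partial>lebesgue) < \<infinity>"
  shows "\<exists>U V. H2 p a b U V (wdd p a b u) \<and> negligible {x\<in>{a..b}. u x \<noteq> U x}"
proof -
  let ?w = "wdd p a b u"
  have L: "Lp_fun p a b ?w" using W2p_imp_primitive[OF W p ab] by blast
  have "(\<lambda>x. (?w x)^2) \<in> borel_measurable (lebesgue_on {a<..<b})"
    using Lp_fun_measurable[OF L] by measurable
  then have "set_borel_measurable lebesgue {a<..<b} (\<lambda>x. (?w x)^2)"
    by (simp add: set_borel_measurable_def borel_measurable_restrict_space_iff)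
  then have "(\<lambda>x. (?w x)^2) integrable_on {a..b}"
    by (rule integrable_on_Icc_of_nn_integral) (use fin in auto)
  then show ?thesis
    using W2p_imp_primitive[OF W p ab] Lp_fun_iff[OF p] by (auto simp: H2_def)
qed

lemma F_eps_finite:
  assumes fin: "F_eps p a b e u < \<infinity>" and p: "1 \<le> p" and ab: "a < b" and e: "e > 0"
  shows "\<exists>U V G. H2 p a b U V G \<and> negligible {x\<in>{a..b}. u x \<noteq> U x} \<and> F_eps p a b e u = ereal (energy e a b U G)"
proof -
  let ?w = "wdd p a b u"
  let ?h = "\<lambda>v x. (v x ^ 2 - 1) ^ 2 / e + e ^ 3 * (?w x) ^ 2"
  have W: "W2p p a b u" using fin by (auto simp: F_eps_def split: if_splits)
  let ?I = "(\<integral>\<^sup>+x\<in>{a<..<b}. ennreal (?h u x) \<partial>lebesgue)"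
  have I: "?I < \<infinity>"
  proof (rule ccontr)
    assume "\<not> ?I < \<infinity>"
    then have "?I = \<infinity>" by (simp add: less_top[symmetric])
    then show False using fin W by (simp add: F_eps_def)
  qed
  \<comment> \<open>For p < 2 membership in W^{2,p} does not control the square of the second
    derivative; the energy does, because e > 0 is fixed here.\<close>
  have "(\<integral>\<^sup>+x\<in>{a<..<b}. ennreal ((?w x) ^ 2) \<partial>lebesgue) \<le> (\<integral>\<^sup>+x\<in>{a<..<b}. ennreal (1/e^3) * ennreal (?h u x) \<partial>lebesgue)"
  proof (rule nn_integral_mono)
    fix x
    have "(?w x)^2 \<le> 1/e^3 * (?h u x)"
      using e by (simp add: ring_distribs)
    then have "ennreal ((?w x) ^ 2) \<le> ennreal (1/e^3 * (?h u x))"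
      by (rule ennreal_leI)
    also have "\<dots> = ennreal (1/e^3) * ennreal (?h u x)"
      using e by (intro ennreal_mult') auto
    finally show "ennreal ((?w x) ^ 2) * indicator {a<..<b} x \<le> ennreal (1/e^3) * ennreal (?h u x) * indicator {a<..<b} x"
      by (rule mult_right_mono) auto
  qed
  also have "\<dots> = (\<integral>\<^sup>+x. ennreal (1/e^3) * (ennreal (?h u x) * indicator {a<..<b} x) \<partial>lebesgue)"
    by (simp add: mult.assoc)
  also have "\<dots> = ennreal (1/e^3) * ?I"
  proof (rule nn_integral_cmult)
    have 1: "u \<in> borel_measurable (lebesgue_on {a<..<b})" "?w \<in> borel_measurable (lebesgue_on {a<..<b})"
      using W W2p_imp_primitive[OF W p ab] by (auto simp: W2p_def intro: Lp_fun_measurable)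
    then have "(\<lambda>x. ennreal (?h u x)) \<in> borel_measurable (lebesgue_on {a<..<b})"
      by measurable
    then show "(\<lambda>x. ennreal (?h u x) * indicator {a<..<b} x) \<in> borel_measurable lebesgue"
      by (simp add: borel_measurable_restrict_space_iff_ennreal)
  qed
  also have "\<dots> < \<infinity>" using I by (simp add: ennreal_mult_less_top)
  finally have "(\<integral>\<^sup>+x\<in>{a<..<b}. ennreal ((?w x) ^ 2) \<partial>lebesgue) < \<infinity>" .
  from wdd_square_integrable[OF W p ab this] obtain U V
    where H: "H2 p a b U V ?w" and n: "negligible {x\<in>{a..b}. u x \<noteq> U x}" by blast
  have "?I = (\<integral>\<^sup>+x\<in>{a<..<b}. ennreal (?h U x) \<partial>lebesgue)"
    using negligible_AE_Ioo[OF n] by (intro nn_integral_cong_AE) (auto elim!: eventually_mono split: split_indicator)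
  also have "\<dots> = ennreal (energy e a b U ?w)"
    unfolding energy_def
    by (rule nn_integral_Ioo_has_integral) (use energy_integrable[OF H] e in auto)
  finally have "F_eps p a b e u = ereal (energy e a b U ?w)"
    using W e energy_integrable[OF H, of e] unfolding F_eps_def energy_def
    by (simp add: enn2ereal_ennreal integral_nonneg)
  then show ?thesis using H n by blast
qed

section \<open>Energy of transitions and of quiet intervals\<close>

lemma H2_subinterval:
  assumes "H2 p a b U V G" "a \<le> c" "d \<le> b" shows "H2 p c d U V G"
  using assms by (auto simp: H2_def intro: primitive_on_subinterval integrable_on_subinterval)

lemma H2_affine:
  assumes H: "H2 p a b U V G" and m: "m > 0" and cd: "a \<le> m*c+k" "m*d+k \<le> b"
  shows "H2 p c d (\<lambda>x. U (m*x+k)) (\<lambda>x. m * V (m*x+k)) (\<lambda>x. m\<^sup>2 * G (m*x+k))"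
  unfolding H2_def
proof (intro conjI)
  have H': "primitive_on a b U V" "primitive_on a b V G" using H by (auto simp: H2_def)
  show "primitive_on c d (\<lambda>x. U (m*x+k)) (\<lambda>x. m * V (m*x+k))"
    by (rule primitive_on_affine[OF H'(1) m cd])
  show "primitive_on c d (\<lambda>x. m * V (m*x+k)) (\<lambda>x. m\<^sup>2 * G (m*x+k))"
    using primitive_on_cmult[OF primitive_on_affine[OF H'(2) m cd], of m] by (simp add: power2_eq_square mult.assoc)
  have i: "(\<lambda>x. f (m*x+k)) integrable_on {c..d}" if "f integrable_on {a..b}" for f :: "real \<Rightarrow> real"
  proof -
    have "f integrable_on {m*c+k..m*d+k}" using that cd by (auto intro: integrable_on_subinterval)
    then show ?thesis unfolding integrable_on_def by (blast intro: has_integral_affine_real[OF _ m])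
  qed
  have "(\<lambda>x. \<bar>G x\<bar> powr p) integrable_on {a..b}" "(\<lambda>x. (G x)\<^sup>2) integrable_on {a..b}" using H by (auto simp: H2_def)
  note this[THEN i]
  from integrable_on_mult_right[OF this(1), of "(m\<^sup>2) powr p"] integrable_on_mult_right[OF this(2), of "(m\<^sup>2)\<^sup>2"]
  show "(\<lambda>x. \<bar>m\<^sup>2 * G (m*x+k)\<bar> powr p) integrable_on {c..d}" "(\<lambda>x. (m\<^sup>2 * G (m*x+k))\<^sup>2) integrable_on {c..d}"
    by (simp_all add: abs_mult powr_mult power_mult_distrib)
qed

lemma H2_uminus:
  "H2 p a b U V G \<Longrightarrow> H2 p a b (\<lambda>x. - U x) (\<lambda>x. - V x) (\<lambda>x. - G x)"
  by (simp add: H2_def primitive_on_uminus)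

lemma energy_uminus [simp]: "energy e a b (\<lambda>x. - U x) (\<lambda>x. - G x) = energy e a b U G"
  by (simp add: energy_def)

lemma integrable_on_If_concat:
  fixes f g :: "real \<Rightarrow> real"
  assumes "f integrable_on {a..c}" "g integrable_on {c..b}" "a \<le> c" "c \<le> b"
  shows "(\<lambda>x. if x \<le> c then f x else g x) integrable_on {a..b}"
    and "integral {a..b} (\<lambda>x. if x \<le> c then f x else g x) = integral {a..c} f + integral {c..b} g"
proof -
  let ?h = "\<lambda>x. if x \<le> c then f x else g x"
  have "(?h has_integral integral {a..c} f) {a..c}"
    by (rule has_integral_eq[OF _ integrable_integral[OF assms(1)]]) auto
  moreover have "(?h has_integral integral {c..b} g) {c..b}"
    by (rule has_integral_spike[of "{c}", OF _ _ integrable_integral[OF assms(2)]]) auto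
  ultimately have "(?h has_integral (integral {a..c} f + integral {c..b} g)) {a..b}"
    using has_integral_combine assms by blast
  then show "?h integrable_on {a..b}" "integral {a..b} ?h = integral {a..c} f + integral {c..b} g" by auto
qed

lemma primitive_on_If:
  assumes "primitive_on a c F f" "primitive_on c b F' f'" "F c = F' c" "a \<le> c" "c \<le> b"
  shows "primitive_on a b (\<lambda>x. if x \<le> c then F x else F' x) (\<lambda>x. if x \<le> c then f x else f' x)"
proof (rule primitive_on_concat[of _ c])
  show "primitive_on a c (\<lambda>x. if x \<le> c then F x else F' x) (\<lambda>x. if x \<le> c then f x else f' x)"
    by (rule primitive_on_cong[OF assms(1), of _ "{}"]) auto
  show "primitive_on c b (\<lambda>x. if x \<le> c then F x else F' x) (\<lambda>x. if x \<le> c then f x else f' x)"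
    by (rule primitive_on_cong[OF assms(2), of _ "{c}"]) (use assms in auto)
qed (use assms in auto)

text \<open>Equal values and slopes at \<open>c\<close> suffice: the second derivative may jump
  there, at a single point that integrals do not see.\<close>

lemma H2_concat:
  assumes H: "H2 p a c U V G" and H': "H2 p c b U' V' G'" and eq: "U c = U' c" "V c = V' c" and ord: "a \<le> c" "c \<le> b"
  defines "W \<equiv> \<lambda>x. if x \<le> c then U x else U' x"
    and "K \<equiv> \<lambda>x. if x \<le> c then G x else G' x"
  shows "H2 p a b W (\<lambda>x. if x \<le> c then V x else V' x) K"
    and "energy e a b W K = energy e a c U G + energy e c b U' G'"
proof -
  have 1: "(\<lambda>x. if x \<le> c then \<bar>G x\<bar> powr p else \<bar>G' x\<bar> powr p) integrable_on {a..b}"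
    "(\<lambda>x. if x \<le> c then (G x)\<^sup>2 else (G' x)\<^sup>2) integrable_on {a..b}"
    using H H' ord by (auto simp: H2_def intro!: integrable_on_If_concat)
  have 2: "(\<lambda>x. \<bar>K x\<bar> powr p) = (\<lambda>x. if x \<le> c then \<bar>G x\<bar> powr p else \<bar>G' x\<bar> powr p)"
    "(\<lambda>x. (K x)\<^sup>2) = (\<lambda>x. if x \<le> c then (G x)\<^sup>2 else (G' x)\<^sup>2)"
    by (auto simp: K_def)
  have "primitive_on a b W (\<lambda>x. if x \<le> c then V x else V' x)"
    unfolding W_def by (rule primitive_on_If) (use H H' eq ord in \<open>auto simp: H2_def\<close>)
  moreover have "primitive_on a b (\<lambda>x. if x \<le> c then V x else V' x) K"
    unfolding K_def by (rule primitive_on_If) (use H H' eq ord in \<open>auto simp: H2_def\<close>)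
  ultimately show "H2 p a b W (\<lambda>x. if x \<le> c then V x else V' x) K"
    unfolding H2_def 2 using 1 by blast
  have "(\<lambda>x. (W x ^ 2 - 1) ^ 2 / e + e ^ 3 * (K x) ^ 2) = (\<lambda>x. if x \<le> c then (U x ^ 2 - 1) ^ 2 / e + e ^ 3 * (G x) ^ 2
     else (U' x ^ 2 - 1) ^ 2 / e + e ^ 3 * (G' x) ^ 2)"
    by (auto simp: W_def K_def)
  then show "energy e a b W K = energy e a c U G + energy e c b U' G'"
    unfolding energy_def using integrable_on_If_concat(2)[OF energy_integrable[OF H] energy_integrable[OF H'] ord] by simp
qed

lemma H2_smooth:
  assumes "\<And>x. (U has_real_derivative V x) (at x)" "\<And>x. (V has_real_derivative G x) (at x)"
    "continuous_on {a..b} G" "1 \<le> p"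
  shows "H2 p a b U V G"
  unfolding H2_def
proof (intro conjI)
  show "primitive_on a b U V" "primitive_on a b V G"
    using assms(1,2) by (auto intro: derivative_primitive_on has_field_derivative_at_within)
  show "(\<lambda>x. \<bar>G x\<bar> powr p) integrable_on {a..b}"
    by (intro integrable_continuous_real continuous_on_powr' continuous_intros assms(3)) (use assms(4) in auto)
  show "(\<lambda>x. (G x)\<^sup>2) integrable_on {a..b}"
    by (intro integrable_continuous_real continuous_intros assms(3))
qed

lemma H2_const: "1 \<le> p \<Longrightarrow> H2 p a b (\<lambda>x. c) (\<lambda>x. 0) (\<lambda>x. 0)"
  by (rule H2_smooth) auto

lemma energy_nonneg:
  assumes "e > 0" shows "0 \<le> energy e a b U G"
proof (cases "(\<lambda>x. (U x ^ 2 - 1) ^ 2 / e + e ^ 3 * (G x) ^ 2) integrable_on {a..b}")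
  case True
  then show ?thesis unfolding energy_def by (rule integral_nonneg) (use assms in auto)
qed (simp add: energy_def not_integrable_integral)

lemma energy_combine:
  assumes "H2 p a b U V G" "a \<le> c" "c \<le> b"
  shows "energy e a c U G + energy e c b U G = energy e a b U G"
  unfolding energy_def by (rule Henstock_Kurzweil_Integration.integral_combine[OF assms(2,3) energy_integrable[OF assms(1)]])

lemma energy_mono:
  assumes "H2 p a b U V G" "a \<le> c" "d \<le> b" "e > 0"
  shows "energy e c d U G \<le> energy e a b U G"
  unfolding energy_def
proof (rule integral_subset_le)
  show "(\<lambda>x. (U x ^ 2 - 1) ^ 2 / e + e ^ 3 * (G x) ^ 2) integrable_on {c..d}"
    using energy_integrable[OF H2_subinterval[OF assms(1-3)]] .
  show "(\<lambda>x. (U x ^ 2 - 1) ^ 2 / e + e ^ 3 * (G x) ^ 2) integrable_on {a..b}"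
    by (rule energy_integrable[OF assms(1)])
qed (use assms in auto)

text \<open>A dilation by \<open>m\<close> multiplies the squared second derivative by m^4, and
  (e/m)^3 takes back m^3. The remaining m, which the potential term acquires too, cancels against
  the change of variable; so only lengths measured in units of \<open>e\<close> matter.\<close>

lemma energy_affine:
  assumes H: "H2 p a b U V G" and m: "m > 0" and cd: "a \<le> m*c+k" "m*d+k \<le> b" and e: "e > 0"
  shows "energy (e/m) c d (\<lambda>x. U (m*x+k)) (\<lambda>x. m\<^sup>2 * G (m*x+k)) = energy e (m*c+k) (m*d+k) U G"
proof -
  let ?h = "\<lambda>x. (U x ^ 2 - 1) ^ 2 / e + e ^ 3 * (G x) ^ 2"
  have "?h integrable_on {m*c+k..m*d+k}"
    by (rule energy_integrable[OF H2_subinterval[OF H cd]])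
  from has_integral_mult_right[OF has_integral_affine_real[OF integrable_integral[OF this] m], of m]
  have "((\<lambda>x. m * ?h (m*x+k)) has_integral energy e (m*c+k) (m*d+k) U G) {c..d}"
    using m by (simp add: energy_def)
  moreover have "(\<lambda>x. m * ?h (m*x+k)) = (\<lambda>x. (U (m*x+k) ^ 2 - 1) ^ 2 / (e/m) + (e/m) ^ 3 * (m\<^sup>2 * G (m*x+k)) ^ 2)"
    using m e by (intro ext) (simp add: field_simps power2_eq_square power3_eq_cube)
  ultimately show ?thesis
    unfolding energy_def[of "e/m"] by (simp only: integral_unique)
qed

lemma energy_split:
  assumes "H2 p a b U V G"
  shows "energy e a b U G = integral {a..b} (\<lambda>x. (U x ^ 2 - 1) ^ 2) / e + e ^ 3 * integral {a..b} (\<lambda>x. (G x)\<^sup>2)"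
  using H2_energy_integrable[OF assms]
  by (simp add: energy_def integral_add integrable_on_divide integrable_on_mult_right integral_divide)

text \<open>Since \<kappa> \<le> 1, the factor |g + \<sigma>| is at most 4 and |g^2 - 1| at most
  8\<kappa>. With |G| \<le> 10\<kappa> the density is at most (64 + 100)\<kappa>^2.\<close>

lemma energy_le_bound:
  assumes "\<And>x. x \<in> {q..q+1} \<Longrightarrow> \<bar>g x - \<sigma>\<bar> \<le> 2*\<kappa>" "\<And>x. x \<in> {q..q+1} \<Longrightarrow> \<bar>G x\<bar> \<le> 10*\<kappa>"
    "\<sigma> = 1 \<or> \<sigma> = -1" "H2 p q (q+1) g V G" "0 \<le> \<kappa>" "\<kappa> \<le> 1"
  shows "energy 1 q (q+1) g G \<le> 164 * \<kappa>\<^sup>2"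
proof -
  have "energy 1 q (q+1) g G \<le> integral {q..q+1} (\<lambda>x. 164 * \<kappa>\<^sup>2)"
    unfolding energy_def
  proof (rule integral_le[OF energy_integrable[OF assms(4)] integrable_const_ivl])
    fix x assume x: "x \<in> {q..q+1}"
    have "\<bar>g x ^ 2 - 1\<bar> = \<bar>g x - \<sigma>\<bar> * \<bar>g x + \<sigma>\<bar>"
      using assms(3) by (auto simp: abs_mult[symmetric] power2_eq_square algebra_simps)
    also have "\<dots> \<le> (2*\<kappa>) * 4"
      using assms(1)[OF x] assms(3,5,6) by (intro mult_mono) auto
    finally have "\<bar>g x ^ 2 - 1\<bar>^2 \<le> (8*\<kappa>)^2" by (intro power_mono) auto
    moreover have "\<bar>G x\<bar>^2 \<le> (10*\<kappa>)^2" using assms(2)[OF x] by (intro power_mono) auto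
    ultimately show "(g x ^ 2 - 1) ^ 2 / 1 + 1 ^ 3 * (G x) ^ 2 \<le> 164 * \<kappa>\<^sup>2"
      by (simp add: power_mult_distrib)
  qed
  then show ?thesis by simp
qed

text \<open>The Hermite cubics interpolating between a pure phase at \<open>q - d\<close> and the data \<open>(\<sigma> + h, v)\<close> at \<open>q\<close>;
  \<open>d = 1\<close> serves the left end of a transition and \<open>d = -1\<close> the right end.\<close>

lemma hermite:
  assumes hv: "\<bar>h\<bar> \<le> \<kappa>" "\<bar>v\<bar> \<le> \<kappa>" and k: "\<kappa> \<le> 1" and \<sigma>: "\<sigma> = 1 \<or> \<sigma> = -1" and p: "1 \<le> p"
    and d: "d = 1 \<and> c = q - 1 \<or> d = -1 \<and> c = q"
  shows "\<exists>U V G. H2 p c (c+1) U V G \<and> U (q-d) = \<sigma> \<and> V (q-d) = 0 \<and> U q = \<sigma> + h \<and> V q = v \<and>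
    energy 1 c (c+1) U G \<le> 164 * \<kappa>\<^sup>2"
proof -
  \<comment> \<open>\<open>s\<close> runs from 0 at the pure end \<open>q - d\<close> to 1 at
    \<open>q\<close>, in either direction. In \<open>U\<close>, the cubic 3s^2 - 2s^3 carries the
    value and s^3 - s^2 the slope; the sign \<open>d\<close> before \<open>v\<close> undoes the
    chain rule.\<close>
  define s where "s x = d * (x - q) + 1" for x
  define U where "U x = \<sigma> + h * (3 * s x^2 - 2 * s x^3) + d * v * (s x^3 - s x^2)" for x
  define V where "V x = d * h * (6 * s x - 6 * s x^2) + v * (3 * s x^2 - 2 * s x)" for x
  define G where "G x = h * (6 - 12 * s x) + d * v * (6 * s x - 2)" for x
  have dd: "d * d = 1" "\<bar>d\<bar> = 1" using d by auto
  have s': "(s has_real_derivative d) (at x)" for x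
    unfolding s_def by (auto intro!: derivative_eq_intros)
  have "(U has_real_derivative V x) (at x)" "(V has_real_derivative G x) (at x)" for x
    unfolding U_def V_def G_def using d
    by (auto intro!: derivative_eq_intros s' simp: power2_eq_square algebra_simps)
  moreover have "continuous_on S G" for S
    unfolding G_def s_def by (intro continuous_intros)
  ultimately have H: "H2 p c (c+1) U V G" using p by (intro H2_smooth)
  have *: "\<bar>h * S + d * v * T\<bar> \<le> \<kappa> * A + \<kappa> * B" if "\<bar>S\<bar> \<le> A" "\<bar>T\<bar> \<le> B" for S T A B
  proof -
    have "\<bar>h\<bar> * \<bar>S\<bar> \<le> \<kappa> * A" "\<bar>v\<bar> * \<bar>T\<bar> \<le> \<kappa> * B" using hv that by (auto intro!: mult_mono)
    then show ?thesis using abs_triangle_ineq[of "h * S" "d * v * T"] dd by (simp add: abs_mult)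
  qed
  have "energy 1 c (c+1) U G \<le> 164 * \<kappa>\<^sup>2"
  proof (rule energy_le_bound[OF _ _ \<sigma> H])
    fix x assume "x \<in> {c..c+1}"
    then obtain t where t: "t = s x" "0 \<le> t" "t \<le> 1" using d by (auto simp: s_def)
    have pw: "0 \<le> t^2" "t^2 \<le> 1" "0 \<le> t^3" "t^3 \<le> t^2"
      using t power_le_one[of t 2] power_decreasing[of 2 3 t] by auto
    have "0 \<le> (1-t)^2 * (1 + 2*t)" using t by auto
    then have "3*t^2 - 2*t^3 \<le> 1" by (simp add: power2_eq_square power3_eq_cube algebra_simps)
    then have "\<bar>3*t^2 - 2*t^3\<bar> \<le> 1" "\<bar>t^3 - t^2\<bar> \<le> 1" unfolding abs_le_iff using pw by linarith+
    then show "\<bar>U x - \<sigma>\<bar> \<le> 2 * \<kappa>"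
      using *[of "3*t^2 - 2*t^3" 1 "t^3 - t^2" 1] t(1) by (simp add: U_def)
    show "\<bar>G x\<bar> \<le> 10 * \<kappa>" using *[of "6-12*t" 6 "6*t-2" 4] t by (simp add: G_def abs_le_iff)
  qed (use hv k in auto)
  moreover have "U (q-d) = \<sigma>" "V (q-d) = 0" "U q = \<sigma> + h" "V q = v"
    using dd by (auto simp: U_def V_def s_def)
  ultimately show ?thesis using H by blast
qed

text \<open>A value at distance at least \<kappa> from both phases has |f^2 - 1| \<ge> \<kappa>,
  since one of |f - 1| and |f + 1| is at least 1. Were this so everywhere, the potential term alone
  would use up \<kappa>^2 (b - a).\<close>

lemma quiet_point:
  assumes H: "H2 p a b f V G" and ab: "a < b" and E: "energy 1 a b f G < \<kappa>\<^sup>2 * (b - a)" and k: "0 < \<kappa>"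
  shows "\<exists>x\<in>{a..b}. \<exists>\<sigma>\<in>{-1, 1}. \<bar>f x - \<sigma>\<bar> < \<kappa>"
proof (rule ccontr)
  assume "\<not> ?thesis"
  then have far: "\<bar>f x - 1\<bar> \<ge> \<kappa>" "\<bar>f x + 1\<bar> \<ge> \<kappa>" if "x \<in> {a..b}" for x using that by force+
  have "integral {a..b} (\<lambda>x. \<kappa>\<^sup>2) \<le> energy 1 a b f G"
    unfolding energy_def
  proof (rule integral_le[OF integrable_const_ivl energy_integrable[OF H]])
    fix x assume x: "x \<in> {a..b}"
    have "\<kappa> \<le> \<bar>f x ^ 2 - 1\<bar>"
    proof (cases "f x \<ge> 0")
      case True
      have "\<kappa> * 1 \<le> \<bar>f x - 1\<bar> * \<bar>f x + 1\<bar>" using far[OF x] True k by (intro mult_mono) auto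
      then show ?thesis by (simp add: abs_mult[symmetric] power2_eq_square algebra_simps)
    next
      case False
      have "\<kappa> * 1 \<le> \<bar>f x + 1\<bar> * \<bar>f x - 1\<bar>" using far[OF x] False k by (intro mult_mono) auto
      then show ?thesis by (simp add: abs_mult[symmetric] power2_eq_square algebra_simps)
    qed
    then have "\<kappa>^2 \<le> \<bar>f x ^ 2 - 1\<bar>^2" using k by (intro power_mono) auto
    then show "\<kappa>\<^sup>2 \<le> (f x ^ 2 - 1) ^ 2 / 1 + 1 ^ 3 * (G x) ^ 2" by (simp add: add_increasing2)
  qed
  then show False using E ab by (simp add: mult.commute)
qed

text \<open>On a cell of small energy the slope is nearly constant. Among three separated points close to \<open>\<plusminus>1\<close>,
  two are close to the same phase, so the slope is small.\<close>

lemma quiet: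
  assumes H: "H2 p q (q+1) f V G" and s: "0 < s" and E: "energy 1 q (q+1) f G \<le> s\<^sup>2"
  shows "\<exists>\<sigma>\<in>{-1, 1}. \<forall>z\<in>{q..q+1}. \<bar>f z - \<sigma>\<bar> \<le> 34 * s \<and> \<bar>V z\<bar> \<le> 34 * s"
proof -
  have pf: "primitive_on q (q+1) f V" and pV: "primitive_on q (q+1) V G" using H by (auto simp: H2_def)
  have Vosc1: "\<bar>V y - V x\<bar> \<le> s" if "q \<le> x" "x \<le> y" "y \<le> q+1" for x y
  proof -
    have sub: "H2 p x y f V G" by (rule H2_subinterval[OF H that(1,3)])
    \<comment> \<open>Young's inequality |G| \<le> G^2/(2s) + s/2: with energy at most s^2 on a
      length at most 1, each half contributes at most s/2.\<close>
    let ?h = "\<lambda>t. ((f t ^ 2 - 1) ^ 2 / 1 + 1 ^ 3 * (G t) ^ 2) / (2 * s) + s/2"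
    have hi: "(?h has_integral energy 1 x y f G / (2 * s) + s/2 * (y-x)) {x..y}"
      using has_integral_add[OF has_integral_divide[OF integrable_integral[OF energy_integrable[OF sub, of 1]], of "2 * s"] has_integral_const_real[of "s/2" x y]] that
      by (simp add: energy_def mult.commute)
    have "norm (integral {x..y} G) \<le> integral {x..y} ?h"
    proof (rule integral_norm_bound_integral)
      show "G integrable_on {x..y}" using primitive_on_integrable(1)[OF pV] that by auto
      show "?h integrable_on {x..y}" using hi by blast
      fix t
      have "0 \<le> (\<bar>G t\<bar> - s)^2" by simp
      then have "2 * s * \<bar>G t\<bar> \<le> (G t)^2 + s^2" by (simp add: power2_diff algebra_simps)
      then have "2 * s * \<bar>G t\<bar> \<le> ((f t ^ 2 - 1) ^ 2 + (G t)^2) + s^2"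
        using zero_le_power2[of "f t ^ 2 - 1"] by linarith
      then show "norm (G t) \<le> ?h t" using s by (simp add: field_simps power2_eq_square)
    qed
    also have "\<dots> = energy 1 x y f G / (2 * s) + s/2 * (y-x)" using hi by auto
    also have "\<dots> \<le> s\<^sup>2/(2 * s) + s/2 * 1"
      using energy_mono[OF H, of x y 1] that E s by (intro add_mono divide_right_mono mult_left_mono) auto
    also have "\<dots> = s" using s by (simp add: power2_eq_square)
    finally show ?thesis using primitive_on_integrable(2)[OF pV that] by simp
  qed
  have Vosc: "\<bar>V x - V y\<bar> \<le> s" if "x \<in> {q..q+1}" "y \<in> {q..q+1}" for x y
    using Vosc1[of x y] Vosc1[of y x] that by (cases "x \<le> y") auto
  have fV: "\<bar>f y - f x - V z * (y - x)\<bar> \<le> s * (y - x)" if "q \<le> x" "x \<le> y" "y \<le> q+1" "z \<in> {q..q+1}" for x y z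
  proof -
    have "((\<lambda>t. V t - V z) has_integral (f y - f x - V z * (y - x))) {x..y}"
      using has_integral_diff[OF primitive_onD[OF pf that(1-3)] has_integral_const_real[of "V z" x y]] that by (simp add: mult.commute)
    from has_integral_bound_real[OF _ _ this, of s "{}"] show ?thesis
      using Vosc that s by (simp add: content_real_if)
  qed
  \<comment> \<open>A window of length 1/5 is long enough because (3s)^2 / 5 exceeds s^2. The three
    windows used below are separated by 1/5, hence so are the points found in them.\<close>
  have pt: "\<exists>x. c \<le> x \<and> x \<le> c + 1/5 \<and> (\<bar>f x - 1\<bar> < 3 * s \<or> \<bar>f x - (-1)\<bar> < 3 * s)"
    if "q \<le> c" "c + 1/5 \<le> q+1" for c
  proof -
    have "energy 1 c (c + 1/5) f G \<le> s\<^sup>2" using energy_mono[OF H that, of 1] E by simp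
    also have "\<dots> < (3 * s)\<^sup>2 * (c + 1/5 - c)" using s by (simp add: power_mult_distrib)
    finally have "\<exists>x\<in>{c..c+1/5}. \<exists>\<sigma>\<in>{-1, 1}. \<bar>f x - \<sigma>\<bar> < 3 * s"
      by (rule quiet_point[OF H2_subinterval[OF H that], rotated]) (use s in auto)
    then show ?thesis by auto
  qed
  obtain x1 where 1: "q \<le> x1" "x1 \<le> q + 1/5" "\<bar>f x1 - 1\<bar> < 3 * s \<or> \<bar>f x1 - (-1)\<bar> < 3 * s"
    using pt[of q] by (simp, elim exE conjE)
  obtain x2 where 2: "q + 2/5 \<le> x2" "x2 \<le> q + 2/5 + 1/5" "\<bar>f x2 - 1\<bar> < 3 * s \<or> \<bar>f x2 - (-1)\<bar> < 3 * s"
    using pt[of "q + 2/5"] by (simp, elim exE conjE)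
  obtain x3 where 3: "q + 4/5 \<le> x3" "x3 \<le> q + 4/5 + 1/5" "\<bar>f x3 - 1\<bar> < 3 * s \<or> \<bar>f x3 - (-1)\<bar> < 3 * s"
    using pt[of "q + 4/5"] by (simp, elim exE conjE)
  have "\<exists>\<sigma>. (\<sigma> = 1 \<or> \<sigma> = -1) \<and> (\<bar>f x1 - \<sigma>\<bar> < 3 * s \<and> \<bar>f x2 - \<sigma>\<bar> < 3 * s \<or>
      \<bar>f x1 - \<sigma>\<bar> < 3 * s \<and> \<bar>f x3 - \<sigma>\<bar> < 3 * s \<or> \<bar>f x2 - \<sigma>\<bar> < 3 * s \<and> \<bar>f x3 - \<sigma>\<bar> < 3 * s)"
    using 1(3) 2(3) 3(3) by metis
  then obtain \<sigma> where \<sigma>: "\<sigma> = 1 \<or> \<sigma> = -1" "\<bar>f x1 - \<sigma>\<bar> < 3 * s \<and> \<bar>f x2 - \<sigma>\<bar> < 3 * s \<or>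
      \<bar>f x1 - \<sigma>\<bar> < 3 * s \<and> \<bar>f x3 - \<sigma>\<bar> < 3 * s \<or> \<bar>f x2 - \<sigma>\<bar> < 3 * s \<and> \<bar>f x3 - \<sigma>\<bar> < 3 * s"
    by (elim exE conjE)
  have sep: "q \<le> x2" "x1 + 1/5 \<le> x2" "x1 + 1/5 \<le> x3" "x2 + 1/5 \<le> x3" "x2 \<le> q+1" "x3 \<le> q+1"
    using 1(1,2) 2(1,2) 3(1,2) by linarith+
  obtain x y where xy: "q \<le> x" "x + 1/5 \<le> y" "y \<le> q+1" "\<bar>f x - \<sigma>\<bar> < 3 * s" "\<bar>f y - \<sigma>\<bar> < 3 * s"
    using \<sigma>(2) sep 1(1) by metis
  \<comment> \<open>Between x and y the function changes by less than 6s, and the oscillation of the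
    slope adds at most s (y - x). As y - x \<ge> 1/5, the 6s is at most 30s (y - x), which gives
    31s; the 3s at x later makes it 34s.\<close>
  have V: "\<bar>V z\<bar> \<le> 31 * s" if "z \<in> {q..q+1}" for z
  proof -
    have "\<bar>V z\<bar> * (y - x) = \<bar>V z * (y - x)\<bar>" using xy by (simp add: abs_mult)
    also have "\<dots> \<le> 6 * s + s * (y - x)" using fV[of x y z] xy that by linarith
    also have "\<dots> \<le> 30 * s * (y - x) + s * (y - x)" using s xy mult_left_mono[of "1/5" "y - x" "30 * s"] by simp
    finally have "\<bar>V z\<bar> * (y - x) \<le> (31 * s) * (y - x)" by (simp add: algebra_simps)
    then show ?thesis by (rule mult_right_le_imp_le) (use xy in linarith)
  qed
  have "\<bar>f z - f x\<bar> \<le> 31 * s" if z: "z \<in> {q..q+1}" for z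
  proof -
    have b: "\<bar>f v - f u\<bar> \<le> 31 * s * (v - u)" if "q \<le> u" "u \<le> v" "v \<le> q+1" for u v
      using has_integral_bound_real[OF _ _ primitive_onD[OF pf that], of "31 * s" "{}"] V that s by (simp add: content_real_if)
    have le1: "31 * s * d \<le> 31 * s" if "d \<le> 1" for d using that s by simp
    show ?thesis
    proof (cases "x \<le> z")
      case True
      then show ?thesis using b[of x z] le1[of "z-x"] xy z by auto
    next
      case False
      then show ?thesis using b[of z x] le1[of "x-z"] xy z by auto
    qed
  qed
  then have "\<bar>f z - \<sigma>\<bar> \<le> 34 * s" if z: "z \<in> {q..q+1}" for z
  proof -
    have "\<bar>f z - f x\<bar> \<le> 31 * s" using \<open>\<And>z. z \<in> {q..q+1} \<Longrightarrow> \<bar>f z - f x\<bar> \<le> 31 * s\<close>[OF z] .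
    then show ?thesis using xy(4) by linarith
  qed
  moreover have "\<bar>V z\<bar> \<le> 34 * s" if "z \<in> {q..q+1}" for z using V[OF that] s by linarith
  ultimately show ?thesis using \<sigma>(1) by auto
qed

section \<open>The optimal transition energy\<close>

definition profile :: "real \<Rightarrow> (real \<Rightarrow> real) \<Rightarrow> (real \<Rightarrow> real) \<Rightarrow> (real \<Rightarrow> real) \<Rightarrow> bool" where
  "profile p U V G \<longleftrightarrow> H2 p 0 1 U V G \<and> U 0 = -1 \<and> U 1 = 1 \<and> V 0 = 0 \<and> V 1 = 0"

definition Phi_H2 :: "(real \<Rightarrow> real) \<Rightarrow> (real \<Rightarrow> real) \<Rightarrow> real" where
  "Phi_H2 U G = integral {0..1} (\<lambda>x. (U x ^ 2 - 1) ^ 2) powr (3/4) * integral {0..1} (\<lambda>x. (G x)\<^sup>2) powr (1/4)"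

lemma Phi_eq:
  assumes H: "H2 p 0 1 U V G" and 1: "\<And>x. x \<in> {0<..<1} \<Longrightarrow> w x = U x"
    and 2: "negligible {x\<in>{0..1}. wdd p 0 1 w x \<noteq> G x}"
  shows "Phi p w = ereal (Phi_H2 U G)"
proof -
  have A: "(\<integral>\<^sup>+y\<in>{0<..<1}. ennreal ((w y ^ 2 - 1) ^ 2) \<partial>lebesgue) = ennreal (integral {0..1} (\<lambda>x. (U x ^ 2 - 1) ^ 2))"
  proof -
    have "(\<integral>\<^sup>+y\<in>{0<..<1}. ennreal ((w y ^ 2 - 1) ^ 2) \<partial>lebesgue) = (\<integral>\<^sup>+y\<in>{0<..<1}. ennreal ((U y ^ 2 - 1) ^ 2) \<partial>lebesgue)"
      by (intro nn_integral_cong) (use 1 in \<open>auto split: split_indicator\<close>)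
    then show ?thesis
      using nn_integral_Ioo_has_integral[OF integrable_integral[OF H2_energy_integrable(1)[OF H]]] by simp
  qed
  have B: "(\<integral>\<^sup>+y\<in>{0<..<1}. ennreal ((wdd p 0 1 w y) ^ 2) \<partial>lebesgue) = ennreal (integral {0..1} (\<lambda>x. (G x)\<^sup>2))"
  proof -
    have "(\<integral>\<^sup>+y\<in>{0<..<1}. ennreal ((wdd p 0 1 w y) ^ 2) \<partial>lebesgue) = (\<integral>\<^sup>+y\<in>{0<..<1}. ennreal ((G y) ^ 2) \<partial>lebesgue)"
      using negligible_AE_Ioo[OF 2] by (intro nn_integral_cong_AE) (auto elim!: eventually_mono split: split_indicator)
    then show ?thesis
      using nn_integral_Ioo_has_integral[OF integrable_integral[OF H2_energy_integrable(2)[OF H]]] by simp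
  qed
  show ?thesis
    unfolding Phi_def A B Let_def Phi_H2_def
    by (simp add: integral_nonneg H2_energy_integrable[OF H])
qed

lemma profile_in_Jset:
  assumes P: "profile p U V G" and p: "1 \<le> p"
  shows "U \<in> Jset p" "Phi p U = ereal (Phi_H2 U G)"
proof -
  have H: "H2 p 0 1 U V G" using P by (simp add: profile_def)
  then have U: "primitive_on 0 1 U V" and V: "primitive_on 0 1 V G" by (auto simp: H2_def)
  note W = W2p_of_primitive[OF U V H2_Lp_fun[OF H p] p]
  show "Phi p U = ereal (Phi_H2 U G)" by (rule Phi_eq[OF H _ W(2)]) auto
  have cU: "continuous_on {0..1} U" and cV: "continuous_on {0..1} V"
    using U V primitive_on_continuous by auto
  have "(U has_real_derivative V x) (at x)" if "x \<in> {0<..<1}" for x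
    using primitive_on_derivative[OF U cV, of x] that by (simp add: at_within_Icc_at)
  moreover have lim: "(f \<longlongrightarrow> f 0) (at_right 0)" "(f \<longlongrightarrow> f 1) (at_left 1)" if "continuous_on {0..1} f" for f :: "real \<Rightarrow> real"
    using that by (auto simp: continuous_on_Icc_at_rightD continuous_on_Icc_at_leftD)
  moreover have "continuous_on {0<..<1} V" by (rule continuous_on_subset[OF cV]) auto
  ultimately show "U \<in> Jset p"
    unfolding Jset_def mem_Collect_eq using W(1) P lim[OF cU] lim[OF cV]
    by (intro conjI exI[of _ V]) (simp_all add: profile_def)
qed

text \<open>\<open>Jset\<close> prescribes limits from inside, \<open>profile\<close> prescribes
  values of a representative on the closed interval. On the open interval \<open>w\<close> is
  continuous and so equals \<open>U\<close>, whence \<open>w'\<close> equals \<open>V\<close>; the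
  limits then become the endpoint values.\<close>

lemma Jset_imp_profile:
  assumes J: "w \<in> Jset p" and fin: "Phi p w < \<infinity>" and p: "1 \<le> p"
  shows "\<exists>U V G. profile p U V G \<and> Phi p w = ereal (Phi_H2 U G)"
proof -
  let ?w = "wdd p 0 1 w"
  have W: "W2p p 0 1 w" using J by (simp add: Jset_def)
  obtain w' where w': "\<forall>x\<in>{0<..<1}. (w has_real_derivative w' x) (at x)"
    "(w \<longlongrightarrow> -1) (at_right 0)" "(w \<longlongrightarrow> 1) (at_left 1)" "(w' \<longlongrightarrow> 0) (at_right 0)" "(w' \<longlongrightarrow> 0) (at_left 1)"
    using J unfolding Jset_def by blast
  have "(\<integral>\<^sup>+x\<in>{0<..<1}. ennreal ((?w x) ^ 2) \<partial>lebesgue) \<noteq> \<infinity>"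
    using fin by (auto simp: Phi_def Let_def split: if_splits)
  then have "(\<integral>\<^sup>+x\<in>{0<..<1}. ennreal ((?w x) ^ 2) \<partial>lebesgue) < \<infinity>" by (simp add: less_top)
  from wdd_square_integrable[OF W p _ this] obtain U V
    where H: "H2 p 0 1 U V ?w" and n: "negligible {x\<in>{0..1}. w x \<noteq> U x}" by auto
  then have U: "primitive_on 0 1 U V" and V: "primitive_on 0 1 V ?w" by (auto simp: H2_def)
  have cU: "continuous_on {0..1} U" and cV: "continuous_on {0..1} V"
    using U V primitive_on_continuous by auto
  have cw: "continuous_on {0<..<1} w"
    using w'(1) DERIV_isCont by (intro continuous_at_imp_continuous_on) blast
  have eqU: "w x = U x" if x: "x \<in> {0<..<1}" for x
  \<comment> \<open>Almost-everywhere equality is upgraded on a compact interval around x, because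
    the values of \<open>w\<close> at 0 and 1 are arbitrary.\<close>
  proof (rule continuous_eq_ae_imp_eq[of "x/2" "(x+1)/2" w U x])
    show "continuous_on {x/2..(x+1)/2} w" by (rule continuous_on_subset[OF cw]) (use x in auto)
    show "continuous_on {x/2..(x+1)/2} U" by (rule continuous_on_subset[OF cU]) (use x in auto)
    show "negligible {t \<in> {x/2..(x+1)/2}. w t \<noteq> U t}" by (rule negligible_subset[OF n]) (use x in auto)
  qed (use x in auto)
  have eqV: "w' x = V x" if x: "x \<in> {0<..<1}" for x
  proof -
    have "(U has_real_derivative V x) (at x)"
      using primitive_on_derivative[OF U cV, of x] x by (simp add: at_within_Icc_at)
    moreover have "(U has_real_derivative w' x) (at x)"
      by (rule has_field_derivative_transform_within_open[OF w'(1)[rule_format, OF x], of "{0<..<1}"]) (use x eqU in auto)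
    ultimately show ?thesis by (rule DERIV_unique[symmetric])
  qed
  have lim: "f 0 = l" "f 1 = l'" if f: "continuous_on {0..1} f" and eq: "\<And>x. x \<in> {0<..<1} \<Longrightarrow> g x = f x"
    and g: "(g \<longlongrightarrow> l) (at_right 0)" "(g \<longlongrightarrow> l') (at_left 1)" for f g :: "real \<Rightarrow> real" and l l'
  proof -
    have "(g \<longlongrightarrow> f 0) (at_right 0)"
    proof (rule Lim_transform_eventually[of f])
      show "(f \<longlongrightarrow> f 0) (at_right 0)" using continuous_on_Icc_at_rightD[OF f] by simp
      show "\<forall>\<^sub>F x in at_right 0. f x = g x"
        using eq by (auto simp: eventually_at_right_field intro!: exI[of _ 1])
    qed
    then show "f 0 = l" using g(1) tendsto_unique trivial_limit_at_right_real by blast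
    have "(g \<longlongrightarrow> f 1) (at_left 1)"
    proof (rule Lim_transform_eventually[of f])
      show "(f \<longlongrightarrow> f 1) (at_left 1)" using continuous_on_Icc_at_leftD[OF f] by simp
      show "\<forall>\<^sub>F x in at_left 1. f x = g x"
        using eq by (auto simp: eventually_at_left_field intro!: exI[of _ 0])
    qed
    then show "f 1 = l'" using g(2) tendsto_unique trivial_limit_at_left_real by blast
  qed
  have "U 0 = -1" "U 1 = 1" using lim[OF cU eqU w'(2,3)] by auto
  moreover have "V 0 = 0" "V 1 = 0" using lim[OF cV eqV w'(4,5)] by auto
  ultimately have "profile p U V ?w" using H by (simp add: profile_def)
  moreover have "Phi p w = ereal (Phi_H2 U ?w)" by (rule Phi_eq[OF H eqU]) auto
  ultimately show ?thesis by blast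
qed

section \<open>Optimal stretching of a profile and positivity of its cost\<close>

lemma powr_quarter_power:
  fixes x :: real
  assumes "x \<ge> 0"
  shows "(x powr (1/4))^4 = x" "(x powr (1/4))^3 = x powr (3/4)"
proof -
  have "(x powr (1/4)) powr 4 = x" "(x powr (1/4)) powr 3 = x powr (3/4)"
    using assms by (simp_all add: powr_powr)
  then show "(x powr (1/4))^4 = x" "(x powr (1/4))^3 = x powr (3/4)"
    using assms by (cases "x = 0"; simp)+
qed

text \<open>Weighted AM-GM in the form \<open>3X\<^sup>4 + Y\<^sup>4 \<ge> 4X\<^sup>3Y\<close>, with equality at \<open>X = Y\<close>.\<close>

lemma amgm_scaling:
  fixes A B e :: real
  assumes "A \<ge> 0" "B \<ge> 0" "e > 0"
  shows "4 / 3 powr (3/4) * (A powr (3/4) * B powr (1/4)) \<le> A/e + e^3 * B"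
proof -
  define a b t d where "a = A powr (1/4)" "b = B powr (1/4)" "t = (3::real) powr (1/4)" "d = e powr (1/4)"
  note pw = powr_quarter_power
  have td: "t > 0" "d > 0" "t^4 = 3" using assms(3) by (auto simp: a_b_t_d_def pw)
  have eqs: "A = a^4" "B = b^4" "A powr (3/4) = a^3" "B powr (1/4) = b" "3 powr (3/4) = t^3" "e = d^4"
    using assms by (auto simp: a_b_t_d_def pw)
  \<comment> \<open>Fourth roots turn real powers into polynomials. The choice gives 3X^4 = A/e and
    Y^4 = e^3 B, and in X^3 Y the scale \<open>d\<close> cancels.\<close>
  define X Y where "X = a / (t * d)" and "Y = d^3 * b"
  have nn: "a \<ge> 0" "b \<ge> 0" by (auto simp: a_b_t_d_def)
  have XY: "X \<ge> 0" "Y \<ge> 0" using nn td by (auto simp: X_def Y_def)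
  have "0 \<le> (X - Y)^2 * (3*X^2 + 2*X*Y + Y^2)" using XY by auto
  also have "\<dots> = 3*X^4 + Y^4 - 4*X^3*Y" by (simp add: power2_eq_square power3_eq_cube power4_eq_xxxx algebra_simps)
  finally have "4*X^3*Y \<le> 3*X^4 + Y^4" by simp
  moreover have "4*X^3*Y = 4 / t^3 * (a^3 * b)"
    using td by (simp add: X_def Y_def power_mult_distrib power_divide)
  moreover have "3*X^4 = a^4/d^4" using td by (simp add: X_def power_mult_distrib power_divide)
  moreover have "Y^4 = (d^4)^3 * b^4" by (simp add: Y_def power_mult_distrib flip: power_mult)
  ultimately have "4 / t^3 * (a^3 * b) \<le> A/e + e^3 * B" unfolding eqs(1,2,6) by simp
  then show ?thesis unfolding eqs(3,4,5) .
qed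

text \<open>Equality in the weighted inequality needs X = Y, that is e = (A / (3B))^(1/4).\<close>

lemma amgm_scaling_eq:
  fixes A B :: real
  assumes "A > 0" "B > 0"
  shows "\<exists>e>0. A/e + e^3 * B = 4 / 3 powr (3/4) * (A powr (3/4) * B powr (1/4))"
proof -
  define a b t where "a = A powr (1/4)" "b = B powr (1/4)" "t = (3::real) powr (1/4)"
  note pw = powr_quarter_power
  have td: "t > 0" "a > 0" "b > 0" "t^4 = 3" using assms by (auto simp: a_b_t_def pw)
  have eqs: "A = a^4" "B = b^4" "A powr (3/4) = a^3" "B powr (1/4) = b" "3 powr (3/4) = t^3"
    using assms by (auto simp: a_b_t_def pw)
  define e where "e = a / (t * b)"
  have "e > 0" using td by (simp add: e_def)
  moreover have "a^4/e + e^3 * b^4 = 4 / t^3 * (a^3 * b)"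
  proof -
    have "a^4/e = a^3 * b * t" using td by (simp add: e_def power4_eq_xxxx power3_eq_cube)
    moreover have "t = 3/t^3" using td by (simp add: field_simps power4_eq_xxxx power3_eq_cube)
    then have "a^3 * b * t = a^3 * b * (3/t^3)" by (rule arg_cong)
    moreover have "e^3 * b^4 = a^3 * b / t^3"
      using td by (simp add: e_def power_divide power_mult_distrib power4_eq_xxxx power3_eq_cube)
    ultimately show ?thesis by simp
  qed
  ultimately have "\<exists>e>0. A/e + e^3 * B = 4 / t^3 * (a^3 * b)" unfolding eqs(1,2) by blast
  then show ?thesis unfolding eqs(3,4,5) .
qed

text \<open>A profile crosses 0. Blown up to scale 1 and continued by -1 over a unit interval on the
  left, it has a whole unit cell ending at a zero; with energy at most (1/35)^2,
  \<open>quiet\<close> would keep it within 34/35 of a phase on that cell.\<close>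

lemma profile_energy_pos:
  assumes P: "profile p U V G" and p: "1 \<le> p" and e: "e > 0"
  shows "energy e 0 1 U G > (1/35)^2"
proof (rule ccontr)
  assume "\<not> ?thesis"
  then have small: "energy e 0 1 U G \<le> (1/35)^2" by simp
  define f g h where "f x = U (e*x+0)" "g x = e * V (e*x+0)" "h x = e\<^sup>2 * G (e*x+0)" for x
  have H: "H2 p 0 1 U V G" and bd: "U 0 = -1" "U 1 = 1" "V 0 = 0" "V 1 = 0" using P by (auto simp: profile_def)
  have H': "H2 p 0 (1/e) f g h" and E: "energy 1 0 (1/e) f h = energy e 0 1 U G"
    unfolding f_g_h_def using H2_affine[OF H e, of 0 0 "1/e"] energy_affine[OF H e, of 0 0 "1/e" e] e by auto
  note C = H2_concat[OF H2_const[OF p, of "-1" 0 "-1"] H']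
  define F K where "F x = (if x \<le> 0 then -1 else f x)" and "K x = (if x \<le> 0 then 0 else h x)" for x :: real
  obtain V' where HF: "H2 p (-1) (1/e) F V' K" and EF: "energy 1 (-1) (1/e) F K = energy 1 (-1) 0 (\<lambda>x. -1) (\<lambda>x. 0) + energy 1 0 (1/e) f h"
    using C bd e unfolding f_g_h_def F_def K_def by fastforce
  have EF': "energy 1 (-1) (1/e) F K \<le> (1/35)^2"
    using EF E small by (simp add: energy_def)
  have "continuous_on {0..1/e} F"
    using HF primitive_on_continuous[of "-1" "1/e" F V'] continuous_on_subset by (fastforce simp: H2_def)
  moreover have "F 0 = -1" "F (1/e) = 1" using e bd by (auto simp: F_def f_g_h_def)
  ultimately obtain y where y: "0 \<le> y" "y \<le> 1/e" "F y = 0"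
    using IVT'[of F 0 0 "1/e"] e by auto
  have "energy 1 (y-1) (y-1+1) F K \<le> (1/35)^2"
    using energy_mono[OF HF, of "y-1" "y-1+1" 1] y EF' by simp
  then have "\<exists>\<sigma>\<in>{-1, 1}. \<forall>z\<in>{y-1..y-1+1}. \<bar>F z - \<sigma>\<bar> \<le> 34 * (1/35) \<and> \<bar>V' z\<bar> \<le> 34 * (1/35)"
    using y by (intro quiet[OF H2_subinterval[OF HF]]) auto
  moreover have "y \<in> {y-1..y-1+1}" by simp
  ultimately show False using y(3) by fastforce
qed

text \<open>A/e + e^3 B stays above one threshold for all e. If A vanished, a small e would violate
  this, and if B vanished, a large one. Positivity of both is what lets the optimal stretching be
  attained.\<close>

lemma profile_integrals_pos:
  assumes P: "profile p U V G" and p: "1 \<le> p"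
  shows "integral {0..1} (\<lambda>x. (U x ^ 2 - 1) ^ 2) > 0" "integral {0..1} (\<lambda>x. (G x)\<^sup>2) > 0"
proof -
  define A B where "A = integral {0..1} (\<lambda>x. (U x ^ 2 - 1) ^ 2)" and "B = integral {0..1} (\<lambda>x. (G x)\<^sup>2)"
  have H: "H2 p 0 1 U V G" using P by (simp add: profile_def)
  have nn: "A \<ge> 0" "B \<ge> 0" unfolding A_def B_def by (auto intro!: integral_nonneg H2_energy_integrable[OF H])
  define \<theta> :: real where "\<theta> = (1/35)^2"
  have E: "A/e + e^3 * B > \<theta>" if "e > 0" for e
    using profile_energy_pos[OF P p that] energy_split[OF H, of e] by (simp add: A_def B_def \<theta>_def)
  have \<theta>: "0 < \<theta>" "\<theta> \<le> 1" by (auto simp: \<theta>_def power_divide)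
  have "A \<noteq> 0"
  proof
    assume "A = 0"
    have e: "\<theta>/(B+1) > 0" "\<theta>/(B+1) \<le> 1" using \<theta> nn by (auto simp: field_simps add_nonneg_pos)
    have "\<theta> < (\<theta>/(B+1))^3 * B" using E[OF e(1)] \<open>A = 0\<close> by simp
    also have "\<dots> \<le> (\<theta>/(B+1))^1 * B" using e nn by (intro mult_right_mono power_decreasing) auto
    also have "\<dots> \<le> \<theta>" using \<theta> nn by (simp add: field_simps)
    finally show False by simp
  qed
  moreover have "B \<noteq> 0"
  proof
    assume "B = 0"
    have e: "(A+1)/\<theta> > 0" using \<theta> nn by auto
    have "\<theta> < A/((A+1)/\<theta>)" using E[OF e] \<open>B = 0\<close> by simp
    also have "\<dots> \<le> \<theta>" using \<theta> nn by (simp add: field_simps)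
    finally show False by simp
  qed
  ultimately show "integral {0..1} (\<lambda>x. (U x ^ 2 - 1) ^ 2) > 0" "integral {0..1} (\<lambda>x. (G x)\<^sup>2) > 0"
    using nn by (auto simp: A_def B_def)
qed

lemma profile_exists:
  assumes "1 \<le> p" shows "\<exists>U V G. profile p U V G"
proof -
  define U V G where "U x = -1 + 6*x^2 - 4*x^3" "V x = 12*x - 12*x^2" "G x = 12 - 24*x" for x :: real
  have "H2 p 0 1 U V G" unfolding U_V_G_def
    by (rule H2_smooth) (auto intro!: derivative_eq_intros continuous_intros assms simp: power2_eq_square algebra_simps)
  then have "profile p U V G" by (auto simp: profile_def U_V_G_def)
  then show ?thesis by blast
qed

text \<open>The constant \<open>c = 2\<alpha>\<close> is the least energy of a full transition.\<close>

lemma alpha_properties: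
  assumes p: "1 \<le> p"
  shows "\<exists>c>0. alpha p = ereal (c/2) \<and>
    (\<forall>U V G e. profile p U V G \<longrightarrow> e > 0 \<longrightarrow> c \<le> energy e 0 1 U G) \<and>
    (\<forall>\<delta>>0. \<exists>U V G e. profile p U V G \<and> e > 0 \<and> energy e 0 1 U G < c + \<delta>)"
proof -
  \<comment> \<open>Twice the factor 2 / 3^(3/4) in \<open>alpha\<close>, since a full transition
    has height 2.\<close>
  define k :: real where "k = 4 / 3 powr (3/4)"
  have k: "k > 0" by (simp add: k_def)
  have opt: "\<exists>e>0. energy e 0 1 U G = k * Phi_H2 U G" if P: "profile p U V G" for U V G
    using amgm_scaling_eq[OF profile_integrals_pos[OF P p]] P energy_split[of p 0 1 U V G]
    unfolding k_def Phi_H2_def profile_def by metis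
  have lower: "k * Phi_H2 U G \<le> energy e 0 1 U G" if P: "profile p U V G" and e: "e > 0" for U V G e
    using amgm_scaling[of "integral {0..1} (\<lambda>x. (U x ^ 2 - 1) ^ 2)" "integral {0..1} (\<lambda>x. (G x)\<^sup>2)" e]
      profile_integrals_pos[OF P p] P energy_split[of p 0 1 U V G] e
    unfolding k_def Phi_H2_def profile_def by simp
  define I where "I = (INF w \<in> Jset p. Phi p w)"
  \<comment> \<open>This keeps the infimum away from 0; together with the cubic profile as an upper
    bound it makes the infimum a real number.\<close>
  have pos: "ereal ((1/35)^2 / k) \<le> I"
    unfolding I_def
  proof (rule INF_greatest)
    fix w assume w: "w \<in> Jset p"
    show "ereal ((1/35)^2 / k) \<le> Phi p w"
    proof (cases "Phi p w < \<infinity>")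
      case True
      then obtain U V G where P: "profile p U V G" "Phi p w = ereal (Phi_H2 U G)"
        using Jset_imp_profile[OF w _ p] by blast
      obtain e where "e > 0" "energy e 0 1 U G = k * Phi_H2 U G" using opt[OF P(1)] by blast
      then have "(1/35)^2 \<le> k * Phi_H2 U G" using profile_energy_pos[OF P(1) p, of e] by simp
      then show ?thesis using P(2) k by (simp add: field_simps)
    qed auto
  qed
  obtain U0 V0 G0 where "profile p U0 V0 G0" using profile_exists[OF p] by blast
  note J0 = profile_in_Jset[OF this p]
  have "I \<le> ereal (Phi_H2 U0 G0)"
    unfolding I_def J0(2)[symmetric] by (rule INF_lower[OF J0(1)])
  with pos obtain m where m: "I = ereal m" by (cases I) auto
  have "m \<ge> (1/35)^2 / k" using pos m by simp
  moreover have "(1/35)^2 / k > 0" using k by simp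
  ultimately have "m > 0" by linarith
  show ?thesis
  proof (intro exI[of _ "k * m"] conjI allI impI)
    show "0 < k * m" using k \<open>m > 0\<close> by simp
    show "alpha p = ereal (k * m / 2)"
      using m unfolding alpha_def I_def[symmetric] by (simp add: k_def)
    show "k * m \<le> energy e 0 1 U G" if P: "profile p U V G" and e: "e > 0" for U V G e
    proof -
      have "I \<le> Phi p U" unfolding I_def by (rule INF_lower[OF profile_in_Jset(1)[OF P p]])
      then have "m \<le> Phi_H2 U G" using profile_in_Jset[OF P p] m by simp
      then have "k * m \<le> k * Phi_H2 U G" using k by simp
      then show ?thesis using lower[OF P e] by linarith
    qed
    fix \<delta> :: real assume "\<delta> > 0"
    then have "I < ereal (m + \<delta>/k)" using m k by simp
    then obtain w where w: "w \<in> Jset p" "Phi p w < ereal (m + \<delta>/k)" unfolding I_def by (auto simp: INF_less_iff)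
    then have "Phi p w < \<infinity>" by (meson less_ereal.simps(4) order.strict_trans less_PInf_Ex_of_nat ereal_less_PInfty)
    then obtain U V G where P: "profile p U V G" "Phi p w = ereal (Phi_H2 U G)"
      using Jset_imp_profile[OF w(1) _ p] by blast
    then have "k * Phi_H2 U G < k * m + \<delta>" using w(2) k by (simp add: field_simps)
    then show "\<exists>U V G e. profile p U V G \<and> e > 0 \<and> energy e 0 1 U G < k * m + \<delta>"
      using opt[OF P(1)] P(1) by metis
  qed
qed

section \<open>Cost of the piece between two nearly pure points\<close>

definition near :: "real \<Rightarrow> real \<Rightarrow> (real \<Rightarrow> real) \<Rightarrow> (real \<Rightarrow> real) \<Rightarrow> real \<Rightarrow> bool" where
  "near \<sigma> \<kappa> f V z \<longleftrightarrow> \<bar>f z - \<sigma>\<bar> \<le> \<kappa> \<and> \<bar>V z\<bar> \<le> \<kappa>"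

text \<open>A unit connector at each end supplies the boundary data that \<open>profile\<close>
  demands, and contracting the total length l = r - q + 2 to 1 turns scale 1 into 1/l. The error
  328\<kappa>^2 pays for the two connectors.\<close>

lemma transition_up:
  assumes c: "\<And>U V G e. profile p U V G \<Longrightarrow> e > 0 \<Longrightarrow> c \<le> energy e 0 1 U G"
    and H: "H2 p q r f V G" and qr: "q \<le> r" and p: "1 \<le> p" and k: "\<kappa> \<le> 1"
    and nq: "near (-1) \<kappa> f V q" and nr: "near 1 \<kappa> f V r"
  shows "c \<le> energy 1 q r f G + 328 * \<kappa>\<^sup>2"
proof -
  obtain U1 V1 G1 where 1: "H2 p (q-1) q U1 V1 G1" "U1 (q-1) = -1" "V1 (q-1) = 0" "U1 q = f q" "V1 q = V q"
    "energy 1 (q-1) q U1 G1 \<le> 164 * \<kappa>\<^sup>2"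
    using hermite[of "f q + 1" \<kappa> "V q" "-1" p 1 "q-1" q] nq k p by (auto simp: near_def)
  obtain U2 V2 G2 where 2: "H2 p r (r+1) U2 V2 G2" "U2 (r+1) = 1" "V2 (r+1) = 0" "U2 r = f r" "V2 r = V r"
    "energy 1 r (r+1) U2 G2 \<le> 164 * \<kappa>\<^sup>2"
    using hermite[of "f r - 1" \<kappa> "V r" 1 p "-1" r r] nr k p by (auto simp: near_def)
  note A = H2_concat[OF 1(1) H 1(4,5) _ qr]
  note B = H2_concat[OF A(1) 2(1)]
  define W where "W x = (if x \<le> r then if x \<le> q then U1 x else f x else U2 x)" for x
  define Z where "Z x = (if x \<le> r then if x \<le> q then V1 x else V x else V2 x)" for x
  define K where "K x = (if x \<le> r then if x \<le> q then G1 x else G x else G2 x)" for x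
  have HW: "H2 p (q-1) (r+1) W Z K"
    unfolding W_def Z_def K_def by (rule B(1)) (use 1 2 qr in auto)
  have EW: "energy 1 (q-1) (r+1) W K = energy 1 (q-1) q U1 G1 + energy 1 q r f G + energy 1 r (r+1) U2 G2"
    unfolding W_def K_def by (subst B(2)) (use 1 2 qr A(2) in auto)
  define l where "l = r - q + 2"
  have l: "l > 0" using qr by (simp add: l_def)
  have "profile p (\<lambda>x. W (l*x+(q-1))) (\<lambda>x. l * Z (l*x+(q-1))) (\<lambda>x. l\<^sup>2 * K (l*x+(q-1)))"
    unfolding profile_def
  proof (intro conjI H2_affine[OF HW l])
    show "W (l*1+(q-1)) = 1" "l * Z (l*1+(q-1)) = 0" using 2 by (auto simp: W_def Z_def l_def)
    show "W (l*0+(q-1)) = -1" "l * Z (l*0+(q-1)) = 0" using 1 qr by (auto simp: W_def Z_def)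
  qed (auto simp: l_def)
  from c[OF this, of "1/l"] have "c \<le> energy (1/l) 0 1 (\<lambda>x. W (l*x+(q-1))) (\<lambda>x. l\<^sup>2 * K (l*x+(q-1)))" using l by simp
  also have "\<dots> = energy 1 (q-1) (r+1) W K"
    using energy_affine[OF HW l, of 0 "q-1" 1 1] by (simp add: l_def)
  finally show ?thesis using EW 1(6) 2(6) by simp
qed

text \<open>One formula for three cases: |\<tau> - \<sigma>| is 2 for a transition in either
  direction, a downward one being reflected, and 0 if the phases agree.\<close>

lemma transition:
  assumes c: "\<And>U V G e. profile p U V G \<Longrightarrow> e > 0 \<Longrightarrow> c \<le> energy e 0 1 U G"
    and H: "H2 p q r f V G" and qr: "q \<le> r" and p: "1 \<le> p" and k: "\<kappa> \<le> 1"
    and \<sigma>: "\<sigma> \<in> {-1,1}" "\<tau> \<in> {-1,1}" and nq: "near \<sigma> \<kappa> f V q" and nr: "near \<tau> \<kappa> f V r"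
  shows "c / 2 * \<bar>\<tau> - \<sigma>\<bar> \<le> energy 1 q r f G + 328 * \<kappa>\<^sup>2"
proof -
  consider "\<sigma> = -1" "\<tau> = 1" | "\<sigma> = 1" "\<tau> = -1" | "\<sigma> = \<tau>" using \<sigma> by auto
  then show ?thesis
  proof cases
    case 1
    then show ?thesis using transition_up[OF c H qr p k] nq nr by simp
  next
    case 2
    then have "c \<le> energy 1 q r (\<lambda>x. - f x) (\<lambda>x. - G x) + 328 * \<kappa>\<^sup>2"
      using nq nr by (intro transition_up[OF c H2_uminus[OF H] qr p k]) (auto simp: near_def)
    then show ?thesis using 2 by simp
  next
    case 3
    then show ?thesis using energy_nonneg[of 1 q r f G] by simp
  qed
qed

section \<open>Quiet points in small windows\<close>

text \<open>The slope enters as \<open>e * V\<close>, the derivative in the blown-up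
  variable.\<close>

lemma quiet_scaled:
  assumes H: "H2 p q (q+e) U V G" and e: "e > 0" and s: "0 < s" and E: "energy e q (q+e) U G \<le> s\<^sup>2"
  shows "\<exists>\<sigma>\<in>{-1, 1}. \<forall>z\<in>{q..q+e}. near \<sigma> (34 * s) U (\<lambda>x. e * V x) z"
proof -
  have H': "H2 p 0 (0+1) (\<lambda>x. U (e*x+q)) (\<lambda>x. e * V (e*x+q)) (\<lambda>x. e\<^sup>2 * G (e*x+q))"
    by (rule H2_affine[OF H e]) auto
  have "energy 1 0 (0+1) (\<lambda>x. U (e*x+q)) (\<lambda>x. e\<^sup>2 * G (e*x+q)) \<le> s\<^sup>2"
    using energy_affine[OF H e, of 0 q 1 e] E e by (simp add: add.commute)
  from quiet[OF H' s this] obtain \<sigma> where \<sigma>: "\<sigma> \<in> {-1, 1}"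
    "\<forall>z\<in>{0..0+1}. \<bar>U (e*z+q) - \<sigma>\<bar> \<le> 34 * s \<and> \<bar>e * V (e*z+q)\<bar> \<le> 34 * s" by blast
  have "near \<sigma> (34 * s) U (\<lambda>x. e * V x) z" if "z \<in> {q..q+e}" for z
    using \<sigma>(2)[rule_format, of "(z-q)/e"] that e by (simp add: near_def)
  then show ?thesis using \<sigma>(1) by blast
qed

lemma transition_scaled:
  assumes c: "\<And>U V G e. profile p U V G \<Longrightarrow> e > 0 \<Longrightarrow> c \<le> energy e 0 1 U G"
    and H: "H2 p q r U V G" and qr: "q \<le> r" and p: "1 \<le> p" and k: "\<kappa> \<le> 1" and e: "e > 0"
    and \<sigma>: "\<sigma> \<in> {-1,1}" "\<tau> \<in> {-1,1}"
    and nq: "near \<sigma> \<kappa> U (\<lambda>x. e * V x) q" and nr: "near \<tau> \<kappa> U (\<lambda>x. e * V x) r"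
  shows "c / 2 * \<bar>\<tau> - \<sigma>\<bar> \<le> energy e q r U G + 328 * \<kappa>\<^sup>2"
proof -
  define l where "l = (r-q)/e"
  have l: "e * l + q = r" "0 \<le> l" using e qr by (auto simp: l_def)
  have H': "H2 p 0 l (\<lambda>x. U (e*x+q)) (\<lambda>x. e * V (e*x+q)) (\<lambda>x. e\<^sup>2 * G (e*x+q))"
    by (rule H2_affine[OF H e]) (use l in auto)
  have "energy 1 0 l (\<lambda>x. U (e*x+q)) (\<lambda>x. e\<^sup>2 * G (e*x+q)) = energy e q r U G"
    using energy_affine[OF H e, of 0 q l e] e l by simp
  then show ?thesis
    using transition[OF c H' l(2) p k \<sigma>] nq nr l(1) by (simp add: near_def)
qed

lemma energy_sum_cells:
  assumes H: "H2 p a b U V G" and e: "e > 0" and N: "a + real N * e \<le> b"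
  shows "(\<Sum>j<N. energy e (a + real j * e) (a + real j * e + e) U G) = energy e a (a + real N * e) U G"
  using N
proof (induction N)
  case 0
  then show ?case by (simp add: energy_def)
next
  case (Suc N)
  have *: "a + real (Suc N) * e = a + real N * e + e" by (simp add: algebra_simps)
  have "H2 p a (a + real N * e + e) U V G" using Suc.prems e unfolding * by (intro H2_subinterval[OF H]) auto
  from energy_combine[OF this, of "a + real N * e" e] Suc e show ?case unfolding * by simp
qed

text \<open>At most \<open>M/\<theta>\<close> cells of length \<open>e\<close> carry an energy above \<open>\<theta>\<close>, so they cannot cover \<open>B\<close>.\<close>

lemma quiet_cell:
  assumes H: "H2 p a b U V G" and e: "e > 0" and M: "energy e a b U G \<le> M" and \<theta>: "\<theta> > 0"
    and B: "B \<subseteq> {a..b-e}" "B \<in> sets lebesgue" "measure lebesgue B > M / \<theta> * e"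
  shows "\<exists>q y. a \<le> q \<and> q + e \<le> b \<and> y \<in> B \<and> y \<in> {q..q+e} \<and> energy e q (q+e) U G \<le> \<theta>"
proof (rule ccontr)
  assume neg: "\<not> ?thesis"
  let ?E = "\<lambda>j. energy e (a + real j * e) (a + real j * e + e) U G"
  define I where "I j = {a + real j * e..a + real j * e + e}" for j :: nat
  define N where "N = nat \<lfloor>(b-a)/e\<rfloor>"
  have "B \<noteq> {}"
  proof
    assume "B = {}"
    then have "M < 0" using B(3) \<theta> e by (simp add: field_simps mult_less_0_iff)
    then show False using M energy_nonneg[OF e, of a b U G] by simp
  qed
  then have ab: "a + e \<le> b" using B(1) by auto
  have N: "a + real N * e \<le> b"
  proof -
    have "real N \<le> (b-a)/e" using ab e by (simp add: N_def)
    then show ?thesis using e by (simp add: field_simps)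
  qed
  define J where "J = {j. j < N \<and> B \<inter> I j \<noteq> {}}"
  have fJ: "finite J" "J \<subseteq> {..<N}" by (auto simp: J_def)
  have jb: "a + real j * e + e \<le> b" if "j < N" for j
  proof -
    have "(real j + 1) * e \<le> real N * e" using that e by (intro mult_right_mono) auto
    then show ?thesis using N by (simp add: algebra_simps)
  qed
  have big: "\<theta> \<le> ?E j" if j: "j \<in> J" for j
  proof -
    obtain y where "y \<in> B" "y \<in> I j" using j by (auto simp: J_def)
    moreover have "a \<le> a + real j * e" using e by simp
    ultimately have "\<not> ?E j \<le> \<theta>"
      using neg jb[of j] j unfolding I_def J_def by blast
    then show ?thesis by simp
  qed
  have "real (card J) * \<theta> \<le> (\<Sum>j\<in>J. ?E j)"
    by (rule sum_bounded_below) (rule big)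
  also have "\<dots> \<le> (\<Sum>j<N. ?E j)"
    by (rule sum_mono2) (use fJ energy_nonneg[OF e] in auto)
  also have "\<dots> = energy e a (a + real N * e) U G" by (rule energy_sum_cells[OF H e N])
  also have "\<dots> \<le> M" using energy_mono[OF H _ N e, of a] M by simp
  finally have cJ: "real (card J) * e \<le> M / \<theta> * e" using \<theta> e by (simp add: field_simps)
  have "B \<subseteq> (\<Union>j\<in>J. I j)"
  proof
    fix y assume y: "y \<in> B"
    define t where "t = (y-a)/e"
    have yb: "a \<le> y" "y - a + e \<le> b - a" using y B(1) by auto
    have t: "0 \<le> t" "y = a + t * e" using yb e by (auto simp: t_def)
    have "t + 1 = (y - a + e)/e" using e by (simp add: t_def add_divide_distrib)
    then have t3: "t + 1 \<le> (b-a)/e" using yb e by (simp add: divide_right_mono)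
    \<comment> \<open>The cell of \<open>y\<close>. Since y + e \<le> b, it is one of the
      \<open>N\<close> full cells; the incomplete one at the right end does not occur.\<close>
    define j where "j = nat \<lfloor>t\<rfloor>"
    have j: "real j \<le> t" "t \<le> real j + 1" using t(1) by (auto simp: j_def)
    have "\<lfloor>t\<rfloor> + 1 \<le> \<lfloor>(b-a)/e\<rfloor>" using floor_mono[OF t3] by simp
    moreover have "0 \<le> \<lfloor>t\<rfloor>" using t(1) by simp
    ultimately have "0 < \<lfloor>(b-a)/e\<rfloor>" "\<lfloor>t\<rfloor> < \<lfloor>(b-a)/e\<rfloor>" by linarith+
    then have "j < N" unfolding j_def N_def by (simp only: nat_mono_iff)
    moreover have "y \<in> I j"
    proof -
      have "real j * e \<le> t * e" "t * e \<le> (real j + 1) * e" using j e by (auto intro!: mult_right_mono)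
      then show ?thesis using t(2) by (simp add: I_def algebra_simps)
    qed
    ultimately show "y \<in> (\<Union>j\<in>J. I j)" using y by (auto simp: J_def)
  qed
  moreover have mI: "I j \<in> lmeasurable" "measure lebesgue (I j) = e" for j
    using e by (auto simp: I_def)
  moreover have "(\<Union>j\<in>J. I j) \<in> lmeasurable" using fJ mI by (intro fmeasurable.finite_UN) auto
  ultimately have "measure lebesgue B \<le> measure lebesgue (\<Union>j\<in>J. I j)"
    using B(2) by (intro measure_mono_fmeasurable) auto
  also have "\<dots> \<le> (\<Sum>j\<in>J. measure lebesgue (I j))"
    using fJ mI by (intro measure_UNION_le) auto
  also have "\<dots> = real (card J) * e" using mI by simp
  finally show False using cJ B(3) by linarith
qed

text \<open>Chebyshev: the part of \<open>A\<close> where u_n is farther than r from u has measure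
  at most r^-p times the integral, which tends to 0. The quantifier over \<open>U\<close> stands
  inside because the continuous representative changes with n; it costs only a null set.\<close>

lemma Lp_conv_in_measure:
  assumes u: "Lp_fun p a b u" and us: "\<And>n. Lp_fun p a b (us n)" and conv: "Lp_conv p a b us u" and p: "1 \<le> p"
    and A: "A \<subseteq> {a<..<b}" "A \<in> sets lebesgue" "measure lebesgue A > 0" and r: "r > 0"
  shows "\<forall>\<^sub>F n in sequentially. \<forall>U. negligible {x\<in>{a..b}. us n x \<noteq> U x} \<longrightarrow>
     {x\<in>A. \<bar>us n x - u x\<bar> \<le> r \<and> us n x = U x} \<in> sets lebesgue \<and>
     measure lebesgue {x\<in>A. \<bar>us n x - u x\<bar> \<le> r \<and> us n x = U x} > measure lebesgue A / 2"
proof -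
  have Am: "A \<in> lmeasurable"
    by (rule fmeasurableI2[of "{a<..<b}"]) (use A in auto)
  define I where "I n = (\<integral>\<^sup>+x\<in>{a<..<b}. ennreal (\<bar>us n x - u x\<bar> powr p) \<partial>lebesgue)" for n
  have I: "I \<longlonglongrightarrow> 0" using conv unfolding Lp_conv_def I_def .
  define \<theta> where "\<theta> = measure lebesgue A"
  have "\<forall>\<^sub>F n in sequentially. I n < ennreal (r powr p * \<theta> / 2)"
    by (rule order_tendstoD(2)[OF I]) (use r A in \<open>simp add: \<theta>_def\<close>)
  then show ?thesis
  proof (rule eventually_mono, intro allI impI)
    fix n U
    assume n: "I n < ennreal (r powr p * \<theta> / 2)" and neg: "negligible {x\<in>{a..b}. us n x \<noteq> U x}"
    let ?N = "{x\<in>{a..b}. us n x \<noteq> U x}"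
    let ?B = "{x\<in>A. \<bar>us n x - u x\<bar> \<le> r \<and> us n x = U x}"
    let ?D = "{x\<in>{a<..<b}. r < \<bar>us n x - u x\<bar>}"
    have m: "us n \<in> borel_measurable (lebesgue_on {a<..<b})" "u \<in> borel_measurable (lebesgue_on {a<..<b})"
      using Lp_fun_measurable us u by blast+
    have sub: "T \<in> sets lebesgue" if "T \<in> sets (lebesgue_on {a<..<b})" for T
      using that by (simp add: sets_restrict_space_iff)
    have "{x \<in> space (lebesgue_on {a<..<b}). \<bar>us n x - u x\<bar> \<le> r} \<in> sets (lebesgue_on {a<..<b})"
      using m by measurable
    from sub[OF this] have C: "{x\<in>{a<..<b}. \<bar>us n x - u x\<bar> \<le> r} \<in> sets lebesgue" by (simp add: space_restrict_space)
    have "{x \<in> space (lebesgue_on {a<..<b}). r < \<bar>us n x - u x\<bar>} \<in> sets (lebesgue_on {a<..<b})"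
      using m by measurable
    from sub[OF this] have D: "?D \<in> sets lebesgue" by (simp add: space_restrict_space)
    have Dm: "?D \<in> lmeasurable" by (rule fmeasurableI2[of "{a<..<b}"]) (use D in auto)
    have Nm: "?N \<in> null_sets lebesgue" using neg negligible_iff_null_sets by blast
    have Beq: "?B = A \<inter> {x\<in>{a<..<b}. \<bar>us n x - u x\<bar> \<le> r} - ?N" using A(1) by auto
    have B: "?B \<in> sets lebesgue"
      unfolding Beq using A(2) C null_setsD2[OF Nm] by (intro sets.Diff sets.Int)
    show "?B \<in> sets lebesgue \<and> measure lebesgue ?B > measure lebesgue A / 2"
    proof (rule conjI[OF B])
      have Bm: "?B \<in> lmeasurable" by (rule fmeasurableI2[of A]) (use B Am in auto)
      have "ennreal (r powr p) * emeasure lebesgue ?D = (\<integral>\<^sup>+x. ennreal (r powr p) * indicator ?D x \<partial>lebesgue)"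
        using D by (simp add: nn_integral_cmult_indicator)
      also have "\<dots> \<le> I n" unfolding I_def
        by (rule nn_integral_mono) (use r p in \<open>auto split: split_indicator intro!: ennreal_leI powr_mono2\<close>)
      finally have "ennreal (r powr p) * ennreal (measure lebesgue ?D) < ennreal (r powr p * \<theta> / 2)"
        using n Dm by (simp add: emeasure_eq_measure2)
      then have "r powr p * measure lebesgue ?D < r powr p * (\<theta> / 2)"
        by (simp add: ennreal_mult[symmetric] ennreal_less_iff)
      then have D2: "measure lebesgue ?D < \<theta> / 2" using r by (subst (asm) mult_less_cancel_left_pos) auto
      have "A \<subseteq> ?B \<union> (?D \<union> ?N)"
        using A(1) by fastforce
      moreover have U: "?B \<union> (?D \<union> ?N) \<in> lmeasurable"
        using Bm Dm negligible_imp_measurable[OF neg] by (intro fmeasurable.Un)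
      ultimately have "\<theta> \<le> measure lebesgue (?B \<union> (?D \<union> ?N))"
        unfolding \<theta>_def using A(2) by (intro measure_mono_fmeasurable)
      also have "\<dots> \<le> measure lebesgue ?B + measure lebesgue (?D \<union> ?N)"
        by (intro measure_Un_le) (use B D Nm in auto)
      also have "\<dots> \<le> measure lebesgue ?B + (measure lebesgue ?D + measure lebesgue ?N)"
        by (intro add_left_mono measure_Un_le) (use B D Nm in auto)
      also have "\<dots> = measure lebesgue ?B + measure lebesgue ?D" using negligible_imp_measure0[OF neg] by simp
      finally show "measure lebesgue ?B > measure lebesgue A / 2" using D2 unfolding \<theta>_def by linarith
    qed
  qed
qed

text \<open>The cap \<open>M\<close> bounds the number of cells of large energy. Functions whose
  energy lies above the cap are dealt with separately, the cap being the value to be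
  reached.\<close>

definition represents where
  "represents p a b e M w U V G \<longleftrightarrow>
     H2 p a b U V G \<and> negligible {x\<in>{a..b}. w x \<noteq> U x} \<and> energy e a b U G \<le> M"

text \<open>Points where u_n is within 1/2 of the phase fill more than half of \<open>A\<close>,
  while cells of energy above s^2 cover only a length of order \<epsilon>_n. So a quiet cell
  contains such a point, and the value there decides to which phase the cell belongs.\<close>

lemma quiet_point_in_window:
  assumes u: "Lp_fun p a b u" and us: "\<And>n. Lp_fun p a b (us n)" and conv: "Lp_conv p a b us u" and p: "1 \<le> p"
    and eps: "\<And>n. eps n > 0" "eps \<longlonglongrightarrow> 0"
    and A: "A \<subseteq> {a<..d}" "d < b" "A \<in> sets lebesgue" "measure lebesgue A > 0"
    and \<sigma>: "\<sigma> \<in> {-1,1}" "\<And>x. x \<in> A \<Longrightarrow> u x = \<sigma>" and k: "0 < \<kappa>" "\<kappa> \<le> 1/2"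
  shows "\<forall>\<^sub>F n in sequentially. \<forall>U V G. represents p a b (eps n) M (us n) U V G \<longrightarrow> (\<exists>z\<in>A. near \<sigma> \<kappa> U (\<lambda>x. eps n * V x) z)"
proof -
  \<comment> \<open>The factor 34 lost in \<open>quiet\<close> is taken out in advance.\<close>
  define s where "s = \<kappa>/34"
  have s: "s > 0" using k by (simp add: s_def)
  have "(\<lambda>n. M / s\<^sup>2 * eps n) \<longlonglongrightarrow> M / s\<^sup>2 * 0" by (intro tendsto_intros eps)
  then have "\<forall>\<^sub>F n in sequentially. M / s\<^sup>2 * eps n < measure lebesgue A / 2"
    by (rule order_tendstoD(2)) (use A in simp)
  moreover have "\<forall>\<^sub>F n in sequentially. eps n < b - d"
    by (rule order_tendstoD(2)[OF eps(2)]) (use A in simp)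
  moreover have "A \<subseteq> {a<..<b}" using A by auto
  then have "\<forall>\<^sub>F n in sequentially. \<forall>U. negligible {x\<in>{a..b}. us n x \<noteq> U x} \<longrightarrow>
     {x\<in>A. \<bar>us n x - u x\<bar> \<le> 1/2 \<and> us n x = U x} \<in> sets lebesgue \<and>
     measure lebesgue {x\<in>A. \<bar>us n x - u x\<bar> \<le> 1/2 \<and> us n x = U x} > measure lebesgue A / 2"
    by (rule Lp_conv_in_measure[OF u us conv p _ A(3,4)]) simp
  ultimately show ?thesis
  proof (eventually_elim, intro allI impI)
    fix n U V G
    assume n: "M / s\<^sup>2 * eps n < measure lebesgue A / 2" "eps n < b - d"
      and m: "\<forall>U. negligible {x \<in> {a..b}. us n x \<noteq> U x} \<longrightarrow>
            {x \<in> A. \<bar>us n x - u x\<bar> \<le> 1 / 2 \<and> us n x = U x} \<in> sets lebesgue \<and>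
            measure lebesgue A / 2 < measure lebesgue {x \<in> A. \<bar>us n x - u x\<bar> \<le> 1 / 2 \<and> us n x = U x}"
      and "represents p a b (eps n) M (us n) U V G"
    then have H: "H2 p a b U V G" and neg: "negligible {x\<in>{a..b}. us n x \<noteq> U x}" and E: "energy (eps n) a b U G \<le> M"
      by (simp_all add: represents_def)
    let ?B = "{x \<in> A. \<bar>us n x - u x\<bar> \<le> 1 / 2 \<and> us n x = U x}"
    have B: "?B \<in> sets lebesgue" "measure lebesgue ?B > M / s\<^sup>2 * eps n"
      using m[rule_format, OF neg] n(1) by linarith+
    \<comment> \<open>The margin \<open>b - d\<close> leaves room for a whole cell to the right of
      every point of \<open>A\<close>.\<close>
    have "?B \<subseteq> {a..b - eps n}" using A(1) n(2) by force
    from quiet_cell[OF H eps(1) E _ this B] s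
    obtain q y where qy: "a \<le> q" "q + eps n \<le> b" "y \<in> ?B" "y \<in> {q..q+eps n}" "energy (eps n) q (q+eps n) U G \<le> s\<^sup>2"
      by auto
    obtain \<tau> where \<tau>: "\<tau> \<in> {-1,1}" "\<forall>z\<in>{q..q+eps n}. near \<tau> (34 * s) U (\<lambda>x. eps n * V x) z"
      using quiet_scaled[OF H2_subinterval[OF H qy(1,2)] eps(1) s qy(5)] by blast
    then have ny: "near \<tau> \<kappa> U (\<lambda>x. eps n * V x) y" using qy(4) by (simp add: s_def)
    \<comment> \<open>The value \<open>U y\<close> is within 1/2 of both \<tau> and \<sigma>,
      whereas distinct phases are 2 apart.\<close>
    moreover have "\<bar>U y - \<sigma>\<bar> \<le> 1/2" using qy(3) \<sigma>(2) by auto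
    then have "\<bar>\<tau> - \<sigma>\<bar> \<le> 1" using ny k(2) unfolding near_def by linarith
    then have "\<tau> = \<sigma>" using \<tau>(1) \<sigma>(1) by auto
    ultimately show "\<exists>z\<in>A. near \<sigma> \<kappa> U (\<lambda>x. eps n * V x) z" using qy(3) by blast
  qed
qed

section \<open>The lower bound\<close>

text \<open>A value of \<open>u\<close> at a point that its neighbourhood does not see costs no transition, so chains
  are restricted to these points.\<close>

definition essential :: "real \<Rightarrow> real \<Rightarrow> (real \<Rightarrow> real) \<Rightarrow> real set" where
  "essential a b u = {x\<in>{a<..<b}. u x \<in> {-1,1} \<and> (\<forall>\<delta>>0. \<not> negligible {y\<in>{x-\<delta><..<x+\<delta>}. u y = u x})}"

text \<open>Within one level set, the points that their neighbourhood does not see form a set that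
  is locally negligible, hence negligible by a countable subcover. Only two levels occur off a null
  set.\<close>

lemma negligible_not_essential:
  assumes "AE x in lebesgue. x \<in> {a<..<b} \<longrightarrow> u x \<in> {-1,1}"
  shows "negligible ({a<..<b} - essential a b u)"
proof -
  define D where "D \<sigma> = {x\<in>{a<..<b}. u x = \<sigma> \<and> (\<exists>\<delta>>0. negligible {y\<in>{x-\<delta><..<x+\<delta>}. u y = u x})}" for \<sigma>
  have "negligible (D \<sigma>)" for \<sigma>
  proof (rule locally_negligible_alt[THEN iffD2], rule ballI)
    fix x assume x: "x \<in> D \<sigma>"
    then obtain \<delta> where \<delta>: "\<delta> > 0" "negligible {y\<in>{x-\<delta><..<x+\<delta>}. u y = u x}" by (auto simp: D_def)
    show "\<exists>U. openin (top_of_set (D \<sigma>)) U \<and> x \<in> U \<and> negligible U"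
    proof (intro exI[of _ "D \<sigma> \<inter> {x-\<delta><..<x+\<delta>}"] conjI)
      show "negligible (D \<sigma> \<inter> {x-\<delta><..<x+\<delta>})"
        by (rule negligible_subset[OF \<delta>(2)]) (use x in \<open>auto simp: D_def\<close>)
    qed (use x \<delta> in \<open>auto simp: openin_open_Int\<close>)
  qed
  moreover obtain N where "negligible N" "{x. \<not> (x \<in> {a<..<b} \<longrightarrow> u x \<in> {-1,1})} \<subseteq> N"
    using assms unfolding eventually_ae_filter_negligible by blast
  ultimately have "negligible (N \<union> (D 1 \<union> D (-1)))" by (intro negligible_Un)
  then show ?thesis
  proof (rule negligible_subset)
    show "{a<..<b} - essential a b u \<subseteq> N \<union> (D 1 \<union> D (-1))"
      using \<open>_ \<subseteq> N\<close> unfolding essential_def D_def by blast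
  qed
qed

lemma energy_ge_sum:
  assumes H: "H2 p a b U V G" and e: "e > 0"
    and z: "\<And>i. i \<le> m \<Longrightarrow> a \<le> z i \<and> z i \<le> b" "\<And>i. i < m \<Longrightarrow> z i \<le> z (Suc i)"
  shows "(\<Sum>i<m. energy e (z i) (z (Suc i)) U G) \<le> energy e a (z m) U G"
  using z
proof (induction m)
  case 0
  then show ?case using energy_nonneg[OF e] by simp
next
  case (Suc m)
  have "H2 p a (z (Suc m)) U V G" using Suc.prems(1)[of "Suc m"] by (intro H2_subinterval[OF H]) auto
  from energy_combine[OF this, of "z m" e] show ?case using Suc by simp
qed

text \<open>Disjoint windows around the essential points each contain a quiet point with the phase
  of the centre. The pieces between consecutive quiet points do not overlap, so their transition
  costs add up, with one connector error per piece.\<close>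

lemma chain_energy_bound:
  fixes u :: "real \<Rightarrow> real"
  assumes c: "\<And>U V G e. profile p U V G \<Longrightarrow> e > 0 \<Longrightarrow> c \<le> energy e 0 1 U G"
    and u: "Lp_fun p a b u" and us: "\<And>n. Lp_fun p a b (us n)" and conv: "Lp_conv p a b us u" and p: "1 \<le> p"
    and eps: "\<And>n. eps n > 0" "eps \<longlonglongrightarrow> 0"
    and x: "\<And>i. i < m \<Longrightarrow> x i < x (Suc i)" "\<And>i. i \<le> m \<Longrightarrow> x i \<in> essential a b u" and k: "0 < \<kappa>" "\<kappa> \<le> 1/2"
  shows "\<forall>\<^sub>F n in sequentially. \<forall>U V G. represents p a b (eps n) M (us n) U V G \<longrightarrow>
    c/2 * (\<Sum>i<m. \<bar>u (x (Suc i)) - u (x i)\<bar>) \<le> energy (eps n) a b U G + real m * (328 * \<kappa>\<^sup>2)"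
proof -
  have xab: "a < x i" "x i < b" "u (x i) \<in> {-1,1}" if "i \<le> m" for i using x(2)[OF that] by (auto simp: essential_def)
  \<comment> \<open>Half of the least gap keeps the windows apart and away from both ends of the
    interval.\<close>
  obtain \<delta> where \<delta>: "\<delta> > 0" "\<And>i. i \<le> m \<Longrightarrow> a \<le> x i - \<delta> \<and> x i + \<delta> < b" "\<And>i. i < m \<Longrightarrow> x i + \<delta> \<le> x (Suc i) - \<delta>"
  proof -
    define S where "S = (\<lambda>i. (x i - a)/2) ` {..m} \<union> (\<lambda>i. (b - x i)/2) ` {..m} \<union> (\<lambda>i. (x (Suc i) - x i)/2) ` {..<m}"
    have fS: "finite S" "S \<noteq> {}" by (auto simp: S_def)
    have pos: "s > 0" if "s \<in> S" for s using that x(1) xab by (auto simp: S_def)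
    have "Min S > 0" using pos Min_in[OF fS] by blast
    moreover have "a \<le> x i - Min S \<and> x i + Min S < b" if i: "i \<le> m" for i
    proof -
      have "Min S \<le> (x i - a)/2" "Min S \<le> (b - x i)/2"
        by (rule Min_le[OF fS(1)], use i in \<open>simp add: S_def\<close>)+
      then have "a \<le> x i - Min S" "x i + Min S < b" using xab(1,2)[OF i] by argo+
      then show ?thesis ..
    qed
    moreover have "x i + Min S \<le> x (Suc i) - Min S" if i: "i < m" for i
    proof -
      have "Min S \<le> (x (Suc i) - x i)/2"
        by (rule Min_le[OF fS(1)], use i in \<open>simp add: S_def\<close>)
      then show ?thesis by argo
    qed
    ultimately show thesis using that by blast
  qed
  \<comment> \<open>That \<open>x i\<close> is essential prevents \<open>A i\<close> from being
    null, so it has the positive measure that \<open>quiet_point_in_window\<close> requires.\<close>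
  define A where "A i = {y\<in>{x i-\<delta><..<x i+\<delta>}. u y = u (x i)}" for i
  have "\<forall>\<^sub>F n in sequentially. \<forall>i\<in>{..m}. \<forall>U V G. represents p a b (eps n) M (us n) U V G \<longrightarrow> (\<exists>z\<in>A i. near (u (x i)) \<kappa> U (\<lambda>x. eps n * V x) z)"
  proof (rule eventually_ball_finite, simp, intro ballI)
    fix i assume "i \<in> {..m}"
    then have i: "i \<le> m" by simp
    have sub: "{x i-\<delta><..<x i+\<delta>} \<subseteq> {a<..<b}" using \<delta>(2)[OF i] by auto
    have mu: "u \<in> borel_measurable (lebesgue_on {a<..<b})" by (rule Lp_fun_measurable[OF u])
    have "{y \<in> space (lebesgue_on {a<..<b}). u y = u (x i)} \<in> sets (lebesgue_on {a<..<b})"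
      using mu by measurable
    then have lv: "{y\<in>{a<..<b}. u y = u (x i)} \<in> sets lebesgue"
      by (simp add: sets_restrict_space_iff space_restrict_space)
    have Ai: "A i = {x i-\<delta><..<x i+\<delta>} \<inter> {y\<in>{a<..<b}. u y = u (x i)}" using sub by (auto simp: A_def)
    have Am: "A i \<in> sets lebesgue" unfolding Ai by (rule sets.Int[OF _ lv]) simp
    have "A i \<in> lmeasurable" by (rule fmeasurableI2[of "{x i-\<delta><..<x i+\<delta>}"]) (use Am in \<open>auto simp: A_def\<close>)
    moreover have "\<not> negligible (A i)" using x(2)[OF i] \<delta>(1) by (auto simp: A_def essential_def)
    ultimately have "measure lebesgue (A i) \<noteq> 0" using negligible_iff_measure by blast
    then have pos: "measure lebesgue (A i) > 0" by (simp add: zero_less_measure_iff)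
    show "\<forall>\<^sub>F n in sequentially. \<forall>U V G. represents p a b (eps n) M (us n) U V G \<longrightarrow> (\<exists>z\<in>A i. near (u (x i)) \<kappa> U (\<lambda>x. eps n * V x) z)"
      by (rule quiet_point_in_window[OF u us conv p eps _ _ Am pos, of "x i + \<delta>"])
         (use \<delta>(2)[OF i] xab[OF i] k in \<open>auto simp: A_def\<close>)
  qed
  then show ?thesis
  proof (eventually_elim, intro allI impI)
    fix n U V G
    assume all: "\<forall>i\<in>{..m}. \<forall>U V G. represents p a b (eps n) M (us n) U V G \<longrightarrow> (\<exists>z\<in>A i. near (u (x i)) \<kappa> U (\<lambda>x. eps n * V x) z)"
      and R: "represents p a b (eps n) M (us n) U V G"
    then have H: "H2 p a b U V G" by (simp add: represents_def)
    have "\<forall>i\<in>{..m}. \<exists>z. z \<in> A i \<and> near (u (x i)) \<kappa> U (\<lambda>x. eps n * V x) z" using all R by blast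
    then obtain z where z: "\<And>i. i \<le> m \<Longrightarrow> z i \<in> A i \<and> near (u (x i)) \<kappa> U (\<lambda>x. eps n * V x) (z i)"
      unfolding atMost_iff Ball_def by metis
    have zb: "a \<le> z i \<and> z i \<le> b" if "i \<le> m" for i using z[OF that] \<delta>(2)[OF that] by (auto simp: A_def)
    have zm: "z i \<le> z (Suc i)" if "i < m" for i using z[of i] z[of "Suc i"] \<delta>(3)[OF that] that by (auto simp: A_def)
    have t: "c/2 * \<bar>u (x (Suc i)) - u (x i)\<bar> \<le> energy (eps n) (z i) (z (Suc i)) U G + 328 * \<kappa>\<^sup>2" if i: "i < m" for i
    proof (rule transition_scaled[OF c _ zm[OF i] p _ eps(1)])
      show "H2 p (z i) (z (Suc i)) U V G"
        using zb[of i] zb[of "Suc i"] i by (intro H2_subinterval[OF H]) auto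
      show "u (x i) \<in> {-1,1}" "u (x (Suc i)) \<in> {-1,1}" using xab(3)[of i] xab(3)[of "Suc i"] i by auto
      show "near (u (x i)) \<kappa> U (\<lambda>x. eps n * V x) (z i)" "near (u (x (Suc i))) \<kappa> U (\<lambda>x. eps n * V x) (z (Suc i))"
        using z[of i] z[of "Suc i"] i by auto
    qed (use k in auto)
    have "c/2 * (\<Sum>i<m. \<bar>u (x (Suc i)) - u (x i)\<bar>) = (\<Sum>i<m. c/2 * \<bar>u (x (Suc i)) - u (x i)\<bar>)"
      by (simp add: sum_distrib_left)
    also have "\<dots> \<le> (\<Sum>i<m. energy (eps n) (z i) (z (Suc i)) U G + 328 * \<kappa>\<^sup>2)"
      by (rule sum_mono) (use t in simp)
    also have "\<dots> = (\<Sum>i<m. energy (eps n) (z i) (z (Suc i)) U G) + real m * (328 * \<kappa>\<^sup>2)"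
      by (simp add: sum.distrib)
    also have "(\<Sum>i<m. energy (eps n) (z i) (z (Suc i)) U G) \<le> energy (eps n) a (z m) U G"
      by (rule energy_ge_sum[OF H eps(1)]) (use zb zm in auto)
    also have "\<dots> \<le> energy (eps n) a b U G"
      using zb[of m] by (intro energy_mono[OF H _ _ eps(1)]) auto
    finally show "c/2 * (\<Sum>i<m. \<bar>u (x (Suc i)) - u (x i)\<bar>) \<le> energy (eps n) a b U G + real m * (328 * \<kappa>\<^sup>2)" by simp
  qed
qed

lemma chain_le_liminf:
  fixes u :: "real \<Rightarrow> real"
  assumes c: "\<And>U V G e. profile p U V G \<Longrightarrow> e > 0 \<Longrightarrow> c \<le> energy e 0 1 U G"
    and ab: "a < b"
    and u: "Lp_fun p a b u" and us: "\<And>n. Lp_fun p a b (us n)" and conv: "Lp_conv p a b us u" and p: "1 \<le> p"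
    and eps: "\<And>n. eps n > 0" "eps \<longlonglongrightarrow> 0"
    and x: "\<And>i. i < m \<Longrightarrow> x i < x (Suc i)" "\<And>i. i \<le> m \<Longrightarrow> x i \<in> essential a b u"
  shows "ereal (c/2 * (\<Sum>i<m. \<bar>u (x (Suc i)) - u (x i)\<bar>)) \<le> liminf (\<lambda>n. F_eps p a b (eps n) (us n))"
  unfolding le_Liminf_iff
proof (intro allI impI)
  fix y assume y: "y < ereal (c/2 * (\<Sum>i<m. \<bar>u (x (Suc i)) - u (x i)\<bar>))"
  define C where "C = c/2 * (\<Sum>i<m. \<bar>u (x (Suc i)) - u (x i)\<bar>)"
  obtain r where r: "y < ereal r" "ereal r < ereal C" using ereal_dense2[OF y] unfolding C_def by blast
  then have d: "C - r > 0" by simp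
  \<comment> \<open>As \<kappa>^2 \<le> \<kappa>, the total connector error becomes at most C - r;
    the + 1 covers m = 0.\<close>
  define \<kappa> where "\<kappa> = min (1/2) ((C - r) / (real m * 328 + 1))"
  have k: "0 < \<kappa>" "\<kappa> \<le> 1/2" unfolding \<kappa>_def using d by (simp add: add_nonneg_pos, intro min.cobounded1)
  have "real m * (328 * \<kappa>\<^sup>2) \<le> real m * (328 * \<kappa>)"
    using k by (intro mult_left_mono) (auto simp: power2_eq_square)
  also have "\<dots> \<le> (real m * 328 + 1) * \<kappa>" using k by (simp add: algebra_simps)
  also have "\<dots> \<le> (real m * 328 + 1) * ((C - r) / (real m * 328 + 1))"
    by (intro mult_left_mono) (auto simp: \<kappa>_def)
  also have "\<dots> = C - r" by (simp add: add_nonneg_pos less_imp_neq[THEN not_sym])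
  finally have small: "real m * (328 * \<kappa>\<^sup>2) \<le> C - r" .
  \<comment> \<open>The energy cap is \<open>C\<close> itself: a function with energy at least
    \<open>C\<close> already lies above r.\<close>
  have ev: "\<forall>\<^sub>F n in sequentially. \<forall>U V G. represents p a b (eps n) C (us n) U V G \<longrightarrow>
    c/2 * (\<Sum>i<m. \<bar>u (x (Suc i)) - u (x i)\<bar>) \<le> energy (eps n) a b U G + real m * (328 * \<kappa>\<^sup>2)"
    by (rule chain_energy_bound[OF _ u us conv p eps _ _ k]) (fact c x)+
  show "\<forall>\<^sub>F n in sequentially. y < F_eps p a b (eps n) (us n)"
    using ev
  proof eventually_elim
    case (elim n)
    show ?case
    proof (cases "F_eps p a b (eps n) (us n) < ereal C")
      case True
      then have "F_eps p a b (eps n) (us n) < \<infinity>" by (rule less_trans) simp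
      from F_eps_finite[OF this p ab eps(1)] obtain U V G where
        *: "H2 p a b U V G" "negligible {x \<in> {a..b}. us n x \<noteq> U x}" "F_eps p a b (eps n) (us n) = ereal (energy (eps n) a b U G)"
        by blast
      then have "C \<le> energy (eps n) a b U G + real m * (328 * \<kappa>\<^sup>2)" using elim True unfolding C_def represents_def by simp
      then have "r \<le> energy (eps n) a b U G" using small by linarith
      then show ?thesis using *(3) r(1) by (simp add: less_le_trans)
    next
      case False
      then show ?thesis using r by (meson less_le_trans less_trans not_le)
    qed
  qed
qed

text \<open>The failure is quantitative on some \<open>A r\<close> of positive measure. On more than
  half of it u_n is within r of u, so it stays r away from 1 and -1, and the potential term is of
  order 1/\<epsilon>_n.\<close>

lemma liminf_infinite:
  assumes ab: "a < b"
    and u: "Lp_fun p a b u" and us: "\<And>n. Lp_fun p a b (us n)" and conv: "Lp_conv p a b us u" and p: "1 \<le> p"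
    and eps: "\<And>n. eps n > 0" "eps \<longlonglongrightarrow> 0"
    and not: "\<not> (AE x in lebesgue. x \<in> {a<..<b} \<longrightarrow> u x \<in> {-1,1})"
  shows "liminf (\<lambda>n. F_eps p a b (eps n) (us n)) = \<infinity>"
proof -
  define A where "A r = {x\<in>{a<..<b}. \<bar>\<bar>u x\<bar> - 1\<bar> > 2 * r}" for r
  have "\<exists>r>0. \<not> negligible (A r)"
  proof (rule ccontr)
    assume "\<not> ?thesis"
    then have "negligible (\<Union>k::nat. A (1 / real (Suc k)))" by (intro negligible_Union_nat) auto
    moreover have "{x. \<not> (x \<in> {a<..<b} \<longrightarrow> u x \<in> {-1,1})} \<subseteq> (\<Union>k::nat. A (1 / real (Suc k)))"
    proof
      fix x assume x: "x \<in> {x. \<not> (x \<in> {a<..<b} \<longrightarrow> u x \<in> {-1,1})}"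
      then have "\<bar>\<bar>u x\<bar> - 1\<bar> / 2 > 0" by (auto simp: abs_if split: if_splits)
      from reals_Archimedean[OF this] obtain k where "inverse (real (Suc k)) < \<bar>\<bar>u x\<bar> - 1\<bar> / 2" by blast
      then show "x \<in> (\<Union>k::nat. A (1 / real (Suc k)))" using x by (auto simp: A_def inverse_eq_divide)
    qed
    ultimately show False using not unfolding eventually_ae_filter_negligible by blast
  qed
  then obtain r where r: "r > 0" "\<not> negligible (A r)" by blast
  have mu: "u \<in> borel_measurable (lebesgue_on {a<..<b})" by (rule Lp_fun_measurable[OF u])
  have "{x \<in> space (lebesgue_on {a<..<b}). \<bar>\<bar>u x\<bar> - 1\<bar> > 2 * r} \<in> sets (lebesgue_on {a<..<b})"
    using mu by measurable
  then have Am: "A r \<in> sets lebesgue"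
    by (simp add: sets_restrict_space_iff space_restrict_space A_def)
  have A: "A r \<subseteq> {a<..<b}" by (auto simp: A_def)
  have "A r \<in> lmeasurable" by (rule fmeasurableI2[OF _ A Am]) auto
  then have "measure lebesgue (A r) \<noteq> 0" using r negligible_iff_measure by blast
  then have pos: "measure lebesgue (A r) > 0" by (simp add: zero_less_measure_iff)
  have "\<infinity> \<le> liminf (\<lambda>n. F_eps p a b (eps n) (us n))"
    unfolding le_Liminf_iff
  proof (intro allI impI)
    fix y :: ereal assume "y < \<infinity>"
    then obtain M where M: "y < ereal M" using ereal_dense2 by blast
    have "(\<lambda>n. M * eps n) \<longlonglongrightarrow> M * 0" by (intro tendsto_intros eps)
    then have "\<forall>\<^sub>F n in sequentially. M * eps n < r\<^sup>2 * (measure lebesgue (A r) / 2)"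
      by (rule order_tendstoD(2)) (use r pos in simp)
    with Lp_conv_in_measure[OF u us conv p A Am pos r(1)]
    show "\<forall>\<^sub>F n in sequentially. y < F_eps p a b (eps n) (us n)"
    proof eventually_elim
      case (elim n)
      show ?case
      proof (rule ccontr)
        assume "\<not> ?thesis"
        then have le: "F_eps p a b (eps n) (us n) < ereal M" using M by (meson le_less_trans not_le)
        then have "F_eps p a b (eps n) (us n) < \<infinity>" by (rule less_trans) simp
        from F_eps_finite[OF this p ab eps(1)] obtain U V G where
          *: "H2 p a b U V G" "negligible {x \<in> {a..b}. us n x \<noteq> U x}" "F_eps p a b (eps n) (us n) = ereal (energy (eps n) a b U G)"
          by blast
        define B where "B = {x\<in>A r. \<bar>us n x - u x\<bar> \<le> r \<and> us n x = U x}"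
        have B: "B \<in> sets lebesgue" "measure lebesgue B > measure lebesgue (A r) / 2"
          using elim(1)[rule_format, OF *(2)] by (auto simp: B_def)
        have Bs: "B \<subseteq> {a..b}" using A by (auto simp: B_def)
        have Bm: "B \<in> lmeasurable" by (rule fmeasurableI2[OF _ Bs B(1)]) auto
        have i: "(\<lambda>x. indicator B x :: real) integrable_on {a..b}"
          using Bm by (intro integrable_on_indicator[THEN iffD2]) (auto intro: fmeasurable_Int_fmeasurable)
        have "measure lebesgue B = integral {a..b} (indicator B)"
          using Bs Bm by (subst integral_indicator) (auto simp: Int_absorb2)
        then have "r\<^sup>2 / eps n * measure lebesgue B = integral {a..b} (\<lambda>x. r\<^sup>2 / eps n * indicator B x)"
          by simp
        also have "\<dots> \<le> energy (eps n) a b U G"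
          unfolding energy_def
        proof (rule integral_le[OF integrable_on_mult_right[OF i] energy_integrable[OF *(1)]])
          fix x
          have "r \<le> \<bar>U x ^ 2 - 1\<bar>" if x: "x \<in> B"
          proof -
            have 1: "\<bar>\<bar>U x\<bar> - 1\<bar> \<ge> r" using x by (auto simp: B_def A_def)
            have "r * 1 \<le> \<bar>\<bar>U x\<bar> - 1\<bar> * \<bar>\<bar>U x\<bar> + 1\<bar>" using 1 r by (intro mult_mono) auto
            also have "\<dots> = \<bar>(\<bar>U x\<bar> - 1) * (\<bar>U x\<bar> + 1)\<bar>" by (simp only: abs_mult)
            also have "(\<bar>U x\<bar> - 1) * (\<bar>U x\<bar> + 1) = U x ^ 2 - 1" by (simp add: power2_eq_square algebra_simps)
            finally show ?thesis by simp
          qed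
          then have "r\<^sup>2 * indicator B x \<le> (U x ^ 2 - 1) ^ 2"
            using r power_mono[of r "\<bar>U x ^ 2 - 1\<bar>" 2] by (auto split: split_indicator)
          then have "r\<^sup>2 * indicator B x / eps n \<le> (U x ^ 2 - 1) ^ 2 / eps n"
            using eps(1)[of n] by (simp add: divide_right_mono)
          then show "r\<^sup>2 / eps n * indicator B x \<le> (U x ^ 2 - 1) ^ 2 / eps n + eps n ^ 3 * (G x) ^ 2"
            using eps(1)[of n] by (simp add: add_increasing2)
        qed
        also have "\<dots> < M" using le *(3) by simp
        finally have "r\<^sup>2 * measure lebesgue B < M * eps n" using eps(1)[of n] by (simp add: field_simps)
        moreover have "r\<^sup>2 * (measure lebesgue (A r) / 2) \<le> r\<^sup>2 * measure lebesgue B" using B(2) by (intro mult_left_mono) auto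
        ultimately show False using elim(2) by linarith
      qed
    qed
  qed
  then show ?thesis by simp
qed

text \<open>Chains only see essential points, so a representative is built whose value at any point
  is attained by u at essential points there or arbitrarily close on the right. Moving the points of
  a partition slightly to the right turns its variation into that of a chain.\<close>

lemma essVar_le_of_chains:
  assumes ae: "AE x in lebesgue. x \<in> {a<..<b} \<longrightarrow> u x \<in> {-1,1}"
    and K: "\<And>m x. (\<And>i. i < m \<Longrightarrow> x i < x (Suc i)) \<Longrightarrow> (\<And>i. i \<le> m \<Longrightarrow> x i \<in> essential a b u) \<Longrightarrow>
      ereal (\<Sum>i<m. \<bar>u (x (Suc i)) - u (x i)\<bar>) \<le> K"
  shows "essVar {a<..<b} u \<le> K"
proof -
  let ?S = "essential a b u"
  have neg: "negligible ({a<..<b} - ?S)" by (rule negligible_not_essential[OF ae])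
  have dense: "\<exists>s\<in>?S. c < s \<and> s < d" if "a \<le> c" "c < d" "d \<le> b" for c d
  proof (rule ccontr)
    assume "\<not> ?thesis"
    then have "{c<..<d} \<subseteq> {a<..<b} - ?S" using that by auto
    then have "negligible {c<..<d}" using neg negligible_subset by blast
    then show False using that negligible_interval(2)[of c d] by simp
  qed
  have ex: "\<exists>\<sigma>. \<forall>\<delta>>0. \<exists>s\<in>?S. x < s \<and> s < x + \<delta> \<and> u s = \<sigma>" if x: "x \<in> {a<..<b}" for x
  proof (rule ccontr)
    assume "\<not> ?thesis"
    then obtain d where d: "\<And>\<sigma>. d \<sigma> > 0 \<and> (\<forall>s\<in>?S. x < s \<and> s < x + d \<sigma> \<longrightarrow> u s \<noteq> \<sigma>)" by metis
    \<comment> \<open>No essential point between \<open>x\<close> and \<open>x + e\<close> could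
      carry either phase, although essential points are dense.\<close>
    define e where "e = min (b - x) (min (d 1) (d (-1)))"
    have "e > 0" using d x by (auto simp: e_def)
    moreover have "x + e \<le> b" by (simp add: e_def)
    ultimately obtain s where s: "s \<in> ?S" "x < s" "s < x + e" using dense[of x "x+e"] x by auto
    have "u s = 1 \<or> u s = -1" using s(1) by (auto simp: essential_def)
    then show False using s d[of 1] d[of "-1"] by (auto simp: e_def)
  qed
  define v where "v x = (if x \<in> ?S then u x else (SOME \<sigma>. \<forall>\<delta>>0. \<exists>s\<in>?S. x < s \<and> s < x + \<delta> \<and> u s = \<sigma>))" for x
  have near: "\<exists>s\<in>?S. x \<le> s \<and> s < x + \<delta> \<and> u s = v x" if x: "x \<in> {a<..<b}" "\<delta> > 0" for x \<delta>
  proof (cases "x \<in> ?S")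
    case True
    then show ?thesis using x by (intro bexI[of _ x]) (auto simp: v_def)
  next
    case False
    then have "\<forall>\<delta>>0. \<exists>s\<in>?S. x < s \<and> s < x + \<delta> \<and> u s = v x"
      using someI_ex[OF ex[OF x(1)]] by (simp add: v_def)
    then show ?thesis using x(2) by (meson less_imp_le)
  qed
  have "pvar {a<..<b} v \<le> K"
    unfolding pvar_def
  proof (rule SUP_least, clarify)
    fix n z assume z: "\<forall>i<n. z i < z (Suc i)" "\<forall>i\<le>n. z i \<in> {a<..<b}"
    \<comment> \<open>No partition point follows the last one, so its shift is bounded by 1 only;
      membership in the essential set keeps it below \<open>b\<close>.\<close>
    define d where "d i = (if i < n then z (Suc i) - z i else 1)" for i
    have dz: "d i > 0" "z i \<in> {a<..<b}" if "i \<le> n" for i using z that by (auto simp: d_def)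
    have "\<forall>i. \<exists>s. i \<le> n \<longrightarrow> s \<in> ?S \<and> z i \<le> s \<and> s < z i + d i \<and> u s = v (z i)"
      using near[OF dz(2,1)] by blast
    then obtain s where s: "\<And>i. i \<le> n \<Longrightarrow> s i \<in> ?S \<and> z i \<le> s i \<and> s i < z i + d i \<and> u (s i) = v (z i)" by metis
    have "(\<Sum>i<n. \<bar>v (z (Suc i)) - v (z i)\<bar>) = (\<Sum>i<n. \<bar>u (s (Suc i)) - u (s i)\<bar>)"
      by (rule sum.cong) (use s in auto)
    moreover have "ereal (\<Sum>i<n. \<bar>u (s (Suc i)) - u (s i)\<bar>) \<le> K"
    proof (rule K)
      show "s i < s (Suc i)" if "i < n" for i using s[of i] s[of "Suc i"] that by (auto simp: d_def)
    qed (use s in auto)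
    ultimately show "ereal (\<Sum>i<fst (n, z). \<bar>v (snd (n, z) (Suc i)) - v (snd (n, z) i)\<bar>) \<le> K" by simp
  qed
  moreover have "AE x in lebesgue. x \<in> {a<..<b} \<longrightarrow> v x = u x"
    unfolding eventually_ae_filter_negligible by (intro exI[of _ "{a<..<b} - ?S"] conjI neg) (auto simp: v_def)
  ultimately show ?thesis unfolding essVar_def by (blast intro: INF_lower2)
qed

lemma F_lim_le_liminf:
  assumes ab: "a < b"
    and u: "Lp_fun p a b u" and us: "\<And>n. Lp_fun p a b (us n)" and conv: "Lp_conv p a b us u" and p: "1 \<le> p"
    and eps: "\<And>n. eps n > 0" "eps \<longlonglongrightarrow> 0"
  shows "F_lim p a b u \<le> liminf (\<lambda>n. F_eps p a b (eps n) (us n))"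
proof (cases "AE x in lebesgue. x \<in> {a<..<b} \<longrightarrow> u x \<in> {-1,1}")
  case False
  then show ?thesis using liminf_infinite[OF ab u us conv p eps] by simp
next
  case True
  obtain c where c: "c > 0" "alpha p = ereal (c/2)" "\<And>U V G e. profile p U V G \<Longrightarrow> e > 0 \<Longrightarrow> c \<le> energy e 0 1 U G"
    using alpha_properties[OF p] by blast
  let ?L = "liminf (\<lambda>n. F_eps p a b (eps n) (us n))"
  have "essVar {a<..<b} u \<le> ?L / ereal (c/2)"
  proof (rule essVar_le_of_chains[OF True])
    fix m and x :: "nat \<Rightarrow> real"
    assume x: "\<And>i. i < m \<Longrightarrow> x i < x (Suc i)" "\<And>i. i \<le> m \<Longrightarrow> x i \<in> essential a b u"
    have "ereal (c/2 * (\<Sum>i<m. \<bar>u (x (Suc i)) - u (x i)\<bar>)) \<le> ?L"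
      by (rule chain_le_liminf[OF c(3) ab u us conv p eps]) (use x in auto)
    then have "ereal (c/2) * ereal (\<Sum>i<m. \<bar>u (x (Suc i)) - u (x i)\<bar>) \<le> ?L" by simp
    then show "ereal (\<Sum>i<m. \<bar>u (x (Suc i)) - u (x i)\<bar>) \<le> ?L / ereal (c/2)"
      using c(1) by (subst ereal_le_divide_pos) auto
  qed
  then have le: "alpha p * essVar {a<..<b} u \<le> ?L"
    using c(1,2) by (subst (asm) ereal_le_divide_pos) auto
  show ?thesis
  proof (cases "BPV p a b u")
    case True
    then show ?thesis using le by (simp add: F_lim_def)
  next
    case False
    \<comment> \<open>The other conditions of \<open>BPV\<close> hold, so only the variation can
      fail; as \<alpha> is positive, the bound then makes the lower limit infinite.\<close>
    then have "essVar {a<..<b} u = \<infinity>" using u True unfolding BPV_def by auto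
    then show ?thesis using le c(1,2) by simp
  qed
qed

section \<open>Step functions of essentially bounded variation\<close>

text \<open>A single partition witnessing \<open>r\<close>, instead of the supremum, so that a
  further jump can be attached to it explicitly.\<close>

definition var_ge :: "(real \<Rightarrow> real) \<Rightarrow> real set \<Rightarrow> real \<Rightarrow> bool" where
  "var_ge v I r \<longleftrightarrow> (\<exists>n x. (\<forall>i<n. x i < x (Suc i)) \<and> (\<forall>i\<le>n. x i \<in> I) \<and>
     r \<le> (\<Sum>i<n. \<bar>v (x (Suc i)) - v (x i)\<bar>))"

lemma var_ge_pvar:
  assumes "var_ge v I r" shows "ereal r \<le> pvar I v"
proof -
  obtain n x where x: "\<forall>i<n. x i < x (Suc i)" "\<forall>i\<le>n. x i \<in> I" "r \<le> (\<Sum>i<n. \<bar>v (x (Suc i)) - v (x i)\<bar>)"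
    using assms unfolding var_ge_def by blast
  show ?thesis
    unfolding pvar_def by (rule SUP_upper2[of "(n, x)"]) (use x in auto)
qed

lemma var_ge_mono: "var_ge v I r \<Longrightarrow> I \<subseteq> J \<Longrightarrow> var_ge v J r"
  unfolding var_ge_def by blast

lemma var_ge_0: "x \<in> I \<Longrightarrow> var_ge v I 0"
  unfolding var_ge_def by (intro exI[of _ 0] exI[of _ "\<lambda>_. x"]) auto

text \<open>The points \<open>lo\<close> and \<open>hi\<close> go behind the old partition; the
  connecting step to \<open>lo\<close> can only add variation and is dropped from the
  estimate.\<close>

lemma var_ge_append:
  assumes "var_ge v {x<..<lo} r" "x < lo" "lo < hi" "hi < d"
  shows "var_ge v {x<..<d} (r + \<bar>v hi - v lo\<bar>)"
proof -
  obtain n z where z: "\<forall>i<n. z i < z (Suc i)" "\<forall>i\<le>n. z i \<in> {x<..<lo}" "r \<le> (\<Sum>i<n. \<bar>v (z (Suc i)) - v (z i)\<bar>)"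
    using assms unfolding var_ge_def by blast
  define y where "y i = (if i \<le> n then z i else if i = Suc n then lo else hi)" for i
  have "(\<Sum>i<n. \<bar>v (y (Suc i)) - v (y i)\<bar>) = (\<Sum>i<n. \<bar>v (z (Suc i)) - v (z i)\<bar>)"
    by (rule sum.cong) (auto simp: y_def)
  then have "r + \<bar>v hi - v lo\<bar> \<le> (\<Sum>i<Suc (Suc n). \<bar>v (y (Suc i)) - v (y i)\<bar>)"
    using z(3) by (simp add: y_def)
  moreover have "y i < y (Suc i)" if i: "i < Suc (Suc n)" for i
  proof -
    consider "i < n" | "i = n" | "i = Suc n" using i by linarith
    then show ?thesis using z(1,2) assms by cases (auto simp: y_def)
  qed
  moreover have "y i \<in> {x<..<d}" if "i \<le> Suc (Suc n)" for i
  proof (cases "i \<le> n")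
    case True
    then show ?thesis using z(2) assms by (fastforce simp: y_def)
  qed (use assms in \<open>auto simp: y_def\<close>)
  ultimately show ?thesis unfolding var_ge_def by blast
qed

lemma var_ge_prepend:
  assumes "var_ge v {hi<..<x} r" "hi < x" "lo < hi" "d < lo"
  shows "var_ge v {d<..<x} (r + \<bar>v hi - v lo\<bar>)"
proof -
  obtain n z where z: "\<forall>i<n. z i < z (Suc i)" "\<forall>i\<le>n. z i \<in> {hi<..<x}" "r \<le> (\<Sum>i<n. \<bar>v (z (Suc i)) - v (z i)\<bar>)"
    using assms unfolding var_ge_def by blast
  define y where "y i = (if i = 0 then lo else if i = Suc 0 then hi else z (i-2))" for i
  have "(\<Sum>i<n. \<bar>v (y (Suc (Suc (Suc i)))) - v (y (Suc (Suc i)))\<bar>) = (\<Sum>i<n. \<bar>v (z (Suc i)) - v (z i)\<bar>)"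
    by (rule sum.cong) (auto simp: y_def)
  then have "r + \<bar>v hi - v lo\<bar> \<le> (\<Sum>i<Suc (Suc n). \<bar>v (y (Suc i)) - v (y i)\<bar>)"
    unfolding sum.lessThan_Suc_shift using z(3) by (simp add: y_def)
  moreover have "y i < y (Suc i)" if i: "i < Suc (Suc n)" for i
  proof (cases i)
    case (Suc k)
    then show ?thesis using i z(1,2) assms by (cases k) (auto simp: y_def)
  qed (use assms in \<open>simp add: y_def\<close>)
  moreover have "y i \<in> {d<..<x}" if i: "i \<le> Suc (Suc n)" for i
  proof (cases i)
    case (Suc k)
    show ?thesis
    proof (cases k)
      case 0
      then show ?thesis using Suc assms by (simp add: y_def)
    next
      case (Suc j)
      then have "y i = z j" "j \<le> n" using i \<open>i = Suc k\<close> by (auto simp: y_def)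
      then show ?thesis using z(2)[rule_format, of j] assms by auto
    qed
  qed (use assms in \<open>simp add: y_def\<close>)
  ultimately show ?thesis unfolding var_ge_def by blast
qed

text \<open>Otherwise both values would be taken on every one-sided neighbourhood of \<open>x\<close>, and peeling off one jump
  at a time would make the variation infinite.\<close>

lemma one_sided_constant:
  fixes u v :: "real \<Rightarrow> real"
  assumes fin: "pvar {a<..<b} v < \<infinity>" and N: "negligible N"
    and good: "\<And>y. y \<in> {a<..<b} - N \<Longrightarrow> v y = u y \<and> u y \<in> {-1,1}"
  shows "a \<le> x \<Longrightarrow> x < b \<Longrightarrow> \<exists>\<delta>>0. \<exists>\<sigma>\<in>{-1,1}. negligible {y\<in>{x<..<x+\<delta>} \<inter> {a<..<b}. u y \<noteq> \<sigma>}"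
    and "a < x \<Longrightarrow> x \<le> b \<Longrightarrow> \<exists>\<delta>>0. \<exists>\<sigma>\<in>{-1,1}. negligible {y\<in>{x-\<delta><..<x} \<inter> {a<..<b}. u y \<noteq> \<sigma>}"
proof -
  have nofin: False if "\<And>k::nat. var_ge v {a<..<b} (2 * real k)"
  proof -
    obtain K where K: "pvar {a<..<b} v \<le> ereal K"
      using fin by (cases "pvar {a<..<b} v") auto
    obtain k :: nat where "K < real k" using reals_Archimedean2 by blast
    moreover have "ereal (2 * real k) \<le> ereal K" using var_ge_pvar[OF that[of k]] K by (rule order_trans)
    ultimately show False by simp
  qed
  \<comment> \<open>If \<open>v\<close> missed one phase on \<open>J\<close>, then \<open>u\<close>
    would be the other one almost everywhere there. So both occur, and whichever comes first, the
    pair jumps by 2.\<close>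
  have both: "\<exists>lo hi. lo \<in> J \<and> hi \<in> J \<and> lo < hi \<and> \<bar>v hi - v lo\<bar> = 2"
    if J: "J \<subseteq> {a<..<b}" "\<And>\<sigma>. \<sigma> \<in> {-1,1} \<Longrightarrow> \<not> negligible {y\<in>J. u y \<noteq> \<sigma>}" for J
  proof -
    have "\<exists>y\<in>J. v y = - \<sigma>" if \<sigma>: "\<sigma> \<in> {-1,1}" for \<sigma>
    proof (rule ccontr)
      assume n: "\<not> ?thesis"
      have "{y\<in>J. u y \<noteq> \<sigma>} \<subseteq> N"
      proof
        fix y assume y: "y \<in> {y\<in>J. u y \<noteq> \<sigma>}"
        show "y \<in> N"
        proof (rule ccontr)
          assume "y \<notin> N"
          then have "v y = u y" "u y \<in> {-1,1}" using good[of y] y J(1) by auto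
          then have "v y = - \<sigma>" using y \<sigma> by auto
          then show False using n y by auto
        qed
      qed
      then show False using J(2)[OF \<sigma>] negligible_subset[OF N] by blast
    qed
    from this[of 1] this[of "-1"] obtain y1 y2 where y: "y1 \<in> J" "v y1 = -1" "y2 \<in> J" "v y2 = 1" by auto
    then have "y1 \<noteq> y2" by auto
    show ?thesis
    proof (cases "y1 < y2")
      case True
      then show ?thesis using y by (intro exI[of _ y1] exI[of _ y2]) auto
    next
      case False
      then show ?thesis using y \<open>y1 \<noteq> y2\<close> by (intro exI[of _ y2] exI[of _ y1]) auto
    qed
  qed
  show "\<exists>\<delta>>0. \<exists>\<sigma>\<in>{-1,1}. negligible {y\<in>{x<..<x+\<delta>} \<inter> {a<..<b}. u y \<noteq> \<sigma>}" if x: "a \<le> x" "x < b"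
  proof (rule ccontr)
    assume neg: "\<not> ?thesis"
    \<comment> \<open>The window is generalised in the induction: one jump from \<open>lo\<close> to
      \<open>hi\<close> is taken inside it, and the other k are found in the smaller window ending
      at \<open>lo\<close>.\<close>
    have "var_ge v {x<..<d} (2 * real k)" if "x < d" "d \<le> b" for k d
      using that
    proof (induction k arbitrary: d)
      case 0
      then show ?case using var_ge_0[of "(x+d)/2" "{x<..<d}"] by simp
    next
      case (Suc k)
      have "{x<..<x+(d-x)} \<inter> {a<..<b} = {x<..<d}" using x Suc.prems by auto
      moreover have "d - x > 0" using Suc.prems by simp
      ultimately have "\<And>\<sigma>. \<sigma> \<in> {-1,1} \<Longrightarrow> \<not> negligible {y\<in>{x<..<d}. u y \<noteq> \<sigma>}" using neg by metis
      moreover have "{x<..<d} \<subseteq> {a<..<b}" using x Suc.prems by auto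
      ultimately obtain lo hi where lh: "lo \<in> {x<..<d}" "hi \<in> {x<..<d}" "lo < hi" "\<bar>v hi - v lo\<bar> = 2"
        using both by blast
      have "var_ge v {x<..<lo} (2 * real k)" using Suc.IH[of lo] lh Suc.prems by auto
      from var_ge_append[OF this _ lh(3), of d] lh show ?case by (simp add: algebra_simps)
    qed
    then have "var_ge v {x<..<b} (2 * real k)" for k using x by blast
    then have "var_ge v {a<..<b} (2 * real k)" for k by (rule var_ge_mono) (use x in auto)
    then show False by (rule nofin)
  qed
  show "\<exists>\<delta>>0. \<exists>\<sigma>\<in>{-1,1}. negligible {y\<in>{x-\<delta><..<x} \<inter> {a<..<b}. u y \<noteq> \<sigma>}" if x: "a < x" "x \<le> b"
  proof (rule ccontr)
    assume neg: "\<not> ?thesis"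
    have "var_ge v {d<..<x} (2 * real k)" if "d < x" "a \<le> d" for k d
      using that
    proof (induction k arbitrary: d)
      case 0
      then show ?case using var_ge_0[of "(x+d)/2" "{d<..<x}"] by simp
    next
      case (Suc k)
      have "{x-(x-d)<..<x} \<inter> {a<..<b} = {d<..<x}" using x Suc.prems by auto
      moreover have "x - d > 0" using Suc.prems by simp
      ultimately have "\<And>\<sigma>. \<sigma> \<in> {-1,1} \<Longrightarrow> \<not> negligible {y\<in>{d<..<x}. u y \<noteq> \<sigma>}" using neg by metis
      moreover have "{d<..<x} \<subseteq> {a<..<b}" using x Suc.prems by auto
      ultimately obtain lo hi where lh: "lo \<in> {d<..<x}" "hi \<in> {d<..<x}" "lo < hi" "\<bar>v hi - v lo\<bar> = 2"
        using both by blast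
      have "var_ge v {hi<..<x} (2 * real k)" using Suc.IH[of hi] lh Suc.prems by auto
      from var_ge_prepend[OF this _ lh(3), of d] lh show ?case by (simp add: algebra_simps)
    qed
    then have "var_ge v {a<..<x} (2 * real k)" for k using x by blast
    then have "var_ge v {a<..<b} (2 * real k)" for k by (rule var_ge_mono) (use x in auto)
    then show False by (rule nofin)
  qed
qed

text \<open>The strict inequality makes the step function left-continuous, in agreement with
  transitions that start at a jump and extend to its right.\<close>

definition stepf :: "real \<Rightarrow> real set \<Rightarrow> real \<Rightarrow> real" where
  "stepf \<tau> T x = \<tau> * (-1) ^ card {t\<in>T. t < x}"

lemma stepf_left: "(\<And>t. t \<in> T' \<Longrightarrow> x \<le> t) \<Longrightarrow> stepf \<tau> (T \<union> T') x = stepf \<tau> T x"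
  unfolding stepf_def by (rule arg_cong[where f = "\<lambda>S. \<tau> * (-1) ^ card S"]) force

lemma stepf_right:
  assumes "finite T" "finite T'" "T \<inter> T' = {}" "\<And>t. t \<in> T \<Longrightarrow> t < x"
  shows "stepf \<tau> (T \<union> T') x = stepf (\<tau> * (-1) ^ card T) T' x"
proof -
  have "{t\<in>T \<union> T'. t < x} = T \<union> {t\<in>T'. t < x}" using assms(4) by auto
  then have "card {t\<in>T \<union> T'. t < x} = card T + card {t\<in>T'. t < x}"
    using assms by (subst card_Un_disjoint[symmetric]) auto
  then show ?thesis by (simp add: stepf_def power_add)
qed

lemma stepf_empty [simp]: "stepf \<tau> {} x = \<tau>"
  by (simp add: stepf_def)

lemma sign_power: "\<tau> \<in> {-1, 1} \<Longrightarrow> \<tau> * (-1) ^ k \<in> {-1, 1 :: real}"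
  by (cases "even k") auto

text \<open>Every point has a neighbourhood on each side where u is a single phase almost
  everywhere, and bisection (\<open>Bolzano\<close>) joins these into the whole interval.
  \<open>I c e\<close> is cut with the open interval because bisection also asks about intervals
  that reach beyond its ends.\<close>

lemma finite_step_structure:
  fixes u v :: "real \<Rightarrow> real"
  assumes ab: "a < b" and fin: "pvar {a<..<b} v < \<infinity>" and N: "negligible N"
    and good: "\<And>y. y \<in> {a<..<b} - N \<Longrightarrow> v y = u y \<and> u y \<in> {-1,1}"
  shows "\<exists>T \<tau>. finite T \<and> T \<subseteq> {a<..<b} \<and> \<tau> \<in> {-1,1} \<and> negligible {y\<in>{a<..<b}. u y \<noteq> stepf \<tau> T y}"
proof -
  define I where "I c e = {c<..<e} \<inter> {a<..<b}" for c e
  define P where "P c e \<longleftrightarrow> (\<exists>T \<tau>. finite T \<and> T \<subseteq> I c e \<and> \<tau> \<in> {-1,1} \<and> negligible {y\<in>I c e. u y \<noteq> stepf \<tau> T y})" for c e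
  have P0: "P c e" if "\<sigma> \<in> {-1,1}" "negligible {y\<in>I c e. u y \<noteq> \<sigma>}" for c e \<sigma>
    unfolding P_def using that by (intro exI[of _ "{}"] exI[of _ \<sigma>]) auto
  have join: "P c g" if 1: "P c e" and 2: "P e g" and ceg: "c \<le> e" "e \<le> g" for c e g
  proof (cases "e \<in> I c g")
    case False
    then have "I c g = I c e \<or> I c g = I e g"
    proof -
      consider "e \<le> c \<or> e \<le> a" | "g \<le> e \<or> b \<le> e" using False by (auto simp: I_def not_less)
      then show ?thesis
      proof cases
        case 1
        then have "I c g = I e g" using ceg by (auto simp: I_def)
        then show ?thesis ..
      next
        case 2
        then have "I c g = I c e" using ceg by (auto simp: I_def)
        then show ?thesis ..
      qed
    qed
    then show ?thesis
    proof
      assume eq: "I c g = I c e"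
      show ?thesis using 1 unfolding P_def eq .
    next
      assume eq: "I c g = I e g"
      show ?thesis using 2 unfolding P_def eq .
    qed
  next
    case True
    obtain T1 \<tau>1 where T1: "finite T1" "T1 \<subseteq> I c e" "\<tau>1 \<in> {-1,1}" "negligible {y\<in>I c e. u y \<noteq> stepf \<tau>1 T1 y}"
      using 1 by (auto simp: P_def)
    obtain T2 \<tau>2 where T2: "finite T2" "T2 \<subseteq> I e g" "\<tau>2 \<in> {-1,1}" "negligible {y\<in>I e g. u y \<noteq> stepf \<tau>2 T2 y}"
      using 2 by (auto simp: P_def)
    \<comment> \<open>The meeting point becomes a jump only if the phases on its two sides differ,
      so in both cases the sign after it is \<open>\<tau>2\<close>.\<close>
    define E where "E = (if \<tau>1 * (-1) ^ card T1 = \<tau>2 then {} else {e})"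
    have E: "finite E" "E \<subseteq> {e}" by (auto simp: E_def)
    have m1: "c < t \<and> t < e \<and> a < t \<and> t < b" if "t \<in> T1" for t using subsetD[OF T1(2) that] by (simp add: I_def)
    have m2: "e < t \<and> t < g \<and> a < t \<and> t < b" if "t \<in> T2" for t using subsetD[OF T2(2) that] by (simp add: I_def)
    have dis: "T1 \<inter> E = {}" "(T1 \<union> E) \<inter> T2 = {}" using m1 m2 E(2) by force+
    have "\<tau>1 * (-1) ^ card (T1 \<union> E) = \<tau>2"
    proof -
      have "card (T1 \<union> E) = card T1 + card E" using T1(1) E(1) dis(1) by (rule card_Un_disjoint)
      moreover have "\<tau>1 * (-1) ^ card T1 \<in> {-1,1}" using T1(3) by (rule sign_power)
      ultimately show ?thesis using T2(3) by (auto simp: E_def power_add)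
    qed
    then have R: "stepf \<tau>1 ((T1 \<union> E) \<union> T2) y = stepf \<tau>2 T2 y" if "e < y" for y
      using stepf_right[of "T1 \<union> E" T2 y \<tau>1] T1(1) T2(1) E dis(2) m1 that by force
    have L: "stepf \<tau>1 ((T1 \<union> E) \<union> T2) y = stepf \<tau>1 T1 y" if "y < e" for y
      using stepf_left[of "E \<union> T2" y \<tau>1 T1] m2 E(2) that by (force simp: Un_assoc)
    show ?thesis unfolding P_def
    proof (intro exI conjI)
      show "finite (T1 \<union> E \<union> T2)" using T1 T2 E by auto
      show "T1 \<union> E \<union> T2 \<subseteq> I c g" 
      proof
        fix t assume "t \<in> T1 \<union> E \<union> T2"
        then consider "t \<in> T1" | "t = e" | "t \<in> T2" using E(2) by blast
        then show "t \<in> I c g" using m1[of t] m2[of t] True ceg by cases (auto simp: I_def)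
      qed
      show "\<tau>1 \<in> {-1,1}" by (rule T1)
      have "negligible ({y\<in>I c e. u y \<noteq> stepf \<tau>1 T1 y} \<union> ({y\<in>I e g. u y \<noteq> stepf \<tau>2 T2 y} \<union> {e}))"
        using T1(4) T2(4) by (intro negligible_Un) auto
      then show "negligible {y\<in>I c g. u y \<noteq> stepf \<tau>1 (T1 \<union> E \<union> T2) y}"
      proof (rule negligible_subset, intro subsetI)
        fix y assume y: "y \<in> {y\<in>I c g. u y \<noteq> stepf \<tau>1 (T1 \<union> E \<union> T2) y}"
        consider "y < e" | "y = e" | "e < y" by linarith
        then show "y \<in> {y\<in>I c e. u y \<noteq> stepf \<tau>1 T1 y} \<union> ({y\<in>I e g. u y \<noteq> stepf \<tau>2 T2 y} \<union> {e})"
          using y L[of y] R[of y] by cases (auto simp: I_def)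
      qed
    qed
  qed
  have "P a b"
  proof (rule Bolzano[of a b P])
    show "a \<le> b" using ab by simp
    fix x assume x: "a \<le> x" "x \<le> b"
    have "\<exists>\<delta>>0. \<exists>\<sigma>\<in>{-1,1}. negligible {y\<in>I x (x+\<delta>). u y \<noteq> \<sigma>}"
    proof (cases "x < b")
      case True
      then show ?thesis using one_sided_constant(1)[OF fin N good, of x] x unfolding I_def by auto
    next
      case False
      then have "I x (x+1) = {}" by (auto simp: I_def)
      then show ?thesis by (intro exI[of _ 1] conjI bexI[of _ 1]) auto
    qed
    then obtain d1 \<sigma>1 where 1: "d1 > 0" "\<sigma>1 \<in> {-1,1}" "negligible {y\<in>I x (x+d1). u y \<noteq> \<sigma>1}" by blast
    have "\<exists>\<delta>>0. \<exists>\<sigma>\<in>{-1,1}. negligible {y\<in>I (x-\<delta>) x. u y \<noteq> \<sigma>}"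
    proof (cases "a < x")
      case True
      then show ?thesis using one_sided_constant(2)[OF fin N good, of x] x unfolding I_def by auto
    next
      case False
      then have "I (x-1) x = {}" by (auto simp: I_def)
      then show ?thesis by (intro exI[of _ 1] conjI bexI[of _ 1]) auto
    qed
    then obtain d2 \<sigma>2 where 2: "d2 > 0" "\<sigma>2 \<in> {-1,1}" "negligible {y\<in>I (x-d2) x. u y \<noteq> \<sigma>2}" by blast
    show "\<exists>d>0. \<forall>c e. c \<le> x \<and> x \<le> e \<and> e - c < d \<longrightarrow> P c e"
    proof (intro exI[of _ "min d1 d2"] conjI allI impI)
      show "min d1 d2 > 0" using 1 2 by simp
      fix c e assume ce: "c \<le> x \<and> x \<le> e \<and> e - c < min d1 d2"
      have "P c x"
        by (rule P0[OF 2(2)], rule negligible_subset[OF 2(3)]) (use ce in \<open>auto simp: I_def\<close>)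
      moreover have "P x e"
        by (rule P0[OF 1(2)], rule negligible_subset[OF 1(3)]) (use ce in \<open>auto simp: I_def\<close>)
      ultimately show "P c e" using join ce by blast
    qed
  qed (use join in blast)
  moreover have "I a b = {a<..<b}" by (auto simp: I_def)
  ultimately show ?thesis by (simp add: P_def)
qed

text \<open>One point is picked in each interval of constancy, off the null set where
  \<open>v\<close> differs from the step function. The value at the last point is part of the claim
  because the next jump is measured from it.\<close>

lemma step_variation:
  assumes "finite T" "a < d" "T \<subseteq> {a<..<d}" "\<tau> \<in> {-1,1}" "negligible {y\<in>{a<..<d}. v y \<noteq> stepf \<tau> T y}"
  shows "\<exists>n x. (\<forall>i<n. x i < x (Suc i)) \<and> (\<forall>i\<le>n. x i \<in> {a<..<d}) \<and>
     2 * real (card T) \<le> (\<Sum>i<n. \<bar>v (x (Suc i)) - v (x i)\<bar>) \<and> v (x n) = \<tau> * (-1) ^ card T"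
  using assms
proof (induction T arbitrary: d rule: finite_linorder_max_induct)
  case empty
  have "\<not> negligible {a<..<d}" using empty.prems(1) negligible_interval(2)[of a d] by simp
  then have "\<not> {a<..<d} \<subseteq> {y\<in>{a<..<d}. v y \<noteq> stepf \<tau> {} y}" using empty.prems(4) negligible_subset by blast
  then obtain y where "y \<in> {a<..<d}" "v y = \<tau>" unfolding stepf_empty by blast
  then show ?case by (intro exI[of _ 0] exI[of _ "\<lambda>_. y"]) auto
next
  case (insert t T)
  have t: "a < t" "t < d" "t \<notin> T" using insert.prems insert.hyps by auto
  have neg: "negligible {y\<in>{a<..<t}. v y \<noteq> stepf \<tau> T y}"
  proof (rule negligible_subset[OF insert.prems(4)], intro subsetI)
    fix y assume "y \<in> {y\<in>{a<..<t}. v y \<noteq> stepf \<tau> T y}"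
    then show "y \<in> {y\<in>{a<..<d}. v y \<noteq> stepf \<tau> (insert t T) y}"
      using stepf_left[of "{t}" y \<tau> T] t by auto
  qed
  have "T \<subseteq> {a<..<t}" using insert.prems insert.hyps by auto
  from insert.IH[OF t(1) this insert.prems(3) neg]
  obtain n x where x: "\<forall>i<n. x i < x (Suc i)" "\<forall>i\<le>n. x i \<in> {a<..<t}"
     "2 * real (card T) \<le> (\<Sum>i<n. \<bar>v (x (Suc i)) - v (x i)\<bar>)" "v (x n) = \<tau> * (-1) ^ card T"
    by blast
  have "\<not> negligible {t<..<d}" using t negligible_interval(2)[of t d] by simp
  then have "\<not> {t<..<d} \<subseteq> {y\<in>{a<..<d}. v y \<noteq> stepf \<tau> (insert t T) y}" using insert.prems(4) negligible_subset by blast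
  then obtain y where y: "y \<in> {t<..<d}" "v y = stepf \<tau> (insert t T) y" using greaterThanLessThan_subseteq_greaterThanLessThan[of t d a d] t by fastforce
  have c: "card (insert t T) = Suc (card T)" using insert.hyps t by simp
  have "{s\<in>insert t T. s < y} = insert t T" using y insert.hyps by auto
  then have vy: "v y = \<tau> * (-1) ^ card (insert t T)" using y(2) by (simp add: stepf_def)
  define z where "z i = (if i \<le> n then x i else y)" for i
  have "(\<Sum>i<n. \<bar>v (z (Suc i)) - v (z i)\<bar>) = (\<Sum>i<n. \<bar>v (x (Suc i)) - v (x i)\<bar>)"
    by (rule sum.cong) (auto simp: z_def)
  moreover have "\<bar>v y - v (x n)\<bar> = 2" using vy x(4) c sign_power[OF insert.prems(3), of "card T"] by auto
  ultimately have s: "2 * real (card (insert t T)) \<le> (\<Sum>i<Suc n. \<bar>v (z (Suc i)) - v (z i)\<bar>)"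
    using x(3) c by (simp add: z_def)
  have m: "z i < z (Suc i)" if "i < Suc n" for i
    using x(1,2) y(1) that by (cases "i < n") (auto simp: z_def less_Suc_eq)
  have r: "z i \<in> {a<..<d}" if "i \<le> Suc n" for i
    using x(2) y(1) t by (fastforce simp: z_def)
  have "v (z (Suc n)) = \<tau> * (-1) ^ card (insert t T)" using vy by (simp add: z_def)
  then show ?case using s m r by blast
qed

lemma essVar_step_ge:
  assumes "finite T" "a < b" "T \<subseteq> {a<..<b}" "\<tau> \<in> {-1,1}" and n: "negligible {y\<in>{a<..<b}. u y \<noteq> stepf \<tau> T y}"
  shows "ereal (2 * real (card T)) \<le> essVar {a<..<b} u"
  unfolding essVar_def
proof (rule INF_greatest, clarify)
  fix v assume "AE x in lebesgue. x \<in> {a<..<b} \<longrightarrow> v x = u x"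
  then obtain N where N: "negligible N" "{x. \<not> (x \<in> {a<..<b} \<longrightarrow> v x = u x)} \<subseteq> N"
    unfolding eventually_ae_filter_negligible by blast
  have "negligible ({y\<in>{a<..<b}. u y \<noteq> stepf \<tau> T y} \<union> N)" by (rule negligible_Un[OF n N(1)])
  then have "negligible {y\<in>{a<..<b}. v y \<noteq> stepf \<tau> T y}"
    by (rule negligible_subset) (use N(2) in auto)
  from step_variation[OF assms(1-4) this] have "var_ge v {a<..<b} (2 * real (card T))"
    unfolding var_ge_def by blast
  then show "ereal (2 * real (card T)) \<le> pvar {a<..<b} v" by (rule var_ge_pvar)
qed

text \<open>The last inequality is the direction that the upper bound needs: \<open>card T\<close>
  transitions at cost 2\<alpha> each stay below \<alpha> times the essential variation.\<close>

lemma BPV_step: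
  assumes B: "BPV p a b u" and ab: "a < b"
  shows "\<exists>T \<tau>. finite T \<and> T \<subseteq> {a<..<b} \<and> \<tau> \<in> {-1,1} \<and> negligible {y\<in>{a<..<b}. u y \<noteq> stepf \<tau> T y} \<and>
    ereal (2 * real (card T)) \<le> essVar {a<..<b} u"
proof -
  obtain v where v: "AE x in lebesgue. x \<in> {a<..<b} \<longrightarrow> v x = u x" "pvar {a<..<b} v < \<infinity>"
    using B unfolding BPV_def essVar_def INF_less_iff by blast
  have "AE x in lebesgue. x \<in> {a<..<b} \<longrightarrow> v x = u x \<and> u x \<in> {-1,1}"
    using v(1) B unfolding BPV_def by (auto elim: eventually_elim2)
  then obtain N where N: "negligible N" "{x. \<not> (x \<in> {a<..<b} \<longrightarrow> v x = u x \<and> u x \<in> {-1,1})} \<subseteq> N"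
    unfolding eventually_ae_filter_negligible by blast
  obtain T \<tau> where "finite T" "T \<subseteq> {a<..<b}" "\<tau> \<in> {-1,1}" "negligible {y\<in>{a<..<b}. u y \<noteq> stepf \<tau> T y}"
    using finite_step_structure[OF ab v(2) N(1), of u] N(2) by blast
  then show ?thesis using essVar_step_ge[of T a b \<tau> u] ab by blast
qed

section \<open>The upper bound\<close>

text \<open>Induction on the last jump: the function for the smaller set on [a, t] is followed by
  one stretched profile on [t, t + L] and a constant. The data at the right end belong to the claim
  because the next profile is glued there. Stretching by \<open>L\<close> turns scale
  \<open>e0\<close> into \<open>e0 * L\<close> and keeps the energy.\<close>

lemma recovery:
  assumes P: "profile p Uw Vw Gw" and p: "1 \<le> p" and e0: "e0 > 0" and L: "L > 0"
    and C: "1 \<le> C" "\<And>x. x \<in> {0..1} \<Longrightarrow> \<bar>Uw x\<bar> \<le> C" and \<tau>: "\<tau> \<in> {-1,1}"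
    and "finite T" "\<And>t. t \<in> T \<Longrightarrow> a < t \<and> t + L \<le> b" "\<And>s t. s \<in> T \<Longrightarrow> t \<in> T \<Longrightarrow> s < t \<Longrightarrow> s + L \<le> t" "a < b"
  shows "\<exists>U V G. H2 p a b U V G \<and> U b = \<tau> * (-1) ^ card T \<and> V b = 0 \<and> (\<forall>x\<in>{a..b}. \<bar>U x\<bar> \<le> C) \<and>
    (\<forall>x\<in>{a..b}. (\<forall>t\<in>T. x \<le> t \<or> t + L \<le> x) \<longrightarrow> U x = stepf \<tau> T x) \<and>
    energy (e0 * L) a b U G \<le> real (card T) * energy e0 0 1 Uw Gw"
  using assms(8-)
proof (induction T arbitrary: b rule: finite_linorder_max_induct)
  case empty
  have "energy (e0 * L) a b (\<lambda>x. \<tau>) (\<lambda>x. 0) = 0" using \<tau> by (auto simp: energy_def)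
  then show ?case
    by (intro exI[of _ "\<lambda>x. \<tau>"] exI[of _ "\<lambda>x. 0"]) (use \<tau> C(1) p in \<open>auto intro: H2_const\<close>)
next
  case (insert t T)
  have e: "e0 * L > 0" using e0 L by simp
  have t: "a < t" "t + L \<le> b" "t \<notin> T" using insert.prems insert.hyps by auto
  have 1: "a < s \<and> s + L \<le> t" if "s \<in> T" for s using that insert.prems insert.hyps by auto
  have 2: "r + L \<le> s" if "r \<in> T" "s \<in> T" "r < s" for r s using that insert.prems by auto
  from insert.IH[OF 1 2 t(1)] obtain U1 V1 G1 where U1:
    "H2 p a t U1 V1 G1" "U1 t = \<tau> * (-1) ^ card T" "V1 t = 0" "\<forall>x\<in>{a..t}. \<bar>U1 x\<bar> \<le> C"
    "\<forall>x\<in>{a..t}. (\<forall>s\<in>T. x \<le> s \<or> s + L \<le> x) \<longrightarrow> U1 x = stepf \<tau> T x"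
    "energy (e0 * L) a t U1 G1 \<le> real (card T) * energy e0 0 1 Uw Gw"
    by blast
  have c: "card (insert t T) = Suc (card T)" using insert.hyps t by simp
  define \<rho> where "\<rho> = \<tau> * (-1) ^ card T"
  have \<rho>: "\<rho> \<in> {-1,1}" unfolding \<rho>_def by (rule sign_power[OF \<tau>])
  define m k where "m = 1/L" and "k = - t/L"
  have m: "m > 0" "m * t + k = 0" "m * (t+L) + k = 1" using L by (auto simp: m_def k_def field_simps)
  have H: "H2 p 0 1 Uw Vw Gw" and bd: "Uw 0 = -1" "Uw 1 = 1" "Vw 0 = 0" "Vw 1 = 0" using P by (auto simp: profile_def)
  \<comment> \<open>The profile rises from -1 to 1, so the factor \<open>- \<rho>\<close> makes it
    run from \<open>\<rho>\<close> to \<open>- \<rho>\<close>.\<close>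
  define U2 V2 G2 where "U2 x = - \<rho> * Uw (m*x+k)" and "V2 x = - \<rho> * (m * Vw (m*x+k))" and "G2 x = - \<rho> * (m\<^sup>2 * Gw (m*x+k))" for x
  have A: "H2 p t (t+L) (\<lambda>x. Uw (m*x+k)) (\<lambda>x. m * Vw (m*x+k)) (\<lambda>x. m\<^sup>2 * Gw (m*x+k))"
    by (rule H2_affine[OF H m(1)]) (use m in auto)
  have eA: "energy (e0 * L) t (t+L) (\<lambda>x. Uw (m*x+k)) (\<lambda>x. m\<^sup>2 * Gw (m*x+k)) = energy e0 0 1 Uw Gw"
    using energy_affine[OF H m(1), of t k "t+L" e0] m e0 by (simp add: m_def)
  have H2: "H2 p t (t+L) U2 V2 G2" and E2: "energy (e0 * L) t (t+L) U2 G2 = energy e0 0 1 Uw Gw"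
    using \<rho> A H2_uminus[OF A] eA unfolding U2_def V2_def G2_def by auto
  have bd2: "U2 t = \<rho>" "V2 t = 0" "U2 (t+L) = - \<rho>" "V2 (t+L) = 0"
    using bd m by (auto simp: U2_def V2_def)
  have H3: "H2 p (t+L) b (\<lambda>x. - \<rho>) (\<lambda>x. 0) (\<lambda>x. 0)" by (rule H2_const[OF p])
  have E3: "energy (e0 * L) (t+L) b (\<lambda>x. - \<rho>) (\<lambda>x. 0) = 0" using \<rho> by (auto simp: energy_def)
  have t1: "a \<le> t" "t \<le> t + L" "a \<le> t + L" using t L by auto
  note X = H2_concat[OF U1(1) H2 _ _ t1(1,2)]
  note Y = H2_concat[OF X(1) H3 _ _ t1(3) t(2)]
  define U where "U x = (if x \<le> t+L then if x \<le> t then U1 x else U2 x else - \<rho>)" for x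
  define V where "V x = (if x \<le> t+L then if x \<le> t then V1 x else V2 x else 0)" for x
  define G where "G x = (if x \<le> t+L then if x \<le> t then G1 x else G2 x else 0)" for x
  have j: "U1 t = U2 t" "V1 t = V2 t" using U1(2,3) bd2 by (auto simp: \<rho>_def)
  have jj: "(if t + L \<le> t then U1 (t+L) else U2 (t+L)) = - \<rho>" "(if t + L \<le> t then V1 (t+L) else V2 (t+L)) = 0"
    using L bd2 by auto
  have HU: "H2 p a b U V G"
    unfolding U_def V_def G_def by (rule Y(1)[OF j jj])
  have "energy (e0 * L) a b U G = energy (e0 * L) a (t+L) (\<lambda>x. if x \<le> t then U1 x else U2 x) (\<lambda>x. if x \<le> t then G1 x else G2 x)
     + energy (e0 * L) (t+L) b (\<lambda>x. - \<rho>) (\<lambda>x. 0)"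
    unfolding U_def G_def by (rule Y(2)[OF j jj])
  also have "energy (e0 * L) a (t+L) (\<lambda>x. if x \<le> t then U1 x else U2 x) (\<lambda>x. if x \<le> t then G1 x else G2 x)
    = energy (e0 * L) a t U1 G1 + energy (e0 * L) t (t+L) U2 G2"
    by (rule X(2)[OF j])
  finally have EU: "energy (e0 * L) a b U G \<le> real (card (insert t T)) * energy e0 0 1 Uw Gw"
    using U1(6) E2 E3 c by (simp add: algebra_simps)
  have Ub: "U b = - \<rho>" "V b = 0" using bd2 t(2) L by (cases "b = t + L"; auto simp: U_def V_def)+
  have UC: "\<bar>U x\<bar> \<le> C" if x: "x \<in> {a..b}" for x
  proof -
    consider "x \<le> t" | "t < x" "x \<le> t+L" | "t+L < x" by linarith
    then show ?thesis
    proof cases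
      case 2
      have "m*x+k = (x-t)/L" by (simp add: m_def k_def diff_divide_distrib)
      then have "m*x+k \<in> {0..1}" using 2 L by simp
      then show ?thesis using 2 C(2)[of "m*x+k"] \<rho> by (auto simp: U_def U2_def)
    qed (use U1(4) x C(1) \<rho> L in \<open>auto simp: U_def\<close>)
  qed
  have US: "U x = stepf \<tau> (insert t T) x" if x: "x \<in> {a..b}" "\<forall>s\<in>insert t T. x \<le> s \<or> s + L \<le> x" for x
  proof (cases "x \<le> t")
    case True
    then have "U x = stepf \<tau> T x" using U1(5) x L by (simp add: U_def)
    then show ?thesis using stepf_left[of "{t}" x \<tau> T] True by simp
  next
    case False
    then have tx: "t + L \<le> x" using x(2) by auto
    have "{s\<in>insert t T. s < x} = insert t T" using False insert.hyps by auto
    then have "stepf \<tau> (insert t T) x = - \<rho>" using c by (simp add: stepf_def \<rho>_def)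
    moreover have "U x = - \<rho>" using tx bd2 L by (cases "x = t + L") (auto simp: U_def)
    ultimately show ?thesis by simp
  qed
  show ?case
    using HU EU Ub UC US c \<rho>_def by (intro exI[of _ U] exI[of _ V] exI[of _ G]) auto
qed

lemma finite_min_gap:
  fixes T :: "real set"
  assumes "finite T" "T \<subseteq> {a<..<b}"
  shows "\<exists>g>0. \<forall>L. L \<le> g \<longrightarrow> (\<forall>t\<in>T. t + L \<le> b) \<and> (\<forall>s\<in>T. \<forall>t\<in>T. s < t \<longrightarrow> s + L \<le> t)"
proof -
  \<comment> \<open>The element 1 keeps the set nonempty when there is no jump.\<close>
  define S where "S = insert 1 ((\<lambda>t. b - t) ` T \<union> (\<lambda>(s,t). t - s) ` {z \<in> T \<times> T. fst z < snd z})"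
  have fS: "finite S" "S \<noteq> {}" using assms(1) by (auto simp: S_def)
  have "Min S \<in> S" by (rule Min_in[OF fS])
  moreover have "\<forall>x\<in>S. x > 0" using assms(2) by (auto simp: S_def)
  ultimately have pos: "Min S > 0" by blast
  have le: "Min S \<le> x" if "x \<in> S" for x by (rule Min_le[OF fS(1) that])
  have 1: "Min S \<le> b - t" if "t \<in> T" for t by (rule le) (use that in \<open>auto simp: S_def\<close>)
  have 2: "Min S \<le> t - s" if "s \<in> T" "t \<in> T" "s < t" for s t
    by (rule le) (use that in \<open>auto simp: S_def intro!: rev_image_eqI[of "(s,t)"]\<close>)
  show ?thesis
    by (intro exI[of _ "Min S"] conjI allI impI ballI pos) (use 1 2 in \<open>fastforce\<close>)+
qed

text \<open>A profile that is nearly optimal at its own scale \<open>e0\<close> has scale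
  \<epsilon>_n after stretching to length \<epsilon>_n / e0. The resulting function differs from u,
  up to a null set, only on \<open>card T\<close> intervals of that length, and there by at most C +
  1.\<close>

lemma recovery_eventually:
  assumes ab: "a < b" and p: "1 \<le> p" and eps: "\<And>n. eps n > 0" "eps \<longlonglongrightarrow> 0"
    and B: "BPV p a b u" and \<delta>: "\<delta> > 0"
  shows "\<forall>\<^sub>F n in sequentially. \<exists>U. Lp_fun p a b U \<and>
    (\<integral>\<^sup>+x\<in>{a<..<b}. ennreal (\<bar>U x - u x\<bar> powr p) \<partial>lebesgue) \<le> ennreal \<delta> \<and>
    F_eps p a b (eps n) U \<le> F_lim p a b u + ereal \<delta>"
proof -
  obtain T \<tau> where T: "finite T" "T \<subseteq> {a<..<b}" "\<tau> \<in> {-1,1}" "negligible {y\<in>{a<..<b}. u y \<noteq> stepf \<tau> T y}"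
    "ereal (2 * real (card T)) \<le> essVar {a<..<b} u"
    using BPV_step[OF B ab] by blast
  obtain c where c: "c > 0" "alpha p = ereal (c/2)"
    "\<forall>\<delta>>0. \<exists>U V G e. profile p U V G \<and> e > 0 \<and> energy e 0 1 U G < c + \<delta>"
    using alpha_properties[OF p] by blast
  define k where "k = card T"
  \<comment> \<open>The tolerance is shared among the k transitions; k + 1 covers the case of no
    jump.\<close>
  have "\<delta> / (real k + 1) > 0" using \<delta> by (simp add: add_nonneg_pos)
  then obtain Uw Vw Gw e0 where w: "profile p Uw Vw Gw" "e0 > 0" "energy e0 0 1 Uw Gw < c + \<delta> / (real k + 1)"
    using c(3) by blast
  have Flim: "ereal (c * real k) \<le> F_lim p a b u"
  proof -
    have "ereal (c/2) * ereal (2 * real k) \<le> ereal (c/2) * essVar {a<..<b} u"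
      using T(5) c(1) unfolding k_def by (intro ereal_mult_left_mono) auto
    then show ?thesis using B c(2) by (simp add: F_lim_def)
  qed
  have "real k * (c + \<delta> / (real k + 1)) \<le> c * real k + \<delta>"
  proof -
    have "real k * (\<delta> / (real k + 1)) \<le> \<delta>" using \<delta> by (simp add: field_simps add_nonneg_pos)
    then show ?thesis by (simp add: algebra_simps)
  qed
  moreover have "real k * energy e0 0 1 Uw Gw \<le> real k * (c + \<delta> / (real k + 1))"
    using w(3) by (intro mult_left_mono) auto
  ultimately have en: "real k * energy e0 0 1 Uw Gw \<le> c * real k + \<delta>" by linarith
  have "continuous_on {0..1} Uw" using w(1) primitive_on_continuous by (auto simp: profile_def H2_def)
  then obtain C where C: "1 \<le> C" "\<And>x. x \<in> {0..1} \<Longrightarrow> \<bar>Uw x\<bar> \<le> C"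
    using continuous_on_Icc_bound by blast
  obtain g where g: "g > 0" "\<And>L. L \<le> g \<Longrightarrow> (\<forall>t\<in>T. t + L \<le> b) \<and> (\<forall>s\<in>T. \<forall>t\<in>T. s < t \<longrightarrow> s + L \<le> t)"
    using finite_min_gap[OF T(1,2)] by blast
  have lim: "(\<lambda>n. eps n / e0) \<longlonglongrightarrow> 0" using tendsto_divide[OF eps(2) tendsto_const, of e0] w(2) by simp
  have lim2: "(\<lambda>n. (C+1) powr p * real k * (eps n / e0)) \<longlonglongrightarrow> (C+1) powr p * real k * 0"
    by (intro tendsto_intros lim)
  have "\<forall>\<^sub>F n in sequentially. eps n / e0 < g" by (rule order_tendstoD(2)[OF lim g(1)])
  moreover have "\<forall>\<^sub>F n in sequentially. (C+1) powr p * real k * (eps n / e0) < \<delta>"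
    by (rule order_tendstoD(2)[OF lim2]) (use \<delta> in simp)
  ultimately show ?thesis
  proof eventually_elim
    case (elim n)
    define L where "L = eps n / e0"
    have L: "L > 0" "e0 * L = eps n" using eps(1)[of n] w(2) by (auto simp: L_def)
    have 1: "a < t \<and> t + L \<le> b" if "t \<in> T" for t using g(2)[of L] elim(1) that T(2) unfolding L_def by auto
    have 2: "s + L \<le> t" if "s \<in> T" "t \<in> T" "s < t" for s t using g(2)[of L] elim(1) that unfolding L_def by auto
    obtain U V G where U: "H2 p a b U V G" "\<forall>x\<in>{a..b}. \<bar>U x\<bar> \<le> C"
      "\<forall>x\<in>{a..b}. (\<forall>t\<in>T. x \<le> t \<or> t + L \<le> x) \<longrightarrow> U x = stepf \<tau> T x"
      "energy (e0 * L) a b U G \<le> real (card T) * energy e0 0 1 Uw Gw"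
      using recovery[OF w(1) p w(2) L(1) C T(3) T(1) 1 2 ab] by blast
    have "F_eps p a b (eps n) U = ereal (energy (eps n) a b U G)" by (rule F_eps_H2[OF U(1) p ab eps(1)])
    also have "\<dots> \<le> ereal (c * real k) + ereal \<delta>" using U(4) L(2) en by (simp add: k_def)
    also have "\<dots> \<le> F_lim p a b u + ereal \<delta>" by (rule add_right_mono[OF Flim])
    finally have F: "F_eps p a b (eps n) U \<le> F_lim p a b u + ereal \<delta>" .
    have "continuous_on {a..b} U" using U(1) primitive_on_continuous by (auto simp: H2_def)
    then have Lp: "Lp_fun p a b U" by (rule Lp_fun_continuous[OF _ p])
    have pt: "ennreal (\<bar>U x - u x\<bar> powr p) * indicator {a<..<b} x \<le> (\<Sum>t\<in>T. ennreal ((C+1) powr p) * indicator {t..t+L} x)"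
      if x: "x \<notin> {y\<in>{a<..<b}. u y \<noteq> stepf \<tau> T y}" for x
    proof (cases "x \<in> {a<..<b} \<and> (\<exists>t\<in>T. t < x \<and> x < t + L)")
      case True
      then obtain t where t: "t \<in> T" "t < x" "x < t + L" by blast
      have "\<bar>u x\<bar> = 1" using x True T(3) by (auto simp: stepf_def abs_mult power_abs)
      then have "\<bar>U x - u x\<bar> \<le> C + 1" using U(2)[rule_format, of x] True by auto
      then have "ennreal (\<bar>U x - u x\<bar> powr p) \<le> ennreal ((C+1) powr p)"
        using p by (intro ennreal_leI powr_mono2) auto
      then have "ennreal (\<bar>U x - u x\<bar> powr p) * indicator {a<..<b} x \<le> ennreal ((C+1) powr p) * indicator {t..t+L} x"
        using t True by simp
      also have "\<dots> \<le> (\<Sum>t\<in>T. ennreal ((C+1) powr p) * indicator {t..t+L} x)"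
        by (rule member_le_sum[OF t(1) _ T(1)]) simp
      finally show ?thesis .
    next
      case False
      show ?thesis
      proof (cases "x \<in> {a<..<b}")
        case True
        then have out: "x \<le> t \<or> t + L \<le> x" if "t \<in> T" for t
          using False that not_less by blast
        have "x \<in> {a..b}" using True by simp
        then have "U x = stepf \<tau> T x" using U(3) out by blast
        moreover have "u x = stepf \<tau> T x" using x True by blast
        ultimately show ?thesis by simp
      qed simp
    qed
    define K where "K = ennreal ((C+1) powr p)"
    have "(\<integral>\<^sup>+x\<in>{a<..<b}. ennreal (\<bar>U x - u x\<bar> powr p) \<partial>lebesgue) \<le> (\<integral>\<^sup>+x. (\<Sum>t\<in>T. K * indicator {t..t+L} x) \<partial>lebesgue)"
    proof (rule nn_integral_mono_AE)
      show "AE x in lebesgue. ennreal (\<bar>U x - u x\<bar> powr p) * indicator {a<..<b} x \<le> (\<Sum>t\<in>T. K * indicator {t..t+L} x)"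
        unfolding eventually_ae_filter_negligible K_def using T(4) pt by blast
    qed
    also have "\<dots> = (\<Sum>t\<in>T. (\<integral>\<^sup>+x. K * indicator {t..t+L} x \<partial>lebesgue))"
    proof (rule nn_integral_sum)
      fix t
      have "{t..t+L} \<in> sets lebesgue" by simp
      from borel_measurable_times_ennreal[OF borel_measurable_const borel_measurable_indicator[OF this]]
      show "(\<lambda>x. K * indicator {t..t+L} x) \<in> borel_measurable lebesgue" .
    qed
    also have "\<dots> = (\<Sum>t\<in>T. K * ennreal L)"
      using L(1) by (simp add: nn_integral_cmult_indicator)
    also have "\<dots> = (\<Sum>t\<in>T. ennreal ((C+1) powr p * L))"
      using L(1) unfolding K_def by (simp only: ennreal_mult' powr_ge_zero)
    also have "\<dots> = ennreal (\<Sum>t\<in>T. (C+1) powr p * L)"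
      by (rule sum_ennreal) (use L(1) in simp)
    also have "(\<Sum>t\<in>T. (C+1) powr p * L) = (C+1) powr p * real k * L" by (simp add: k_def)
    also have "ennreal ((C+1) powr p * real k * L) \<le> ennreal \<delta>" using elim(2) by (intro ennreal_leI) (simp add: L_def)
    finally show ?case using Lp F by blast
  qed
qed

text \<open>Index n uses the finest tolerance 1/(j + 1) with j \<le> n that can be met; the bound on
  j makes the maximum exist. A given tolerance can eventually be met, and from then on the chosen
  one is at least as fine.\<close>

lemma diagonal_sequence:
  assumes ev: "\<And>\<delta>::real. \<delta> > 0 \<Longrightarrow> \<forall>\<^sub>F n in sequentially. \<exists>U. P n \<delta> U"
    and mono: "\<And>n \<delta> \<delta>' U. P n \<delta> U \<Longrightarrow> \<delta> \<le> \<delta>' \<Longrightarrow> P n \<delta>' U"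
  shows "\<exists>us. (\<forall>\<delta>>0. \<forall>\<^sub>F n in sequentially. P n \<delta> (us n)) \<and> (\<forall>n. us n = u0 \<or> (\<exists>\<delta>. P n \<delta> (us n)))"
proof -
  define J where "J n = {j. j \<le> n \<and> (\<exists>U. P n (1 / real (Suc j)) U)}" for n
  have fJ: "finite (J n)" for n by (simp add: J_def)
  \<comment> \<open>\<open>u0\<close> fills the indices at which no tolerance can be met yet; the
    last conjunct of the claim lets every term be checked for admissibility.\<close>
  define us where "us n = (if J n = {} then u0 else SOME U. P n (1 / real (Suc (Max (J n)))) U)" for n
  have us: "P n (1 / real (Suc (Max (J n)))) (us n)" if "J n \<noteq> {}" for n
  proof -
    have "\<exists>U. P n (1 / real (Suc (Max (J n)))) U" using Max_in[OF fJ that] by (auto simp: J_def)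
    then show ?thesis using that by (simp add: us_def someI_ex)
  qed
  have "\<forall>\<^sub>F n in sequentially. P n \<delta> (us n)" if \<delta>: "\<delta> > 0" for \<delta>
  proof -
    obtain j where j: "inverse (real (Suc j)) < \<delta>" using reals_Archimedean[OF \<delta>] by blast
    have "1 / real (Suc j) > 0" by simp
    from ev[OF this] eventually_ge_at_top[of j] show ?thesis
    proof eventually_elim
      case (elim n)
      then have "j \<in> J n" by (auto simp: J_def)
      then have "J n \<noteq> {}" "j \<le> Max (J n)" using Max_ge[OF fJ] by auto
      then have "1 / real (Suc (Max (J n))) \<le> 1 / real (Suc j)" by (intro divide_left_mono) auto
      then have "1 / real (Suc (Max (J n))) \<le> \<delta>" using j by (simp add: inverse_eq_divide)
      then show ?case using mono us[OF \<open>J n \<noteq> {}\<close>] by blast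
    qed
  qed
  moreover have "us n = u0 \<or> (\<exists>\<delta>. P n \<delta> (us n))" for n
    using us[of n] by (cases "J n = {}") (auto simp: us_def)
  ultimately show ?thesis by blast
qed

lemma recovery_sequence:
  assumes ab: "a < b" and p: "1 \<le> p" and eps: "\<And>n. eps n > 0" "eps \<longlonglongrightarrow> 0"
    and u: "Lp_fun p a b u"
  shows "\<exists>us. (\<forall>n. Lp_fun p a b (us n)) \<and> Lp_conv p a b us u \<and>
    limsup (\<lambda>n. F_eps p a b (eps n) (us n)) \<le> F_lim p a b u"
proof (cases "BPV p a b u")
  case False
  then show ?thesis
    by (intro exI[of _ "\<lambda>_. u"]) (use u in \<open>simp add: Lp_conv_def F_lim_def\<close>)
next
  case True
  define P where "P n \<delta> U \<longleftrightarrow> Lp_fun p a b U \<and>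
    (\<integral>\<^sup>+x\<in>{a<..<b}. ennreal (\<bar>U x - u x\<bar> powr p) \<partial>lebesgue) \<le> ennreal \<delta> \<and>
    F_eps p a b (eps n) U \<le> F_lim p a b u + ereal \<delta>" for n \<delta> U
  have "\<exists>us. (\<forall>\<delta>>0. \<forall>\<^sub>F n in sequentially. P n \<delta> (us n)) \<and> (\<forall>n. us n = u \<or> (\<exists>\<delta>. P n \<delta> (us n)))"
  proof (rule diagonal_sequence)
    show "\<forall>\<^sub>F n in sequentially. \<exists>U. P n \<delta> U" if "\<delta> > 0" for \<delta>
      unfolding P_def by (rule recovery_eventually[OF ab p eps True that])
    show "P n \<delta>' U" if "P n \<delta> U" "\<delta> \<le> \<delta>'" for n \<delta> \<delta>' U
    proof -
      have "ennreal \<delta> \<le> ennreal \<delta>'" "F_lim p a b u + ereal \<delta> \<le> F_lim p a b u + ereal \<delta>'"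
        using that(2) by (auto intro: ennreal_leI add_left_mono)
      then show ?thesis using that(1) unfolding P_def by (meson order_trans)
    qed
  qed
  then obtain us where us: "\<And>\<delta>. \<delta> > 0 \<Longrightarrow> \<forall>\<^sub>F n in sequentially. P n \<delta> (us n)" "\<And>n. us n = u \<or> (\<exists>\<delta>. P n \<delta> (us n))"
    by blast
  have "Lp_fun p a b (us n)" for n using us(2)[of n] u by (auto simp: P_def)
  moreover have "Lp_conv p a b us u"
    unfolding Lp_conv_def
  proof (rule order_tendstoI)
    fix y :: ennreal assume y: "0 < y"
    then obtain z where z: "0 < z" "z < y" using dense by blast
    then have "z < top" by (meson less_le_trans top_greatest)
    then obtain \<delta> where \<delta>: "z = ennreal \<delta>" "0 \<le> \<delta>" by (cases z) auto
    then have "\<delta> > 0" using z by auto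
    from us(1)[OF this]
    show "\<forall>\<^sub>F n in sequentially. (\<integral>\<^sup>+x\<in>{a<..<b}. ennreal (\<bar>us n x - u x\<bar> powr p) \<partial>lebesgue) < y"
      by (rule eventually_mono) (use \<delta> z in \<open>auto simp: P_def intro: le_less_trans\<close>)
  qed simp
  moreover have "limsup (\<lambda>n. F_eps p a b (eps n) (us n)) \<le> F_lim p a b u"
    unfolding Limsup_le_iff
  proof (intro allI impI)
    fix y assume y: "F_lim p a b u < y"
    obtain r where r: "F_lim p a b u < ereal r" "ereal r < y" using ereal_dense2[OF y] by blast
    have "\<exists>\<delta>>0. F_lim p a b u + ereal \<delta> \<le> ereal r"
    proof (cases "F_lim p a b u")
      case (real f)
      then show ?thesis using r(1) by (intro exI[of _ "r - f"]) auto
    next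
      case MInf
      then show ?thesis by (intro exI[of _ 1]) auto
    qed (use r in auto)
    then obtain \<delta> where \<delta>: "\<delta> > 0" "F_lim p a b u + ereal \<delta> \<le> ereal r" by blast
    from us(1)[OF \<delta>(1)] show "\<forall>\<^sub>F n in sequentially. F_eps p a b (eps n) (us n) < y"
    proof eventually_elim
      case (elim n)
      then have "F_eps p a b (eps n) (us n) \<le> F_lim p a b u + ereal \<delta>" by (simp add: P_def)
      then show ?case using \<delta>(2) r(2) by (meson le_less_trans order_trans)
    qed
  qed
  ultimately show ?thesis by blast
qed

theorem theorem3p5:
  fixes a b p :: real and eps :: "nat \<Rightarrow> real"
  assumes "a < b" and "1 \<le> p"
    and "\<forall>n. eps n > 0" and "eps \<longlonglongrightarrow> 0"
  shows "Gamma_conv_Lp p a b (\<lambda>n. F_eps p a b (eps n)) (F_lim p a b)"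
  unfolding Gamma_conv_Lp_def Lp_space_def mem_Collect_eq
proof (intro ballI conjI allI impI)
  fix u assume "u \<in> {u. Lp_fun p a b u}"
  then have u: "Lp_fun p a b u" by simp
  show "\<exists>us. (\<forall>n. Lp_fun p a b (us n)) \<and> Lp_conv p a b us u \<and>
      limsup (\<lambda>n. F_eps p a b (eps n) (us n)) \<le> F_lim p a b u"
    by (rule recovery_sequence[OF assms(1,2) _ assms(4) u]) (use assms(3) in blast)
  fix us assume us: "\<forall>n. Lp_fun p a b (us n)" "Lp_conv p a b us u"
  show "F_lim p a b u \<le> liminf (\<lambda>n. F_eps p a b (eps n) (us n))"
    by (rule F_lim_le_liminf[OF assms(1) u _ us(2) assms(2) _ assms(4)]) (use us(1) assms(3) in blast)+
qed

end
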